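(* Let $\mathbf{k}$ be a field and let $H=(H,m_H,\Delta_H,\alpha_H,\psi_H)$ be a hom-bialgebra over $\mathbf{k}$ with $\alpha_H=\psi_H$ and $\alpha_H$ bijective. Then the category ${}_H^H\mathbb{YD}$ of Yetter-Drinfeld modules over $H$ may be organized as a hom-braided category with tensor product $\hat\otimes$ and hom-braiding the family of maps $$B_{M,N}:M\otimes N\to N\otimes M,\qquad B_{M,N}(m\otimes n)=\sum\alpha_H^{-1}(m_{(-1)})\cdot n\otimes m_{(0)}.$$ That is, there exist functors $F,G:{}_H^H\mathbb{YD}\to{}_H^H\mathbb{YD}$ (which leave underlying vector spaces and underlying linear maps unchanged, so that $B_{M,N}$ may be regarded as a map $M\hat\otimes N\to G(N)\hat\otimes G(M)$), a natural isomorphism $a$ and a natural transformation $\Phi$ such that $({}_H^H\mathbb{YD},\hat\otimes,F,G,a,\Phi,B)$ is a hom-braided category.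
   Context: All vector spaces, tensor products and linear maps are over $\mathbf{k}$; algebras and coalgebras are not assumed (co)unital. A hom-associative $\mathbf{k}$-algebra is a triple $(A,m_A,\alpha_A)$ with $m_A:A\otimes A\to A$ linear (written $ab$) and $\alpha_A:A\to A$ linear such that $\alpha_A(ab)=\alpha_A(a)\alpha_A(b)$ and $\alpha_A(a)(bc)=(ab)\alpha_A(c)$. A morphism is a linear map commuting with multiplications and structure maps; $A\otimes A$ is hom-associative with componentwise multiplication and structure map $\alpha_A\otimes\alpha_A$. A hom-coassociative coalgebra is $(C,\Delta_C,\psi_C)$ with $\Delta_C:C\to C\otimes C$, $\psi_C:C\to C$ linear, $(\psi_C\otimes\psi_C)\circ\Delta_C=\Delta_C\circ\psi_C$ and $(\Delta_C\otimes\psi_C)\circ\Delta_C=(\psi_C\otimes\Delta_C)\circ\Delta_C$; morphisms commute with comultiplications and structure maps. A hom-bialgebra $(B,m_B,\Delta_B,\alpha_B,\psi_B)$ consists of a hom-associative algebra $(B,m_B,\alpha_B)$ and a hom-coassociative coalgebra $(B,\Delta_B,\psi_B)$ such that $\Delta_B$ and $\psi_B$ are morphisms of hom-associative algebras and $\alpha_B$ is a morphism of hom-coassociative coalgebras. Notation: $\Delta_H(h)=\sum h_{(1)}\otimes h_{(2)}$. Left $H$-module: a pair $(M,\alpha_M)$, $\alpha_M:M\to M$ linear, with a linear action $H\otimes M\to M$, $h\otimes m\mapsto h\cdot m$, such that $\alpha_M(h\cdot m)=\alpha_H(h)\cdot\alpha_M(m)$ and $\alpha_H(h)\cdot(h'\cdot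 m)=(hh')\cdot\alpha_M(m)$. Morphisms are linear maps commuting with the actions and with the maps $\alpha_M$. Left $H$-comodule (here $\psi_H=\alpha_H$): a pair $(M,\alpha_M)$ with a linear map $\lambda_M:M\to H\otimes M$, $\lambda_M(m)=\sum m_{(-1)}\otimes m_{(0)}$, such that $(\alpha_H\otimes\alpha_M)\circ\lambda_M=\lambda_M\circ\alpha_M$ and $(\Delta_H\otimes\alpha_M)\circ\lambda_M=(\alpha_H\otimes\lambda_M)\circ\lambda_M$. Morphisms $g:M\to N$ are linear maps with $\alpha_N\circ g=g\circ\alpha_M$ and $(\mathrm{id}_H\otimes g)\circ\lambda_M=\lambda_N\circ g$. Yetter-Drinfeld module over $H$: a pair $(M,\alpha_M)$ that is both a left $H$-module and a left $H$-comodule (with the same $\alpha_M$), such that for all $h\in H$, $m\in M$, $$\sum(h_{(1)}\cdot m)_{(-1)}\alpha_H^2(h_{(2)})\otimes(h_{(1)}\cdot m)_{(0)}=\sum\alpha_H^2(h_{(1)})\alpha_H(m_{(-1)})\otimes\alpha_H(h_{(2)})\cdot m_{(0)}.$$ ${}_H^H\mathbb{YD}$ is the category of Yetter-Drinfeld modules over $H$, whose morphisms are the linear maps that are morphisms of both left $H$-modules and left $H$-comodules. Tensor product: for $(M,\alpha_M),(N,\alpha_N)\in{}_H^H\mathbb{YD}$, $M\hat\otimes N$ is $(M\otimes N,\alpha_M\otimes\alpha_N)$ with action $h\cdot(m\otimes n)=\sum h_{(1)}\cdot m\otimes h_{(2)}\cdot n$ and coaction $m\otimes n\mapsto\sum\alpha_H^{-2}(m_{(-1)}n_{(-1)})\otimes(m_{(0)}\otimes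 n_{(0)})$; it is known that this is again a Yetter-Drinfeld module over $H$. On morphisms $\hat\otimes$ is the usual tensor product of linear maps. A hom-tensor category is a 6-tuple $(\mathcal{C},\otimes,F,G,a,\Phi)$ where: $\mathcal{C}$ is a category; $\otimes:\mathcal{C}\times\mathcal{C}\to\mathcal{C}$ is a functor; $F,G:\mathcal{C}\to\mathcal{C}$ are functors with $F(U\otimes V)=F(U)\otimes F(V)$, $F(f\otimes g)=F(f)\otimes F(g)$, and likewise for $G$; $FG=GF$; $a_{X,Y,Z}:(X\otimes Y)\otimes F(Z)\to F(X)\otimes(Y\otimes Z)$ is a natural isomorphism with $a_{F(X),F(Y),Z\otimes T}\circ a_{X\otimes Y,F(Z),F(T)}=(\mathrm{id}_{F^2(X)}\otimes a_{Y,Z,T})\circ a_{F(X),Y\otimes Z,F(T)}\circ(a_{X,Y,Z}\otimes \mathrm{id}_{F^2(T)})$; $\Phi:\mathrm{id}_{\mathcal{C}}\to G$ is a natural transformation with $F(\Phi_U)=\Phi_{F(U)}$, $G(\Phi_U)=\Phi_{G(U)}$, $\Phi_{M\otimes N}=\Phi_M\otimes\Phi_N$. A hom-braiding $d$ in a hom-tensor category is a family of morphisms $d_{V,W}:V\otimes W\to G(W)\otimes G(V)$, natural in $V,W$ (i.e. $(G(g)\otimes G(f))\circ d_{V,W}=d_{V',W'}\circ(f\otimes g)$ for $f:V\to V'$, $g:W\to W'$), not required to be invertible, with $G(d_{U,V})=d_{G(U),G(V)}$ and satisfying for all objects $U,V,W$: (H1) $(\mathrm{id}_{FG(V)}\otimes(\mathrm{id}_{G(W)}\otimes\Phi_{G(U)}))\circ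 a_{G(V),G(W),G(U)}\circ d_{F(U),V\otimes W}\circ a_{U,V,W}=(\mathrm{id}_{FG(V)}\otimes d_{G(U),W})\circ a_{G(V),G(U),W}\circ(d_{U,V}\otimes\mathrm{id}_{F(W)})$; (H2) $((\Phi_{G(W)}\otimes\mathrm{id}_{G(U)})\otimes\mathrm{id}_{FG(V)})\circ a^{-1}_{G(W),G(U),G(V)}\circ d_{U\otimes V,F(W)}\circ a^{-1}_{U,V,W}=(d_{U,G(W)}\otimes\mathrm{id}_{FG(V)})\circ a^{-1}_{U,G(W),G(V)}\circ(\mathrm{id}_{F(U)}\otimes d_{V,W})$. A hom-braided category is a hom-tensor category with a hom-braiding. *)

theory Defs
  imports "HOL-Algebra.Module" "HOL-Library.FuncSet"
begin

section \<open>Vector spaces and their tensor products\<close>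

text \<open>
  Vector spaces over a field \<open>K\<close> are the modules of \<open>HOL-Algebra\<close> over \<open>K\<close>. (The fields
  \<open>mult\<close> and \<open>one\<close> of the module record play no role.)

  A category of vector spaces that is strictly closed under a tensor product needs all
  underlying sets to live in one type. The following type consists of an arbitrary supply
  \<open>'a\<close> of basic elements and is closed under formation of formal sums
  \<open>v\<^sub>1 \<otimes> w\<^sub>1 + \<dots> + v\<^sub>n \<otimes> w\<^sub>n\<close>, represented as lists of pairs. Since \<open>'a\<close> is arbitrary,
  every vector space on a HOL type occurs, up to renaming its elements.
\<close>

datatype 'a tuniv = Atom 'a | Formal "('a tuniv \<times> 'a tuniv) list"

primrec terms :: "'a tuniv \<Rightarrow> ('a tuniv \<times> 'a tuniv) list" where
  "terms (Atom a) = []"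
| "terms (Formal xs) = xs"

text \<open>
  Sweedler sums: for \<open>t = v\<^sub>1 \<otimes> w\<^sub>1 + \<dots> + v\<^sub>n \<otimes> w\<^sub>n\<close>, \<open>tsum X \<beta> t\<close> is the element
  \<open>\<beta> v\<^sub>1 w\<^sub>1 + \<dots> + \<beta> v\<^sub>n w\<^sub>n\<close> of \<open>X\<close>. If \<open>\<beta>\<close> is bilinear, this is the value at \<open>t\<close> of the
  linear map induced by \<open>\<beta>\<close>, and it does not depend on the representation of \<open>t\<close>.
\<close>

definition tsum ::
  "('k, 'u) module \<Rightarrow> ('a tuniv \<Rightarrow> 'a tuniv \<Rightarrow> 'u) \<Rightarrow> 'a tuniv \<Rightarrow> 'u" where
  "tsum X \<beta> t = foldr (\<lambda>(v, w) s. \<beta> v w \<oplus>\<^bsub>X\<^esub> s) (terms t) \<zero>\<^bsub>X\<^esub>"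

context
  fixes K :: "('k, 'r) ring_scheme"
begin

text \<open>Linear maps are extensional, so that they are equal iff they agree on their domain.\<close>

definition linear_maps :: "('k, 'u) module \<Rightarrow> ('k, 'v) module \<Rightarrow> ('u \<Rightarrow> 'v) set" where
  "linear_maps V W =
    {f \<in> carrier V \<rightarrow>\<^sub>E carrier W.
       (\<forall>x\<in>carrier V. \<forall>y\<in>carrier V. f (x \<oplus>\<^bsub>V\<^esub> y) = f x \<oplus>\<^bsub>W\<^esub> f y) \<and>
       (\<forall>c\<in>carrier K. \<forall>x\<in>carrier V. f (c \<odot>\<^bsub>V\<^esub> x) = c \<odot>\<^bsub>W\<^esub> f x)}"

text \<open>
  \<open>V \<otimes> W\<close> is the additive group generated by the symbols \<open>v \<otimes> w\<close> subject to bilinearity.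
  Scalars are absorbed into the generators, so an element is a class of lists
  of pairs modulo the following congruence.
\<close>

inductive tensor_cong ::
  "('k, 'u) module \<Rightarrow> ('k, 'v) module \<Rightarrow> ('u \<times> 'v) list \<Rightarrow> ('u \<times> 'v) list \<Rightarrow> bool"
  for V W where
  refl: "set xs \<subseteq> carrier V \<times> carrier W \<Longrightarrow> tensor_cong V W xs xs"
| sym: "tensor_cong V W xs ys \<Longrightarrow> tensor_cong V W ys xs"
| trans: "tensor_cong V W xs ys \<Longrightarrow> tensor_cong V W ys zs \<Longrightarrow> tensor_cong V W xs zs"
| append: "tensor_cong V W xs xs' \<Longrightarrow> tensor_cong V W ys ys' \<Longrightarrow>
    tensor_cong V W (xs @ ys) (xs' @ ys')"
| commute: "set xs \<subseteq> carrier V \<times> carrier W \<Longrightarrow> set ys \<subseteq> carrier V \<times> carrier W \<Longrightarrow>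
    tensor_cong V W (xs @ ys) (ys @ xs)"
| add_left: "v \<in> carrier V \<Longrightarrow> v' \<in> carrier V \<Longrightarrow> w \<in> carrier W \<Longrightarrow>
    tensor_cong V W [(v \<oplus>\<^bsub>V\<^esub> v', w)] [(v, w), (v', w)]"
| add_right: "v \<in> carrier V \<Longrightarrow> w \<in> carrier W \<Longrightarrow> w' \<in> carrier W \<Longrightarrow>
    tensor_cong V W [(v, w \<oplus>\<^bsub>W\<^esub> w')] [(v, w), (v, w')]"
| scalar: "c \<in> carrier K \<Longrightarrow> v \<in> carrier V \<Longrightarrow> w \<in> carrier W \<Longrightarrow>
    tensor_cong V W [(c \<odot>\<^bsub>V\<^esub> v, w)] [(v, c \<odot>\<^bsub>W\<^esub> w)]"
| zero: "w \<in> carrier W \<Longrightarrow> tensor_cong V W [(\<zero>\<^bsub>V\<^esub>, w)] []"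

text \<open>
  A congruence class is represented by a chosen member, so that it is again an element of
  the type \<open>'a tuniv\<close>.
\<close>

definition tclass ::
  "('k, 'a tuniv) module \<Rightarrow> ('k, 'a tuniv) module \<Rightarrow> ('a tuniv \<times> 'a tuniv) list \<Rightarrow> 'a tuniv" where
  "tclass V W xs = Formal (SOME ys. tensor_cong V W xs ys)"

definition tensor ::
  "('k, 'a tuniv) module \<Rightarrow> ('k, 'a tuniv) module \<Rightarrow> ('k, 'a tuniv) module" where
  "tensor V W =
    \<lparr>carrier = tclass V W ` {xs. set xs \<subseteq> carrier V \<times> carrier W},
     monoid.mult = undefined,
     one = undefined,
     zero = tclass V W [],
     add = (\<lambda>s t. tclass V W (terms s @ terms t)),
     smult = (\<lambda>c t. tclass V W (map (\<lambda>(v, w). (c \<odot>\<^bsub>V\<^esub> v, w)) (terms t)))\<rparr>"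

text \<open>\<open>pure V W v w\<close> is \<open>v \<otimes> w\<close>.\<close>

definition pure ::
  "('k, 'a tuniv) module \<Rightarrow> ('k, 'a tuniv) module \<Rightarrow> 'a tuniv \<Rightarrow> 'a tuniv \<Rightarrow> 'a tuniv" where
  "pure V W v w = tclass V W [(v, w)]"

text \<open>\<open>tensor_map V W V' W' f g\<close> is \<open>f \<otimes> g\<close> for \<open>f: V \<rightarrow> V'\<close> and \<open>g: W \<rightarrow> W'\<close>.\<close>

definition tensor_map ::
  "('k, 'a tuniv) module \<Rightarrow> ('k, 'a tuniv) module \<Rightarrow> ('k, 'a tuniv) module \<Rightarrow> ('k, 'a tuniv) module \<Rightarrow>
   ('a tuniv \<Rightarrow> 'a tuniv) \<Rightarrow> ('a tuniv \<Rightarrow> 'a tuniv) \<Rightarrow> 'a tuniv \<Rightarrow> 'a tuniv" where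
  "tensor_map V W V' W' f g =
    (\<lambda>t\<in>carrier (tensor V W). tsum (tensor V' W') (\<lambda>v w. pure V' W' (f v) (g w)) t)"

text \<open>
  The canonical map \<open>(U \<otimes> V) \<otimes> W \<rightarrow> U \<otimes> (V \<otimes> W)\<close>, which is left implicit in formulas such as
  \<open>(\<Delta> \<otimes> \<psi>) \<circ> \<Delta> = (\<psi> \<otimes> \<Delta>) \<circ> \<Delta>\<close>.
\<close>

definition tassoc ::
  "('k, 'a tuniv) module \<Rightarrow> ('k, 'a tuniv) module \<Rightarrow> ('k, 'a tuniv) module \<Rightarrow> 'a tuniv \<Rightarrow> 'a tuniv" where
  "tassoc U V W =
    (\<lambda>t\<in>carrier (tensor (tensor U V) W).
       tsum (tensor U (tensor V W))
         (\<lambda>s w. tsum (tensor U (tensor V W))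
            (\<lambda>u v. pure U (tensor V W) u (pure V W v w)) s) t)"


section \<open>Hom-bialgebras\<close>

definition hom_assoc_algebra ::
  "('k, 'a tuniv) module \<Rightarrow> ('a tuniv \<Rightarrow> 'a tuniv) \<Rightarrow> ('a tuniv \<Rightarrow> 'a tuniv) \<Rightarrow> bool" where
  "hom_assoc_algebra A m \<alpha> \<longleftrightarrow>
    module K A \<and> m \<in> linear_maps (tensor A A) A \<and> \<alpha> \<in> linear_maps A A \<and>
    (\<forall>a\<in>carrier A. \<forall>b\<in>carrier A.
       \<alpha> (m (pure A A a b)) = m (pure A A (\<alpha> a) (\<alpha> b))) \<and>
    (\<forall>a\<in>carrier A. \<forall>b\<in>carrier A. \<forall>c\<in>carrier A.
       m (pure A A (\<alpha> a) (m (pure A A b c))) = m (pure A A (m (pure A A a b)) (\<alpha> c)))"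

definition hom_algebra_morphism ::
  "('k, 'a tuniv) module \<Rightarrow> ('a tuniv \<Rightarrow> 'a tuniv) \<Rightarrow> ('a tuniv \<Rightarrow> 'a tuniv) \<Rightarrow>
   ('k, 'a tuniv) module \<Rightarrow> ('a tuniv \<Rightarrow> 'a tuniv) \<Rightarrow> ('a tuniv \<Rightarrow> 'a tuniv) \<Rightarrow>
   ('a tuniv \<Rightarrow> 'a tuniv) \<Rightarrow> bool" where
  "hom_algebra_morphism A m \<alpha> B n \<beta> f \<longleftrightarrow>
    f \<in> linear_maps A B \<and>
    (\<forall>a\<in>carrier A. \<forall>b\<in>carrier A. f (m (pure A A a b)) = n (pure B B (f a) (f b))) \<and>
    (\<forall>a\<in>carrier A. f (\<alpha> a) = \<beta> (f a))"

text \<open>The componentwise multiplication on \<open>A \<otimes> A\<close>, as a map on \<open>(A \<otimes> A) \<otimes> (A \<otimes> A)\<close>.\<close>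

definition tensor_mult ::
  "('k, 'a tuniv) module \<Rightarrow> ('a tuniv \<Rightarrow> 'a tuniv) \<Rightarrow> 'a tuniv \<Rightarrow> 'a tuniv" where
  "tensor_mult A m =
    (\<lambda>t\<in>carrier (tensor (tensor A A) (tensor A A)).
       tsum (tensor A A)
         (\<lambda>s s'. tsum (tensor A A)
            (\<lambda>a b. tsum (tensor A A)
               (\<lambda>a' b'. pure A A (m (pure A A a a')) (m (pure A A b b'))) s') s) t)"

definition hom_coassoc_coalgebra ::
  "('k, 'a tuniv) module \<Rightarrow> ('a tuniv \<Rightarrow> 'a tuniv) \<Rightarrow> ('a tuniv \<Rightarrow> 'a tuniv) \<Rightarrow> bool" where
  "hom_coassoc_coalgebra C \<Delta> \<psi> \<longleftrightarrow>
    module K C \<and> \<Delta> \<in> linear_maps C (tensor C C) \<and> \<psi> \<in> linear_maps C C \<and>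
    (\<forall>c\<in>carrier C. tensor_map C C C C \<psi> \<psi> (\<Delta> c) = \<Delta> (\<psi> c)) \<and>
    (\<forall>c\<in>carrier C.
       tassoc C C C (tensor_map C C (tensor C C) C \<Delta> \<psi> (\<Delta> c)) =
       tensor_map C C C (tensor C C) \<psi> \<Delta> (\<Delta> c))"

definition hom_coalgebra_morphism ::
  "('k, 'a tuniv) module \<Rightarrow> ('a tuniv \<Rightarrow> 'a tuniv) \<Rightarrow> ('a tuniv \<Rightarrow> 'a tuniv) \<Rightarrow>
   ('k, 'a tuniv) module \<Rightarrow> ('a tuniv \<Rightarrow> 'a tuniv) \<Rightarrow> ('a tuniv \<Rightarrow> 'a tuniv) \<Rightarrow>
   ('a tuniv \<Rightarrow> 'a tuniv) \<Rightarrow> bool" where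
  "hom_coalgebra_morphism C \<Delta> \<psi> D \<Delta>' \<psi>' f \<longleftrightarrow>
    f \<in> linear_maps C D \<and>
    (\<forall>c\<in>carrier C. tensor_map C C D D f f (\<Delta> c) = \<Delta>' (f c)) \<and>
    (\<forall>c\<in>carrier C. f (\<psi> c) = \<psi>' (f c))"

end

record ('k, 'u) hom_bialg =
  hspace :: "('k, 'u) module"
  hmult :: "'u \<Rightarrow> 'u"
  hcomult :: "'u \<Rightarrow> 'u"
  halpha :: "'u \<Rightarrow> 'u"
  hpsi :: "'u \<Rightarrow> 'u"

definition hom_bialgebra ::
  "('k, 'r) ring_scheme \<Rightarrow> ('k, 'a tuniv) hom_bialg \<Rightarrow> bool" where
  "hom_bialgebra K B \<longleftrightarrow>
    hom_assoc_algebra K (hspace B) (hmult B) (halpha B) \<and>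
    hom_coassoc_coalgebra K (hspace B) (hcomult B) (hpsi B) \<and>
    hom_algebra_morphism K
      (hspace B) (hmult B) (halpha B)
      (tensor K (hspace B) (hspace B)) (tensor_mult K (hspace B) (hmult B))
      (tensor_map K (hspace B) (hspace B) (hspace B) (hspace B) (halpha B) (halpha B))
      (hcomult B) \<and>
    hom_algebra_morphism K
      (hspace B) (hmult B) (halpha B) (hspace B) (hmult B) (halpha B) (hpsi B) \<and>
    hom_coalgebra_morphism K
      (hspace B) (hcomult B) (hpsi B) (hspace B) (hcomult B) (hpsi B) (halpha B)"


section \<open>Yetter-Drinfeld modules\<close>

record ('k, 'u) yd_module =
  mspace :: "('k, 'u) module"
  malpha :: "'u \<Rightarrow> 'u"
  maction :: "'u \<Rightarrow> 'u"
  mcoaction :: "'u \<Rightarrow> 'u"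

type_synonym ('k, 'u) yd_arrow = "('k, 'u) yd_module \<times> ('u \<Rightarrow> 'u) \<times> ('k, 'u) yd_module"

context
  fixes K :: "('k, 'r) ring_scheme"
    and H :: "('k, 'a tuniv) hom_bialg"
begin

abbreviation (input) HH :: "('k, 'a tuniv) module" where
  "HH \<equiv> hspace H"

abbreviation (input) \<alpha>\<^sub>H :: "'a tuniv \<Rightarrow> 'a tuniv" where
  "\<alpha>\<^sub>H \<equiv> halpha H"

definition \<alpha>\<^sub>H_inv :: "'a tuniv \<Rightarrow> 'a tuniv" where
  "\<alpha>\<^sub>H_inv = inv_into (carrier HH) \<alpha>\<^sub>H"

definition hprod :: "'a tuniv \<Rightarrow> 'a tuniv \<Rightarrow> 'a tuniv" where
  "hprod g h = hmult H (pure K HH HH g h)"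

definition act :: "('k, 'a tuniv) yd_module \<Rightarrow> 'a tuniv \<Rightarrow> 'a tuniv \<Rightarrow> 'a tuniv" where
  "act M h m = maction M (pure K HH (mspace M) h m)"

definition left_module :: "('k, 'a tuniv) yd_module \<Rightarrow> bool" where
  "left_module M \<longleftrightarrow>
    module K (mspace M) \<and>
    malpha M \<in> linear_maps K (mspace M) (mspace M) \<and>
    maction M \<in> linear_maps K (tensor K HH (mspace M)) (mspace M) \<and>
    (\<forall>h\<in>carrier HH. \<forall>m\<in>carrier (mspace M).
       malpha M (act M h m) = act M (\<alpha>\<^sub>H h) (malpha M m)) \<and>
    (\<forall>h\<in>carrier HH. \<forall>h'\<in>carrier HH. \<forall>m\<in>carrier (mspace M).
       act M (\<alpha>\<^sub>H h) (act M h' m) = act M (hprod h h') (malpha M m))"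

text \<open>Comodules are considered for \<open>\<psi>\<^sub>H = \<alpha>\<^sub>H\<close> only; the axioms are stated with \<open>\<alpha>\<^sub>H\<close>.\<close>

definition left_comodule :: "('k, 'a tuniv) yd_module \<Rightarrow> bool" where
  "left_comodule M \<longleftrightarrow>
    module K (mspace M) \<and>
    malpha M \<in> linear_maps K (mspace M) (mspace M) \<and>
    mcoaction M \<in> linear_maps K (mspace M) (tensor K HH (mspace M)) \<and>
    (\<forall>m\<in>carrier (mspace M).
       tensor_map K HH (mspace M) HH (mspace M) \<alpha>\<^sub>H (malpha M) (mcoaction M m) =
       mcoaction M (malpha M m)) \<and>
    (\<forall>m\<in>carrier (mspace M).
       tassoc K HH HH (mspace M)
         (tensor_map K HH (mspace M) (tensor K HH HH) (mspace M)
            (hcomult H) (malpha M) (mcoaction M m)) =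
       tensor_map K HH (mspace M) HH (tensor K HH (mspace M))
         \<alpha>\<^sub>H (mcoaction M) (mcoaction M m))"

text \<open>
  In the sums below, \<open>h\<^sub>1, h\<^sub>2\<close> stand for \<open>h\<^sub>(\<^sub>1\<^sub>), h\<^sub>(\<^sub>2\<^sub>)\<close> and \<open>p, q\<close> for the legs
  \<open>m\<^sub>(\<^sub>-\<^sub>1\<^sub>), m\<^sub>(\<^sub>0\<^sub>)\<close> of a coaction.
\<close>

definition yetter_drinfeld :: "('k, 'a tuniv) yd_module \<Rightarrow> bool" where
  "yetter_drinfeld M \<longleftrightarrow>
    left_module M \<and> left_comodule M \<and>
    (\<forall>h\<in>carrier HH. \<forall>m\<in>carrier (mspace M).
       tsum (tensor K HH (mspace M))
         (\<lambda>h\<^sub>1 h\<^sub>2. tsum (tensor K HH (mspace M))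
            (\<lambda>p q. pure K HH (mspace M) (hprod p (\<alpha>\<^sub>H (\<alpha>\<^sub>H h\<^sub>2))) q)
            (mcoaction M (act M h\<^sub>1 m)))
         (hcomult H h) =
       tsum (tensor K HH (mspace M))
         (\<lambda>h\<^sub>1 h\<^sub>2. tsum (tensor K HH (mspace M))
            (\<lambda>p q. pure K HH (mspace M)
               (hprod (\<alpha>\<^sub>H (\<alpha>\<^sub>H h\<^sub>1)) (\<alpha>\<^sub>H p)) (act M (\<alpha>\<^sub>H h\<^sub>2) q))
            (mcoaction M m))
         (hcomult H h))"

definition yd_morphism ::
  "('k, 'a tuniv) yd_module \<Rightarrow> ('k, 'a tuniv) yd_module \<Rightarrow> ('a tuniv \<Rightarrow> 'a tuniv) \<Rightarrow> bool" where
  "yd_morphism M N f \<longleftrightarrow>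
    f \<in> linear_maps K (mspace M) (mspace N) \<and>
    (\<forall>m\<in>carrier (mspace M). f (malpha M m) = malpha N (f m)) \<and>
    (\<forall>h\<in>carrier HH. \<forall>m\<in>carrier (mspace M). f (act M h m) = act N h (f m)) \<and>
    (\<forall>m\<in>carrier (mspace M).
       tensor_map K HH (mspace M) HH (mspace N) (\<lambda>h\<in>carrier HH. h) f (mcoaction M m) =
       mcoaction N (f m))"

definition yd_tensor ::
  "('k, 'a tuniv) yd_module \<Rightarrow> ('k, 'a tuniv) yd_module \<Rightarrow> ('k, 'a tuniv) yd_module" where
  "yd_tensor M N =
    (let MN = tensor K (mspace M) (mspace N) in
     \<lparr>mspace = MN,
      malpha =
        tensor_map K (mspace M) (mspace N) (mspace M) (mspace N) (malpha M) (malpha N),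
      maction =
        (\<lambda>x\<in>carrier (tensor K HH MN).
           tsum MN
             (\<lambda>h t. tsum MN
                (\<lambda>h\<^sub>1 h\<^sub>2. tsum MN
                   (\<lambda>m n. pure K (mspace M) (mspace N) (act M h\<^sub>1 m) (act N h\<^sub>2 n)) t)
                (hcomult H h)) x),
      mcoaction =
        (\<lambda>t\<in>carrier MN.
           tsum (tensor K HH MN)
             (\<lambda>m n. tsum (tensor K HH MN)
                (\<lambda>p q. tsum (tensor K HH MN)
                   (\<lambda>r s. pure K HH MN
                      (\<alpha>\<^sub>H_inv (\<alpha>\<^sub>H_inv (hprod p r)))
                      (pure K (mspace M) (mspace N) q s))
                   (mcoaction N n))
                (mcoaction M m)) t)\<rparr>)"

definition yd_braiding ::
  "('k, 'a tuniv) yd_module \<Rightarrow> ('k, 'a tuniv) yd_module \<Rightarrow> 'a tuniv \<Rightarrow> 'a tuniv" where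
  "yd_braiding M N =
    (\<lambda>t\<in>carrier (tensor K (mspace M) (mspace N)).
       tsum (tensor K (mspace N) (mspace M))
         (\<lambda>m n. tsum (tensor K (mspace N) (mspace M))
            (\<lambda>p q. pure K (mspace N) (mspace M) (act N (\<alpha>\<^sub>H_inv p) n) q)
            (mcoaction M m)) t)"

end


section \<open>Categories\<close>

text \<open>\<open>Comp C g f\<close> is \<open>g \<circ> f\<close>.\<close>

record ('o, 'm) category =
  Obj :: "'o set"
  Arr :: "'m set"
  Dom :: "'m \<Rightarrow> 'o"
  Cod :: "'m \<Rightarrow> 'o"
  Id :: "'o \<Rightarrow> 'm"
  Comp :: "'m \<Rightarrow> 'm \<Rightarrow> 'm"

definition Hom :: "('o, 'm) category \<Rightarrow> 'o \<Rightarrow> 'o \<Rightarrow> 'm set" where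
  "Hom C X Y = {f \<in> Arr C. Dom C f = X \<and> Cod C f = Y}"

locale category =
  fixes C :: "('o, 'm) category"
  assumes Dom_Obj: "f \<in> Arr C \<Longrightarrow> Dom C f \<in> Obj C"
    and Cod_Obj: "f \<in> Arr C \<Longrightarrow> Cod C f \<in> Obj C"
    and Id_Hom: "X \<in> Obj C \<Longrightarrow> Id C X \<in> Hom C X X"
    and Comp_Hom: "f \<in> Hom C X Y \<Longrightarrow> g \<in> Hom C Y Z \<Longrightarrow> Comp C g f \<in> Hom C X Z"
    and Comp_Id: "f \<in> Hom C X Y \<Longrightarrow> Comp C f (Id C X) = f"
    and Id_Comp: "f \<in> Hom C X Y \<Longrightarrow> Comp C (Id C Y) f = f"
    and Comp_assoc: "f \<in> Hom C W X \<Longrightarrow> g \<in> Hom C X Y \<Longrightarrow> h \<in> Hom C Y Z \<Longrightarrow>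
      Comp C h (Comp C g f) = Comp C (Comp C h g) f"

definition inverse_arrows :: "('o, 'm) category \<Rightarrow> 'm \<Rightarrow> 'm \<Rightarrow> bool" where
  "inverse_arrows C f g \<longleftrightarrow>
    f \<in> Arr C \<and> g \<in> Hom C (Cod C f) (Dom C f) \<and>
    Comp C g f = Id C (Dom C f) \<and> Comp C f g = Id C (Cod C f)"

definition iso_arrow :: "('o, 'm) category \<Rightarrow> 'm \<Rightarrow> bool" where
  "iso_arrow C f \<longleftrightarrow> (\<exists>g. inverse_arrows C f g)"

definition inverse_arrow :: "('o, 'm) category \<Rightarrow> 'm \<Rightarrow> 'm" where
  "inverse_arrow C f = (THE g. inverse_arrows C f g)"

definition product_category ::
  "('o, 'm) category \<Rightarrow> ('p, 'n) category \<Rightarrow> ('o \<times> 'p, 'm \<times> 'n) category" where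
  "product_category C D =
    \<lparr>Obj = Obj C \<times> Obj D,
     Arr = Arr C \<times> Arr D,
     Dom = map_prod (Dom C) (Dom D),
     Cod = map_prod (Cod C) (Cod D),
     Id = map_prod (Id C) (Id D),
     Comp = (\<lambda>(g, g') (f, f'). (Comp C g f, Comp D g' f'))\<rparr>"

record ('o, 'm, 'p, 'n) cat_functor =
  fobj :: "'o \<Rightarrow> 'p"
  farr :: "'m \<Rightarrow> 'n"

locale is_functor = C: category C + D: category D
  for C :: "('o, 'm) category" and D :: "('p, 'n) category"
    and F :: "('o, 'm, 'p, 'n) cat_functor" +
  assumes fobj_Obj: "X \<in> Obj C \<Longrightarrow> fobj F X \<in> Obj D"
    and farr_Hom: "f \<in> Hom C X Y \<Longrightarrow> farr F f \<in> Hom D (fobj F X) (fobj F Y)"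
    and farr_Id: "X \<in> Obj C \<Longrightarrow> farr F (Id C X) = Id D (fobj F X)"
    and farr_Comp: "f \<in> Hom C X Y \<Longrightarrow> g \<in> Hom C Y Z \<Longrightarrow>
      farr F (Comp C g f) = Comp D (farr F g) (farr F f)"

locale natural_transformation = S: is_functor C D S + T: is_functor C D T
  for C :: "('o, 'm) category" and D :: "('p, 'n) category"
    and S T :: "('o, 'm, 'p, 'n) cat_functor" and \<tau> :: "'o \<Rightarrow> 'n" +
  assumes component_Hom: "X \<in> Obj C \<Longrightarrow> \<tau> X \<in> Hom D (fobj S X) (fobj T X)"
    and natural: "f \<in> Hom C X Y \<Longrightarrow>
      Comp D (farr T f) (\<tau> X) = Comp D (\<tau> Y) (farr S f)"

locale natural_isomorphism = natural_transformation +
  assumes component_iso: "X \<in> Obj C \<Longrightarrow> iso_arrow D (\<tau> X)"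


section \<open>Hom-tensor categories and hom-braidings\<close>

locale hom_tensor_category =
  category C +
  T: is_functor "product_category C C" C T +
  F: is_functor C C F +
  G: is_functor C C G
  for C :: "('o, 'm) category"
    and T :: "('o \<times> 'o, 'm \<times> 'm, 'o, 'm) cat_functor"
    and F G :: "('o, 'm, 'o, 'm) cat_functor"
    and a :: "'o \<Rightarrow> 'o \<Rightarrow> 'o \<Rightarrow> 'm"
    and \<Phi> :: "'o \<Rightarrow> 'm" +
  fixes tobj :: "'o \<Rightarrow> 'o \<Rightarrow> 'o" (infixl \<open>\<otimes>\<^sub>o\<close> 70)
    and tarr :: "'m \<Rightarrow> 'm \<Rightarrow> 'm" (infixl \<open>\<otimes>\<^sub>a\<close> 70)
    and cmp :: "'m \<Rightarrow> 'm \<Rightarrow> 'm" (infixr \<open>\<bullet>\<close> 55)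
    and ident :: "'o \<Rightarrow> 'm" (\<open>\<iota>\<close>)
  defines "X \<otimes>\<^sub>o Y \<equiv> fobj T (X, Y)"
    and "f \<otimes>\<^sub>a g \<equiv> farr T (f, g)"
    and "g \<bullet> f \<equiv> Comp C g f"
    and "\<iota> X \<equiv> Id C X"
  assumes F_tensor_obj: "X \<in> Obj C \<Longrightarrow> Y \<in> Obj C \<Longrightarrow>
      fobj F (X \<otimes>\<^sub>o Y) = fobj F X \<otimes>\<^sub>o fobj F Y"
    and F_tensor_arr: "f \<in> Arr C \<Longrightarrow> g \<in> Arr C \<Longrightarrow>
      farr F (f \<otimes>\<^sub>a g) = farr F f \<otimes>\<^sub>a farr F g"
    and G_tensor_obj: "X \<in> Obj C \<Longrightarrow> Y \<in> Obj C \<Longrightarrow>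
      fobj G (X \<otimes>\<^sub>o Y) = fobj G X \<otimes>\<^sub>o fobj G Y"
    and G_tensor_arr: "f \<in> Arr C \<Longrightarrow> g \<in> Arr C \<Longrightarrow>
      farr G (f \<otimes>\<^sub>a g) = farr G f \<otimes>\<^sub>a farr G g"
    and FG_obj: "X \<in> Obj C \<Longrightarrow> fobj F (fobj G X) = fobj G (fobj F X)"
    and FG_arr: "f \<in> Arr C \<Longrightarrow> farr F (farr G f) = farr G (farr F f)"
    and a_natural_iso:
      "natural_isomorphism (product_category C (product_category C C)) C
         \<lparr>fobj = (\<lambda>(X, Y, Z). (X \<otimes>\<^sub>o Y) \<otimes>\<^sub>o fobj F Z),
          farr = (\<lambda>(f, g, h). (f \<otimes>\<^sub>a g) \<otimes>\<^sub>a farr F h)\<rparr>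
         \<lparr>fobj = (\<lambda>(X, Y, Z). fobj F X \<otimes>\<^sub>o (Y \<otimes>\<^sub>o Z)),
          farr = (\<lambda>(f, g, h). farr F f \<otimes>\<^sub>a (g \<otimes>\<^sub>a h))\<rparr>
         (\<lambda>(X, Y, Z). a X Y Z)"
    and hom_pentagon:
      "X \<in> Obj C \<Longrightarrow> Y \<in> Obj C \<Longrightarrow> Z \<in> Obj C \<Longrightarrow> U \<in> Obj C \<Longrightarrow>
         a (fobj F X) (fobj F Y) (Z \<otimes>\<^sub>o U) \<bullet> a (X \<otimes>\<^sub>o Y) (fobj F Z) (fobj F U) =
         (\<iota> (fobj F (fobj F X)) \<otimes>\<^sub>a a Y Z U) \<bullet>
           a (fobj F X) (Y \<otimes>\<^sub>o Z) (fobj F U) \<bullet>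
             (a X Y Z \<otimes>\<^sub>a \<iota> (fobj F (fobj F U)))"
    and \<Phi>_natural: "natural_transformation C C \<lparr>fobj = (\<lambda>X. X), farr = (\<lambda>f. f)\<rparr> G \<Phi>"
    and F_\<Phi>: "X \<in> Obj C \<Longrightarrow> farr F (\<Phi> X) = \<Phi> (fobj F X)"
    and G_\<Phi>: "X \<in> Obj C \<Longrightarrow> farr G (\<Phi> X) = \<Phi> (fobj G X)"
    and \<Phi>_tensor: "X \<in> Obj C \<Longrightarrow> Y \<in> Obj C \<Longrightarrow> \<Phi> (X \<otimes>\<^sub>o Y) = \<Phi> X \<otimes>\<^sub>a \<Phi> Y"

locale hom_braided_category = hom_tensor_category +
  fixes d :: "'a \<Rightarrow> 'a \<Rightarrow> 'b"
    and FG :: "'a \<Rightarrow> 'a"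
  defines "FG X \<equiv> fobj F (fobj G X)"
  assumes d_natural:
      "natural_transformation (product_category C C) C
         \<lparr>fobj = (\<lambda>(V, W). V \<otimes>\<^sub>o W), farr = (\<lambda>(f, g). f \<otimes>\<^sub>a g)\<rparr>
         \<lparr>fobj = (\<lambda>(V, W). fobj G W \<otimes>\<^sub>o fobj G V), farr = (\<lambda>(f, g). farr G g \<otimes>\<^sub>a farr G f)\<rparr>
         (\<lambda>(V, W). d V W)"
    and G_d: "U \<in> Obj C \<Longrightarrow> V \<in> Obj C \<Longrightarrow> farr G (d U V) = d (fobj G U) (fobj G V)"
    and H1: "U \<in> Obj C \<Longrightarrow> V \<in> Obj C \<Longrightarrow> W \<in> Obj C \<Longrightarrow>
      (\<iota> (FG V) \<otimes>\<^sub>a (\<iota> (fobj G W) \<otimes>\<^sub>a \<Phi> (fobj G U))) \<bullet>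
        a (fobj G V) (fobj G W) (fobj G U) \<bullet>
          d (fobj F U) (V \<otimes>\<^sub>o W) \<bullet>
            a U V W =
      (\<iota> (FG V) \<otimes>\<^sub>a d (fobj G U) W) \<bullet>
        a (fobj G V) (fobj G U) W \<bullet>
          (d U V \<otimes>\<^sub>a \<iota> (fobj F W))"
    and H2: "U \<in> Obj C \<Longrightarrow> V \<in> Obj C \<Longrightarrow> W \<in> Obj C \<Longrightarrow>
      ((\<Phi> (fobj G W) \<otimes>\<^sub>a \<iota> (fobj G U)) \<otimes>\<^sub>a \<iota> (FG V)) \<bullet>
        inverse_arrow C (a (fobj G W) (fobj G U) (fobj G V)) \<bullet>
          d (U \<otimes>\<^sub>o V) (fobj F W) \<bullet>
            inverse_arrow C (a U V W) =
      (d U (fobj G W) \<otimes>\<^sub>a \<iota> (FG V)) \<bullet>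
        inverse_arrow C (a U (fobj G W) (fobj G V)) \<bullet>
          (\<iota> (fobj F U) \<otimes>\<^sub>a d V W)"


section \<open>The category of Yetter-Drinfeld modules\<close>

definition yd_category ::
  "('k, 'r) ring_scheme \<Rightarrow> ('k, 'a tuniv) hom_bialg \<Rightarrow>
   (('k, 'a tuniv) yd_module, ('k, 'a tuniv) yd_arrow) category" where
  "yd_category K H =
    \<lparr>Obj = {M. yetter_drinfeld K H M},
     Arr = {(M, f, N). yetter_drinfeld K H M \<and> yetter_drinfeld K H N \<and> yd_morphism K H M N f},
     Dom = (\<lambda>(M, f, N). M),
     Cod = (\<lambda>(M, f, N). N),
     Id = (\<lambda>M. (M, \<lambda>m\<in>carrier (mspace M). m, M)),
     Comp = (\<lambda>(N', g, P) (M, f, N). (M, compose (carrier (mspace M)) g f, P))\<rparr>"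

definition yd_tensor_functor ::
  "('k, 'r) ring_scheme \<Rightarrow> ('k, 'a tuniv) hom_bialg \<Rightarrow>
   (('k, 'a tuniv) yd_module \<times> ('k, 'a tuniv) yd_module,
    ('k, 'a tuniv) yd_arrow \<times> ('k, 'a tuniv) yd_arrow,
    ('k, 'a tuniv) yd_module, ('k, 'a tuniv) yd_arrow) cat_functor" where
  "yd_tensor_functor K H =
    \<lparr>fobj = (\<lambda>(M, N). yd_tensor K H M N),
     farr = (\<lambda>((M, f, M'), (N, g, N')).
       (yd_tensor K H M N,
        tensor_map K (mspace M) (mspace N) (mspace M') (mspace N') f g,
        yd_tensor K H M' N'))\<rparr>"

text \<open>\<open>F\<close> changes neither underlying vector spaces nor underlying linear maps.\<close>

definition preserves_underlying ::
  "('k, 'r) ring_scheme \<Rightarrow> ('k, 'a tuniv) hom_bialg \<Rightarrow>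
   (('k, 'a tuniv) yd_module, ('k, 'a tuniv) yd_arrow,
    ('k, 'a tuniv) yd_module, ('k, 'a tuniv) yd_arrow) cat_functor \<Rightarrow> bool" where
  "preserves_underlying K H F \<longleftrightarrow>
    (\<forall>M\<in>Obj (yd_category K H). mspace (fobj F M) = mspace M) \<and>
    (\<forall>\<phi>\<in>Arr (yd_category K H). fst (snd (farr F \<phi>)) = fst (snd \<phi>))"

end

theory Submission
  imports Defs
begin

text \<open>
  The theorem asks for functors \<open>F\<close> and \<open>G\<close>, an associativity isomorphism and a transformation
  \<open>\<Phi>\<close>. All of them are dictated by the requirement that the obvious linear maps be morphisms.
  
  Hom-coassociativity says \<open>\<Sum> h\<^sub>1\<^sub>1 \<otimes> h\<^sub>1\<^sub>2 \<otimes> \<alpha>(h\<^sub>2) = \<Sum> \<alpha>(h\<^sub>1) \<otimes> h\<^sub>2\<^sub>1 \<otimes> h\<^sub>2\<^sub>2\<close>. Hence the ordinary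
  associativity map \<open>(x \<otimes> y) \<otimes> z \<mapsto> x \<otimes> (y \<otimes> z)\<close> commutes with the actions of \<open>H\<close> as soon as, on the
  left, \<open>h\<close> acts on \<open>z\<close> through \<open>\<alpha>(h)\<close> and, on the right, \<open>h\<close> acts on \<open>x\<close> through \<open>\<alpha>(h)\<close>. Comparing the two
  coactions by means of hom-associativity, one is led in the same way to compose the coactions
  of \<open>z\<close> and \<open>x\<close> with \<open>\<alpha>\<inverse>\<close>. So let \<open>twist M\<close> be \<open>M\<close> with the action \<open>\<alpha>(h) \<cdot> m\<close> and the coaction
  \<open>\<Sum> \<alpha>\<inverse>(m\<^sub>-\<^sub>1) \<otimes> m\<^sub>0\<close>, with the same space and the same structure map. It is again a Yetter-Drinfeld
  module, twisting is strictly compatible with tensor products, and the theorem holds with \<open>F = G = twist\<close>,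
  with the ordinary associativity map, and with \<open>\<Phi>\<^sub>M = \<alpha>\<^sub>M\<close>, which is a morphism from \<open>M\<close> to
  \<open>twist M\<close> by the first axioms of modules and comodules. Naturality and the pentagon are
  then inherited from vector spaces (\<open>assoc_natural_iso\<close>, \<open>pentagon\<close>).
  
  The map \<open>B(m \<otimes> n) = \<Sum> \<alpha>\<inverse>(m\<^sub>-\<^sub>1) \<cdot> n \<otimes> m\<^sub>0\<close> is a morphism to \<open>twist N \<otimes> twist M\<close> precisely because of the
  Yetter-Drinfeld condition (\<open>mor_braiding\<close>). In the first hexagon (\<open>hexagon1\<close>) both sides send
  \<open>(u \<otimes> v) \<otimes> w\<close> to a sum over two Sweedler components of \<open>u\<close>, once as \<open>\<Delta>(u\<^sub>-\<^sub>1) \<otimes> \<alpha>\<^sub>U(u\<^sub>0)\<close> and once as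
  \<open>\<alpha>(u\<^sub>-\<^sub>1) \<otimes> \<lambda>(u\<^sub>0)\<close>, so the identity is the coassociativity of the comodule \<open>U\<close>; the factor
  \<open>\<alpha>\<^sub>U\<close> comes from \<open>\<Phi>\<close>. Dually, the second hexagon (\<open>hexagon2\<close>) is the associativity
  \<open>\<alpha>(h) \<cdot> (h' \<cdot> w) = (h h') \<cdot> \<alpha>\<^sub>W(w)\<close> of the module \<open>W\<close>. That the tensor product of two
  Yetter-Drinfeld modules satisfies the compatibility condition (\<open>yd_tensor_closed\<close>) is the longest
  computation; it moves between the two bracketings of \<open>\<Delta>\<close> three times.
  
  All these computations are with Sweedler sums. An expression \<open>\<Sum> \<beta>(v, w)\<close>, summed over a
  representation \<open>\<Sum> v \<otimes> w\<close> of a tensor \<open>t\<close>, is written \<open>sweedler K V W X \<beta> t\<close>. Each axiom becomes a rule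
  that holds under an arbitrary multilinear expression (\<open>coassoc\<close>, \<open>co_coassoc\<close>, \<open>yd_compat\<close>),
  and linear maps are compared on pure tensors (\<open>tensor_eqI\<close>). The rewrite rules declared below evaluate sums at
  pure tensors, pull sums out of linear maps and discharge the linearity side conditions.
\<close>

section \<open>Linear and bilinear maps\<close>

definition list_sum ::
  "('k, 'u) module \<Rightarrow> ('v \<Rightarrow> 'w \<Rightarrow> 'u) \<Rightarrow> ('v \<times> 'w) list \<Rightarrow> 'u" where
  "list_sum X \<beta> xs = foldr (\<lambda>(v, w) s. \<beta> v w \<oplus>\<^bsub>X\<^esub> s) xs \<zero>\<^bsub>X\<^esub>"

lemma tsum_list_sum: "tsum X \<beta> t = list_sum X \<beta> (terms t)"
  by (simp add: tsum_def list_sum_def)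

lemma list_sum_simps [simp]:
  "list_sum X \<beta> [] = \<zero>\<^bsub>X\<^esub>"
  "list_sum X \<beta> ((v, w) # xs) = \<beta> v w \<oplus>\<^bsub>X\<^esub> list_sum X \<beta> xs"
  by (simp_all add: list_sum_def)

text \<open>
  Unlike the maps in \<open>linear_maps\<close>, a map satisfying \<open>lin\<close> may have arbitrary values outside the
  carrier, so that it can be an arbitrary lambda term. The modules are included in order that they need
  not be carried along as separate hypotheses.
\<close>

definition lin :: "('k, 'r) ring_scheme \<Rightarrow> ('k, 'u) module \<Rightarrow> ('k, 'v) module \<Rightarrow> ('u \<Rightarrow> 'v) \<Rightarrow> bool" where
  "lin K V X f \<longleftrightarrow> module K V \<and> module K X \<and>
    (\<forall>x\<in>carrier V. f x \<in> carrier X) \<and>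
    (\<forall>x\<in>carrier V. \<forall>y\<in>carrier V. f (x \<oplus>\<^bsub>V\<^esub> y) = f x \<oplus>\<^bsub>X\<^esub> f y) \<and>
    (\<forall>c\<in>carrier K. \<forall>x\<in>carrier V. f (c \<odot>\<^bsub>V\<^esub> x) = c \<odot>\<^bsub>X\<^esub> f x)"

definition bilin ::
  "('k, 'r) ring_scheme \<Rightarrow> ('k, 'u) module \<Rightarrow> ('k, 'v) module \<Rightarrow> ('k, 'w) module \<Rightarrow> ('u \<Rightarrow> 'v \<Rightarrow> 'w) \<Rightarrow> bool" where
  "bilin K V W X \<beta> \<longleftrightarrow> module K V \<and> module K W \<and> module K X \<and>
    (\<forall>v\<in>carrier V. lin K W X (\<lambda>w. \<beta> v w)) \<and> (\<forall>w\<in>carrier W. lin K V X (\<lambda>v. \<beta> v w))"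

lemma lin_zero: "lin K V X f \<Longrightarrow> f \<zero>\<^bsub>V\<^esub> = \<zero>\<^bsub>X\<^esub>"
proof -
  assume f: "lin K V X f"
  interpret V: module K V using f by (simp add: lin_def)
  interpret X: module K X using f by (simp add: lin_def)
  have "f (\<zero>\<^bsub>V\<^esub> \<oplus>\<^bsub>V\<^esub> \<zero>\<^bsub>V\<^esub>) = f \<zero>\<^bsub>V\<^esub> \<oplus>\<^bsub>X\<^esub> f \<zero>\<^bsub>V\<^esub>" "f \<zero>\<^bsub>V\<^esub> \<in> carrier X"
    using f V.zero_closed unfolding lin_def by blast+
  then show ?thesis by (simp add: X.add.l_cancel_one)
qed

lemma linI:
  assumes "module K V" "module K X" "\<And>x. x \<in> carrier V \<Longrightarrow> f x \<in> carrier X"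
    "\<And>x y. x \<in> carrier V \<Longrightarrow> y \<in> carrier V \<Longrightarrow> f (x \<oplus>\<^bsub>V\<^esub> y) = f x \<oplus>\<^bsub>X\<^esub> f y"
    "\<And>c x. c \<in> carrier K \<Longrightarrow> x \<in> carrier V \<Longrightarrow> f (c \<odot>\<^bsub>V\<^esub> x) = c \<odot>\<^bsub>X\<^esub> f x"
  shows "lin K V X f"
  using assms by (simp add: lin_def)

lemma linD:
  assumes "lin K V X f"
  shows "module K V" "module K X" "x \<in> carrier V \<Longrightarrow> f x \<in> carrier X"
    "x \<in> carrier V \<Longrightarrow> y \<in> carrier V \<Longrightarrow> f (x \<oplus>\<^bsub>V\<^esub> y) = f x \<oplus>\<^bsub>X\<^esub> f y"
    "c \<in> carrier K \<Longrightarrow> x \<in> carrier V \<Longrightarrow> f (c \<odot>\<^bsub>V\<^esub> x) = c \<odot>\<^bsub>X\<^esub> f x"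
  using assms by (simp_all add: lin_def)

lemma bilinI:
  assumes "module K V" "module K W" "module K X"
    "\<And>v. v \<in> carrier V \<Longrightarrow> lin K W X (\<lambda>w. \<beta> v w)"
    "\<And>w. w \<in> carrier W \<Longrightarrow> lin K V X (\<lambda>v. \<beta> v w)"
  shows "bilin K V W X \<beta>"
  using assms by (simp add: bilin_def)

lemma bilinD:
  assumes "bilin K V W X \<beta>"
  shows "module K V" "module K W" "module K X"
    "v \<in> carrier V \<Longrightarrow> lin K W X (\<lambda>w. \<beta> v w)"
    "w \<in> carrier W \<Longrightarrow> lin K V X (\<lambda>v. \<beta> v w)"
    "v \<in> carrier V \<Longrightarrow> w \<in> carrier W \<Longrightarrow> \<beta> v w \<in> carrier X"
  using assms by (auto simp add: bilin_def lin_def)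

section \<open>The tensor product is a module\<close>

locale two_modules =
  fixes K :: "('k, 'r) ring_scheme" and V W :: "('k, 'a tuniv) module"
  assumes V: "module K V" and W: "module K W"
begin

sublocale V: module K V by (rule V)
sublocale W: module K W by (rule W)

abbreviation "pairs \<equiv> carrier V \<times> carrier W"
abbreviation "cong \<equiv> tensor_cong K V W"
abbreviation "cls \<equiv> tclass K V W"
abbreviation "VW \<equiv> tensor K V W"

lemma cong_in: "cong xs ys \<Longrightarrow> set xs \<subseteq> pairs \<and> set ys \<subseteq> pairs"
  by (induction rule: tensor_cong.induct) auto

lemma cong_terms: "set xs \<subseteq> pairs \<Longrightarrow> cong xs (terms (cls xs))"
  unfolding tclass_def by (simp, rule someI, rule tensor_cong.refl)

lemma cls_eq:
  assumes "cong xs ys"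
  shows "cls xs = cls ys"
proof -
  have "cong xs zs \<longleftrightarrow> cong ys zs" for zs
    using tensor_cong.trans[OF assms] tensor_cong.trans[OF tensor_cong.sym[OF assms]] by blast
  then show ?thesis by (simp add: tclass_def)
qed

lemma carrier_tensor: "carrier VW = cls ` {xs. set xs \<subseteq> pairs}"
  by (simp add: tensor_def)

lemma terms_in: "t \<in> carrier VW \<Longrightarrow> set (terms t) \<subseteq> pairs"
  using cong_in[OF cong_terms] by (auto simp: carrier_tensor)

lemma cls_terms: "t \<in> carrier VW \<Longrightarrow> cls (terms t) = t"
  by (auto simp: carrier_tensor cls_eq[OF cong_terms, symmetric])

lemma cls_in: "set xs \<subseteq> pairs \<Longrightarrow> cls xs \<in> carrier VW"
  by (auto simp: carrier_tensor)

lemma add_cls: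
  assumes "set xs \<subseteq> pairs" "set ys \<subseteq> pairs"
  shows "cls xs \<oplus>\<^bsub>VW\<^esub> cls ys = cls (xs @ ys)"
proof -
  have "cong (xs @ ys) (terms (cls xs) @ terms (cls ys))"
    by (intro tensor_cong.append cong_terms assms)
  then show ?thesis by (simp add: tensor_def cls_eq)
qed

abbreviation scale where "scale c \<equiv> map (\<lambda>(v, w). (c \<odot>\<^bsub>V\<^esub> v, w))"

lemma scale_in: "c \<in> carrier K \<Longrightarrow> set xs \<subseteq> pairs \<Longrightarrow> set (scale c xs) \<subseteq> pairs"
  by auto

text \<open>
  This makes the scalar multiplication of the tensor product, which is defined on
  representatives, well defined.
\<close>

lemma cong_scale: "cong xs ys \<Longrightarrow> c \<in> carrier K \<Longrightarrow> cong (scale c xs) (scale c ys)"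
proof (induction rule: tensor_cong.induct)
  case (refl xs) then show ?case by (intro tensor_cong.refl scale_in)
next
  case (sym xs ys) then show ?case by (simp add: tensor_cong.sym)
next
  case (trans xs ys zs) show ?case
    by (rule tensor_cong.trans[OF trans.IH(1)[OF trans.prems] trans.IH(2)[OF trans.prems]])
next
  case (append xs xs' ys ys') then show ?case by (simp add: tensor_cong.append)
next
  case (commute xs ys) then show ?case by (simp add: tensor_cong.commute scale_in del: set_map)
next
  case (add_left v v' w) then show ?case
    by (simp add: V.smult_r_distr tensor_cong.add_left)
next
  case (add_right v w w') then show ?case by (simp add: tensor_cong.add_right)
next
  case (scalar d v w)
  then have "c \<odot>\<^bsub>V\<^esub> (d \<odot>\<^bsub>V\<^esub> v) = d \<odot>\<^bsub>V\<^esub> (c \<odot>\<^bsub>V\<^esub> v)"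
    by (metis V.smult_assoc1 V.R.m_comm)
  with scalar show ?case by (simp add: tensor_cong.scalar)
next
  case (zero w) then show ?case by (simp add: V.smult_r_null tensor_cong.zero)
qed

lemma smult_cls:
  assumes "set xs \<subseteq> pairs" "c \<in> carrier K"
  shows "c \<odot>\<^bsub>VW\<^esub> cls xs = cls (scale c xs)"
  using cls_eq[OF cong_scale[OF cong_terms[OF assms(1)] assms(2)]] by (simp add: tensor_def)

lemma zero_cls: "\<zero>\<^bsub>VW\<^esub> = cls []"
  by (simp add: tensor_def)

lemma cong_Cons:
  "cong [p] ps \<Longrightarrow> cong xs ys \<Longrightarrow> cong (p # xs) (ps @ ys)"
  using tensor_cong.append[of K V W "[p]" ps xs ys] by simp

lemma cong_zero_left: "set xs \<subseteq> pairs \<Longrightarrow> cong (scale \<zero>\<^bsub>K\<^esub> xs) []"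
proof (induction xs)
  case Nil then show ?case by (simp add: tensor_cong.refl)
next
  case (Cons p xs)
  then show ?case using cong_Cons[of _ "[]" _ "[]", OF tensor_cong.zero]
    by (auto simp: V.smult_l_null)
qed

text \<open>
  Additive inverses come from here: with \<open>c = -1\<close> and \<open>d = 1\<close> it shows that scaling by \<open>-1\<close>
  yields the negative of a tensor.
\<close>

lemma cong_scale_add:
  "set xs \<subseteq> pairs \<Longrightarrow> c \<in> carrier K \<Longrightarrow> d \<in> carrier K \<Longrightarrow>
    cong (scale (c \<oplus>\<^bsub>K\<^esub> d) xs) (scale c xs @ scale d xs)"
proof (induction xs)
  case Nil then show ?case by (simp add: tensor_cong.refl)
next
  case (Cons p xs)
  obtain v w where p: "p = (v, w)" "v \<in> carrier V" "w \<in> carrier W" using Cons by auto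
  let ?c = "(c \<odot>\<^bsub>V\<^esub> v, w)" and ?d = "(d \<odot>\<^bsub>V\<^esub> v, w)"
  have "cong (scale (c \<oplus>\<^bsub>K\<^esub> d) (p # xs)) ([?c, ?d] @ (scale c xs @ scale d xs))"
    using Cons p by (auto simp: V.smult_l_distr intro!: cong_Cons tensor_cong.add_left simp del: append_Cons)
  moreover have "cong ([?c] @ ([?d] @ scale c xs) @ scale d xs) ([?c] @ (scale c xs @ [?d]) @ scale d xs)"
    using Cons p by (intro tensor_cong.append tensor_cong.refl tensor_cong.commute scale_in) auto
  ultimately have "cong (scale (c \<oplus>\<^bsub>K\<^esub> d) (p # xs)) ([?c] @ (scale c xs @ [?d]) @ scale d xs)"
    using tensor_cong.trans by simp
  then show ?case using p by simp
qed

lemma tensor_module: "module K VW"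
proof (rule moduleI)
  show "cring K" by (rule V.R.is_cring)
  show "abelian_group VW"
  proof (rule abelian_groupI)
    fix x y z assume "x \<in> carrier VW" "y \<in> carrier VW" "z \<in> carrier VW"
    then show "x \<oplus>\<^bsub>VW\<^esub> y \<oplus>\<^bsub>VW\<^esub> z = x \<oplus>\<^bsub>VW\<^esub> (y \<oplus>\<^bsub>VW\<^esub> z)"
      by (auto simp: carrier_tensor add_cls)
  next
    fix x y assume "x \<in> carrier VW" "y \<in> carrier VW"
    then show "x \<oplus>\<^bsub>VW\<^esub> y = y \<oplus>\<^bsub>VW\<^esub> x"
      by (auto simp: carrier_tensor add_cls intro!: cls_eq tensor_cong.commute)
  next
    fix x assume x: "x \<in> carrier VW"
    then obtain xs where xs: "x = cls xs" "set xs \<subseteq> pairs" by (auto simp: carrier_tensor)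
    have s: "scale \<one>\<^bsub>K\<^esub> xs = xs" using xs by (auto intro!: map_idI)
    have i: "set (scale (\<ominus>\<^bsub>K\<^esub> \<one>\<^bsub>K\<^esub>) xs) \<subseteq> pairs" by (rule scale_in) (use xs in auto)
    have "cong (scale ((\<ominus>\<^bsub>K\<^esub> \<one>\<^bsub>K\<^esub>) \<oplus>\<^bsub>K\<^esub> \<one>\<^bsub>K\<^esub>) xs) (scale (\<ominus>\<^bsub>K\<^esub> \<one>\<^bsub>K\<^esub>) xs @ scale \<one>\<^bsub>K\<^esub> xs)"
      by (rule cong_scale_add) (use xs in auto)
    then have "cong (scale \<zero>\<^bsub>K\<^esub> xs) (scale (\<ominus>\<^bsub>K\<^esub> \<one>\<^bsub>K\<^esub>) xs @ xs)"
      by (simp add: s V.R.l_neg)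
    then have "cong (scale (\<ominus>\<^bsub>K\<^esub> \<one>\<^bsub>K\<^esub>) xs @ xs) []"
      by (rule tensor_cong.trans[OF tensor_cong.sym]) (rule cong_zero_left, rule xs)
    then show "\<exists>y\<in>carrier VW. y \<oplus>\<^bsub>VW\<^esub> x = \<zero>\<^bsub>VW\<^esub>"
      using xs by (intro bexI[OF _ cls_in[OF i]]) (simp add: add_cls[OF i] zero_cls cls_eq)
  qed (auto simp: carrier_tensor add_cls zero_cls)
next
  fix c x assume "c \<in> carrier K" "x \<in> carrier VW"
  then show "c \<odot>\<^bsub>VW\<^esub> x \<in> carrier VW"
    using cls_in[OF scale_in] by (auto simp: carrier_tensor smult_cls simp del: set_map)
next
  fix c d x assume "c \<in> carrier K" "d \<in> carrier K" "x \<in> carrier VW"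
  then show "(c \<oplus>\<^bsub>K\<^esub> d) \<odot>\<^bsub>VW\<^esub> x = c \<odot>\<^bsub>VW\<^esub> x \<oplus>\<^bsub>VW\<^esub> d \<odot>\<^bsub>VW\<^esub> x"
    by (auto simp: carrier_tensor smult_cls add_cls[OF scale_in scale_in] simp del: set_map intro!: cls_eq cong_scale_add)
next
  fix c x y assume "c \<in> carrier K" "x \<in> carrier VW" "y \<in> carrier VW"
  then show "c \<odot>\<^bsub>VW\<^esub> (x \<oplus>\<^bsub>VW\<^esub> y) = c \<odot>\<^bsub>VW\<^esub> x \<oplus>\<^bsub>VW\<^esub> c \<odot>\<^bsub>VW\<^esub> y"
    by (auto simp: carrier_tensor smult_cls add_cls add_cls[OF scale_in scale_in] simp del: set_map)
next
  fix c d x assume cd: "c \<in> carrier K" "d \<in> carrier K" "x \<in> carrier VW"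
  then obtain xs where xs: "x = cls xs" "set xs \<subseteq> pairs" by (auto simp: carrier_tensor)
  have "scale (c \<otimes>\<^bsub>K\<^esub> d) xs = scale c (scale d xs)"
    using xs cd by (auto simp: V.smult_assoc1)
  then show "(c \<otimes>\<^bsub>K\<^esub> d) \<odot>\<^bsub>VW\<^esub> x = c \<odot>\<^bsub>VW\<^esub> (d \<odot>\<^bsub>VW\<^esub> x)"
    using xs cd by (simp add: smult_cls smult_cls[OF scale_in] del: set_map map_map)
next
  fix x assume "x \<in> carrier VW"
  then obtain xs where xs: "x = cls xs" "set xs \<subseteq> pairs" by (auto simp: carrier_tensor)
  have "scale \<one>\<^bsub>K\<^esub> xs = xs" using xs by (auto intro!: map_idI)
  then show "\<one>\<^bsub>K\<^esub> \<odot>\<^bsub>VW\<^esub> x = x" using xs by (simp add: smult_cls)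
qed

lemma pure_bilin: "bilin K V W VW (pure K V W)"
proof (intro bilinI linI V W tensor_module)
  fix v w assume "v \<in> carrier V" "w \<in> carrier W"
  then show "pure K V W v w \<in> carrier VW" by (simp add: pure_def cls_in)
  then show "pure K V W v w \<in> carrier VW" .
next
  fix v w w' assume "v \<in> carrier V" "w \<in> carrier W" "w' \<in> carrier W"
  then show "pure K V W v (w \<oplus>\<^bsub>W\<^esub> w') = pure K V W v w \<oplus>\<^bsub>VW\<^esub> pure K V W v w'"
    by (simp add: pure_def add_cls cls_eq tensor_cong.add_right)
next
  fix v w w' assume "v \<in> carrier W" "w \<in> carrier V" "w' \<in> carrier V"
  then show "pure K V W (w \<oplus>\<^bsub>V\<^esub> w') v = pure K V W w v \<oplus>\<^bsub>VW\<^esub> pure K V W w' v"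
    by (simp add: pure_def add_cls cls_eq tensor_cong.add_left)
next
  fix c v w assume "v \<in> carrier V" "w \<in> carrier W" "c \<in> carrier K"
  then show "pure K V W v (c \<odot>\<^bsub>W\<^esub> w) = c \<odot>\<^bsub>VW\<^esub> pure K V W v w"
    by (simp add: pure_def smult_cls cls_eq tensor_cong.scalar[THEN tensor_cong.sym])
next
  fix c v w assume "v \<in> carrier W" "w \<in> carrier V" "c \<in> carrier K"
  then show "pure K V W (c \<odot>\<^bsub>V\<^esub> w) v = c \<odot>\<^bsub>VW\<^esub> pure K V W w v"
    by (simp add: pure_def smult_cls)
qed

text \<open>
  Every tensor is the sum of the pure tensors in its chosen representative, which is why linear maps on a
  tensor product are determined by their values on pure tensors.
\<close>

lemma cls_as_sum: "set xs \<subseteq> pairs \<Longrightarrow> cls xs = list_sum VW (pure K V W) xs"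
proof (induction xs)
  case Nil then show ?case by (simp add: zero_cls)
next
  case (Cons p xs)
  then show ?case using add_cls[of "[p]" xs] by (cases p) (simp add: pure_def)
qed

end

lemma list_sum_closed:
  assumes "module K X" "\<And>v w. (v, w) \<in> set xs \<Longrightarrow> \<beta> v w \<in> carrier X"
  shows "list_sum X \<beta> xs \<in> carrier X"
proof -
  interpret X: module K X by fact
  show ?thesis using assms(2) by (induction xs) auto
qed

lemma list_sum_append:
  assumes "module K X" "\<And>v w. (v, w) \<in> set (xs @ ys) \<Longrightarrow> \<beta> v w \<in> carrier X"
  shows "list_sum X \<beta> (xs @ ys) = list_sum X \<beta> xs \<oplus>\<^bsub>X\<^esub> list_sum X \<beta> ys"
proof -
  interpret X: module K X by fact
  show ?thesis using assms(2)
  proof (induction xs)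
    case Nil
    then show ?case using list_sum_closed[OF assms(1), of ys \<beta>] by simp
  next
    case (Cons p xs)
    have "\<beta> (fst p) (snd p) \<in> carrier X" using Cons.prems[of "fst p" "snd p"] by simp
    moreover have "list_sum X \<beta> xs \<in> carrier X" "list_sum X \<beta> ys \<in> carrier X"
      using Cons.prems by (auto intro!: list_sum_closed[OF assms(1)])
    ultimately show ?case using Cons by (cases p) (simp add: X.a_assoc)
  qed
qed

lemma lin_list_sum:
  assumes "lin K X Y f" "\<And>v w. (v, w) \<in> set xs \<Longrightarrow> \<beta> v w \<in> carrier X"
  shows "f (list_sum X \<beta> xs) = list_sum Y (\<lambda>v w. f (\<beta> v w)) xs"
  using assms(2)
proof (induction xs)
  case Nil
  then show ?case by (simp add: lin_zero[OF assms(1)])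
next
  case (Cons p xs)
  have "list_sum X \<beta> xs \<in> carrier X"
    using Cons.prems by (auto intro!: list_sum_closed[OF linD(1)[OF assms(1)]])
  then show ?case using Cons by (cases p) (simp add: linD[OF assms(1)])
qed

lemma list_sum_cong_fun:
  assumes "\<And>v w. (v, w) \<in> set xs \<Longrightarrow> \<beta> v w = \<beta>' v w"
  shows "list_sum X \<beta> xs = list_sum X \<beta>' xs"
  using assms by (induction xs) auto

lemma list_sum_lin:
  assumes "module K U" "module K X" "\<And>v w. (v, w) \<in> set xs \<Longrightarrow> lin K U X (\<lambda>x. \<beta> x v w)"
  shows "lin K U X (\<lambda>x. list_sum X (\<beta> x) xs)"
proof -
  interpret X: module K X by fact
  show ?thesis using assms(3)
  proof (induction xs)
    case Nil
    show ?case by (rule linI[OF assms(1,2)]) (auto simp: X.smult_r_null)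
  next
    case (Cons p xs)
    have IH: "lin K U X (\<lambda>x. list_sum X (\<beta> x) xs)" by (rule Cons.IH, rule Cons.prems) simp
    obtain v w where p: "p = (v, w)" by force
    have b: "lin K U X (\<lambda>x. \<beta> x v w)" by (rule Cons.prems) (simp add: p)
    show ?case unfolding p
      by (rule linI[OF assms(1,2)])
        (simp_all add: linD[OF IH] linD[OF b] X.smult_r_distr X.a_ac)
  qed
qed

text \<open>
  The universal property of the tensor product: a bilinear map respects each generator of the
  congruence, so its sum depends on the tensor only and not on the representing list.
\<close>

lemma list_sum_tensor_cong:
  fixes V W :: "('k, 'a tuniv) module"
  assumes "bilin K V W X \<beta>"
  shows "tensor_cong K V W xs ys \<Longrightarrow> list_sum X \<beta> xs = list_sum X \<beta> ys"
proof -
  have V: "module K V" and W: "module K W" and X: "module K X" using bilinD[OF assms] by auto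
  interpret two_modules K V W by (rule two_modules.intro) fact+
  interpret X: module K X by fact
  have in_X: "\<And>v w. (v, w) \<in> set xs \<Longrightarrow> \<beta> v w \<in> carrier X" if "set xs \<subseteq> carrier V \<times> carrier W" for xs
    using bilinD(6)[OF assms] that by blast
  note sum_app = list_sum_append[OF X]
  show "tensor_cong K V W xs ys \<Longrightarrow> list_sum X \<beta> xs = list_sum X \<beta> ys"
  proof (induction rule: tensor_cong.induct)
    case (append xs xs' ys ys')
    then have "set (xs @ ys) \<subseteq> carrier V \<times> carrier W" "set (xs' @ ys') \<subseteq> carrier V \<times> carrier W"
      using cong_in by auto
    then show ?case using append.IH by (simp only: sum_app in_X)
  next
    case (commute xs ys)
    then have app: "set (xs @ ys) \<subseteq> carrier V \<times> carrier W" "set (ys @ xs) \<subseteq> carrier V \<times> carrier W"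
      by auto
    have "list_sum X \<beta> xs \<in> carrier X"
      by (rule list_sum_closed[OF X], rule in_X[OF commute(1)])
    moreover have "list_sum X \<beta> ys \<in> carrier X"
      by (rule list_sum_closed[OF X], rule in_X[OF commute(2)])
    ultimately show ?case
      by (simp only: sum_app[OF in_X[OF app(1)]] sum_app[OF in_X[OF app(2)]] X.a_comm)
  next
    case (add_left v v' w) then show ?case
      using bilinD[OF assms] linD(4)[OF bilinD(5)[OF assms]] by simp
  next
    case (add_right v w w') then show ?case
      using bilinD[OF assms] linD(4)[OF bilinD(4)[OF assms]] by simp
  next
    case (scalar c v w) then show ?case
      using linD(5)[OF bilinD(5)[OF assms]] linD(5)[OF bilinD(4)[OF assms]] by simp
  next
    case (zero w) then show ?case using lin_zero[OF bilinD(5)[OF assms]] by simp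
  qed auto
qed

section \<open>Sweedler sums\<close>

text \<open>
  The value is zero when \<open>t\<close> is not a tensor in \<open>V \<otimes> W\<close>; the congruence, closure and interchange rules
  then hold for every \<open>t\<close>. The modules \<open>V\<close> and \<open>W\<close> are arguments in order that a congruence rule
  can tell the simplifier, under nested sums, in which carriers the bound legs lie.
\<close>

definition sweedler ::
  "('k, 'r) ring_scheme \<Rightarrow> ('k, 'a tuniv) module \<Rightarrow> ('k, 'a tuniv) module \<Rightarrow> ('k, 'u) module \<Rightarrow>
    ('a tuniv \<Rightarrow> 'a tuniv \<Rightarrow> 'u) \<Rightarrow> 'a tuniv \<Rightarrow> 'u" where
  "sweedler K V W X \<beta> t = (if t \<in> carrier (tensor K V W) \<and> module K V \<and> module K W then tsum X \<beta> t else \<zero>\<^bsub>X\<^esub>)"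

lemma sweedler_cong [cong]:
  assumes "V = V'" "W = W'" "X = X'" "t = t'"
    "\<And>v w. v \<in> carrier V' \<Longrightarrow> w \<in> carrier W' \<Longrightarrow> \<beta> v w = \<beta>' v w"
  shows "sweedler K V W X \<beta> t = sweedler K V' W' X' \<beta>' t'"
proof (cases "t' \<in> carrier (tensor K V' W') \<and> module K V' \<and> module K W'")
  case True
  interpret two_modules K V' W' by (rule two_modules.intro) (use True in auto)
  show ?thesis using True assms(5) terms_in[of t'] unfolding assms(1-4)
    by (auto simp: sweedler_def tsum_list_sum intro!: list_sum_cong_fun)
qed (auto simp: assms(1-4) sweedler_def)

lemma sweedler_closed:
  assumes "module K X" "\<And>v w. v \<in> carrier V \<Longrightarrow> w \<in> carrier W \<Longrightarrow> \<beta> v w \<in> carrier X"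
  shows "sweedler K V W X \<beta> t \<in> carrier X"
proof (cases "t \<in> carrier (tensor K V W) \<and> module K V \<and> module K W")
  case True
  interpret two_modules K V W by (rule two_modules.intro) (use True in auto)
  show ?thesis using True assms terms_in[of t]
    by (auto simp: sweedler_def tsum_list_sum intro!: list_sum_closed[OF assms(1)])
next
  case False
  interpret module K X by fact
  show ?thesis using False by (auto simp: sweedler_def)
qed

text \<open>
  Linear maps commute with Sweedler sums. Every rule that pulls a sum to the outside is an
  instance of this one.
\<close>

lemma lin_sweedler:
  assumes "lin K X Y f" "\<And>v w. v \<in> carrier V \<Longrightarrow> w \<in> carrier W \<Longrightarrow> \<beta> v w \<in> carrier X"
  shows "f (sweedler K V W X \<beta> t) = sweedler K V W Y (\<lambda>v w. f (\<beta> v w)) t"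
proof (cases "t \<in> carrier (tensor K V W) \<and> module K V \<and> module K W")
  case True
  interpret two_modules K V W by (rule two_modules.intro) (use True in auto)
  show ?thesis using True assms terms_in[of t]
    by (auto simp: sweedler_def tsum_list_sum intro!: lin_list_sum[OF assms(1)])
qed (auto simp: sweedler_def lin_zero[OF assms(1)])

text \<open>
  This is linearity in a parameter of the summand, with the tensor \<open>t\<close> fixed: a finite sum of linear maps is
  linear.
\<close>

lemma lin_sweedler_body:
  assumes "module K U" "module K X" "\<And>v w. v \<in> carrier V \<Longrightarrow> w \<in> carrier W \<Longrightarrow> lin K U X (\<lambda>x. \<beta> x v w)"
  shows "lin K U X (\<lambda>x. sweedler K V W X (\<beta> x) t)"
proof (cases "t \<in> carrier (tensor K V W) \<and> module K V \<and> module K W")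
  case True
  interpret two_modules K V W by (rule two_modules.intro) (use True in auto)
  show ?thesis using True assms terms_in[of t]
    by (auto simp: sweedler_def tsum_list_sum intro!: list_sum_lin)
next
  case False
  interpret X: module K X by fact
  interpret U: module K U by fact
  from False show ?thesis by (auto simp: sweedler_def X.smult_r_null intro!: linI assms)
qed

text \<open>
  This is linearity in the tensor. Bilinearity of the summand makes the sum independent of the
  representation of the tensor, so it is the linear map induced by \<open>\<beta>\<close>.
\<close>

lemma lin_sweedler_induced:
  assumes "bilin K V W X \<beta>"
  shows "lin K (tensor K V W) X (sweedler K V W X \<beta>)"
proof -
  have V: "module K V" and W: "module K W" and X: "module K X" using bilinD[OF assms] by auto
  interpret two_modules K V W by (rule two_modules.intro) fact+
  interpret X: module K X by fact
  interpret T: module K VW by (rule tensor_module)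
  have sw: "sweedler K V W X \<beta> (cls xs) = list_sum X \<beta> xs" if "set xs \<subseteq> pairs" for xs
    using list_sum_tensor_cong[OF assms cong_terms[OF that]] that
    by (simp add: sweedler_def tsum_list_sum cls_in V W)
  show ?thesis
  proof (rule linI)
    show "module K VW" by (rule tensor_module)
    show "module K X" by (rule X)
  next
    fix t assume "t \<in> carrier VW"
    then show "sweedler K V W X \<beta> t \<in> carrier X"
      using bilinD(6)[OF assms] by (simp add: sweedler_closed X)
  next
    fix s t assume "s \<in> carrier VW" "t \<in> carrier VW"
    then obtain xs ys where *: "s = cls xs" "set xs \<subseteq> pairs" "t = cls ys" "set ys \<subseteq> pairs"
      by (auto simp: carrier_tensor)
    then have "list_sum X \<beta> (xs @ ys) = list_sum X \<beta> xs \<oplus>\<^bsub>X\<^esub> list_sum X \<beta> ys"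
      by (intro list_sum_append[OF X]) (auto intro!: bilinD(6)[OF assms])
    with * show "sweedler K V W X \<beta> (s \<oplus>\<^bsub>VW\<^esub> t) = sweedler K V W X \<beta> s \<oplus>\<^bsub>X\<^esub> sweedler K V W X \<beta> t"
      by (simp add: add_cls sw)
  next
    fix c t assume "c \<in> carrier K" "t \<in> carrier VW"
    then obtain xs where *: "t = cls xs" "set xs \<subseteq> pairs"
      by (auto simp: carrier_tensor)
    have "list_sum X \<beta> (scale c xs) = c \<odot>\<^bsub>X\<^esub> list_sum X \<beta> xs" using *(2)
    proof (induction xs)
      case Nil then show ?case using \<open>c \<in> carrier K\<close> by (simp add: X.smult_r_null)
    next
      case (Cons p xs)
      obtain v w where p: "p = (v, w)" by force
      have "list_sum X \<beta> xs \<in> carrier X"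
        using Cons by (auto intro!: list_sum_closed[OF X] bilinD(6)[OF assms])
      with Cons p \<open>c \<in> carrier K\<close> show ?case
        by (simp add: X.smult_r_distr linD(5)[OF bilinD(5)[OF assms]] bilinD(6)[OF assms])
    qed
    with * \<open>c \<in> carrier K\<close> show "sweedler K V W X \<beta> (c \<odot>\<^bsub>VW\<^esub> t) = c \<odot>\<^bsub>X\<^esub> sweedler K V W X \<beta> t"
      using scale_in[of c xs] by (simp add: smult_cls sw del: set_map)
  qed
qed

lemma sweedler_pure:
  assumes "bilin K V W X \<beta>" "v \<in> carrier V" "w \<in> carrier W"
  shows "sweedler K V W X \<beta> (pure K V W v w) = \<beta> v w"
proof -
  have V: "module K V" and W: "module K W" and X: "module K X" using bilinD[OF assms(1)] by auto
  interpret two_modules K V W by (rule two_modules.intro) fact+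
  interpret X: module K X by fact
  have "list_sum X \<beta> (terms (cls [(v, w)])) = list_sum X \<beta> [(v, w)]"
    by (rule list_sum_tensor_cong[OF assms(1), symmetric], rule cong_terms) (use assms in auto)
  then show ?thesis using assms bilinD(6)[OF assms]
    by (simp add: sweedler_def tsum_list_sum pure_def cls_in V W)
qed

lemma sweedler_expand:
  assumes "module K V" "module K W" "t \<in> carrier (tensor K V W)"
  shows "sweedler K V W (tensor K V W) (\<lambda>v w. pure K V W v w) t = t"
proof -
  interpret two_modules K V W by (rule two_modules.intro) fact+
  show ?thesis using assms cls_as_sum[OF terms_in] cls_terms
    by (simp add: sweedler_def tsum_list_sum)
qed

lemma tensor_eqI:
  assumes "t \<in> carrier (tensor K V W)" "lin K (tensor K V W) X f" "lin K (tensor K V W) X g"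
    "module K V" "module K W"
    "\<And>v w. v \<in> carrier V \<Longrightarrow> w \<in> carrier W \<Longrightarrow> f (pure K V W v w) = g (pure K V W v w)"
  shows "f t = g t"
proof -
  interpret two_modules K V W by (rule two_modules.intro) fact+
  have p: "\<And>v w. v \<in> carrier V \<Longrightarrow> w \<in> carrier W \<Longrightarrow> pure K V W v w \<in> carrier VW"
    by (rule bilinD[OF pure_bilin])
  have "f t = f (sweedler K V W VW (pure K V W) t)" using assms by (simp add: sweedler_expand)
  also have "\<dots> = sweedler K V W X (\<lambda>v w. f (pure K V W v w)) t"
    by (rule lin_sweedler[OF assms(2)]) (use p in auto)
  also have "\<dots> = sweedler K V W X (\<lambda>v w. g (pure K V W v w)) t"
    using assms by (intro sweedler_cong) auto
  also have "\<dots> = g (sweedler K V W VW (pure K V W) t)"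
    by (rule lin_sweedler[OF assms(3), symmetric]) (use p in auto)
  also have "\<dots> = g t" using assms by (simp add: sweedler_expand)
  finally show ?thesis .
qed

lemma list_sum_add:
  assumes "module K X" "\<And>v w. (v, w) \<in> set xs \<Longrightarrow> \<beta> v w \<in> carrier X"
    "\<And>v w. (v, w) \<in> set xs \<Longrightarrow> \<gamma> v w \<in> carrier X"
  shows "list_sum X (\<lambda>v w. \<beta> v w \<oplus>\<^bsub>X\<^esub> \<gamma> v w) xs = list_sum X \<beta> xs \<oplus>\<^bsub>X\<^esub> list_sum X \<gamma> xs"
proof -
  interpret X: module K X by fact
  show ?thesis using assms(2,3)
  proof (induction xs)
    case (Cons p xs)
    have "list_sum X \<beta> xs \<in> carrier X" "list_sum X \<gamma> xs \<in> carrier X"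
      using Cons.prems by (auto intro!: list_sum_closed[OF assms(1)])
    with Cons show ?case by (cases p) (simp add: X.a_ac)
  qed simp
qed

text \<open>
  Two nested sums over tensors that do not depend on each other's legs may be
  interchanged, as both are finite sums in an abelian group.
\<close>

lemma sweedler_swap:
  fixes A B C D :: "('k, 'a tuniv) module"
  assumes X: "module K X"
    "\<And>a b c d. a \<in> carrier A \<Longrightarrow> b \<in> carrier B \<Longrightarrow> c \<in> carrier C \<Longrightarrow> d \<in> carrier D \<Longrightarrow> \<beta> a b c d \<in> carrier X"
  shows "sweedler K A B X (\<lambda>a b. sweedler K C D X (\<lambda>c d. \<beta> a b c d) s) t =
    sweedler K C D X (\<lambda>c d. sweedler K A B X (\<lambda>a b. \<beta> a b c d) t) s"
proof -
  interpret X: module K X by fact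
  have z: "list_sum X (\<lambda>v w. \<zero>\<^bsub>X\<^esub>) xs = \<zero>\<^bsub>X\<^esub>" for xs :: "('a tuniv \<times> 'a tuniv) list"
    by (induction xs) auto
  have zz: "sweedler K P Q X (\<lambda>v w. \<zero>\<^bsub>X\<^esub>) u = \<zero>\<^bsub>X\<^esub>" for P Q and u :: "'a tuniv"
    by (simp add: sweedler_def tsum_list_sum z)
  have "?thesis" if "t \<in> carrier (tensor K A B)" "module K A" "module K B"
    "s \<in> carrier (tensor K C D)" "module K C" "module K D"
  proof -
    interpret AB: two_modules K A B by (rule two_modules.intro) (use that in auto)
    interpret CD: two_modules K C D by (rule two_modules.intro) (use that in auto)
    have "list_sum X (\<lambda>a b. list_sum X (\<beta> a b) ys) xs =
       list_sum X (\<lambda>c d. list_sum X (\<lambda>a b. \<beta> a b c d) xs) ys"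
      if "set xs \<subseteq> carrier A \<times> carrier B" "set ys \<subseteq> carrier C \<times> carrier D" for xs ys
      using that(1)
    proof (induction xs)
      case Nil show ?case by (simp add: z)
    next
      case (Cons p xs)
      obtain a b where p: "p = (a, b)" by force
      show ?case using Cons p that
        by (auto simp: subset_eq intro!: list_sum_add[OF X(1), symmetric] list_sum_closed[OF X(1)] X(2))
    qed
    from this[OF AB.terms_in CD.terms_in] show ?thesis using that
      by (simp add: sweedler_def tsum_list_sum)
  qed
  moreover have ?thesis if "\<not> (t \<in> carrier (tensor K A B) \<and> module K A \<and> module K B)"
    using that zz[of C D s] by (simp add: sweedler_def[of K A B] if_not_P)
  moreover have ?thesis if "\<not> (s \<in> carrier (tensor K C D) \<and> module K C \<and> module K D)"
    using that zz[of A B t] by (simp add: sweedler_def[of K C D] if_not_P)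
  ultimately show ?thesis by blast
qed

section \<open>Rules for computing with Sweedler sums\<close>

lemma tensor_module [simp]:
  "module K V \<Longrightarrow> module K W \<Longrightarrow> module K (tensor K V W)"
  by (rule two_modules.tensor_module[OF two_modules.intro])

lemma pure_bilin: "module K V \<Longrightarrow> module K W \<Longrightarrow> bilin K V W (tensor K V W) (pure K V W)"
  by (rule two_modules.pure_bilin[OF two_modules.intro])

text \<open>
  These congruence rules keep the simplifier out of the bodies of linearity side conditions. The
  body is a multilinear expression with bound variables that are not known to lie in any carrier, so
  rewriting it would be fruitless; the side condition is instead decomposed along the syntax
  of the body.
\<close>

lemma lin_cong [cong]: "V = V' \<Longrightarrow> X = X' \<Longrightarrow> lin K V X f = lin K V' X' f"
  by simp

lemma bilin_cong [cong]: "V = V' \<Longrightarrow> W = W' \<Longrightarrow> X = X' \<Longrightarrow> bilin K V W X f = bilin K V' W' X' f"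
  by simp

lemma lin_comp:
  assumes "lin K V X f" "lin K U V e"
  shows "lin K U X (\<lambda>x. f (e x))"
  by (rule linI) (simp_all add: linD[OF assms(1)] linD[OF assms(2)])

lemma lin_id: "module K V \<Longrightarrow> lin K V V (\<lambda>x. x)"
  by (simp add: lin_def)

lemma pure_closed:
  "module K V \<Longrightarrow> module K W \<Longrightarrow> v \<in> carrier V \<Longrightarrow> w \<in> carrier W \<Longrightarrow>
    pure K V W v w \<in> carrier (tensor K V W)"
  by (rule bilinD(6)[OF pure_bilin])

lemma lin_pure_left:
  "lin K U V e \<Longrightarrow> module K W \<Longrightarrow> w \<in> carrier W \<Longrightarrow>
    lin K U (tensor K V W) (\<lambda>x. pure K V W (e x) w)"
  by (rule lin_comp[OF bilinD(5)[OF pure_bilin]]) (auto dest: linD)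

lemma lin_pure_right:
  "lin K U W e \<Longrightarrow> module K V \<Longrightarrow> v \<in> carrier V \<Longrightarrow>
    lin K U (tensor K V W) (\<lambda>x. pure K V W v (e x))"
  by (rule lin_comp[OF bilinD(4)[OF pure_bilin]]) (auto dest: linD)

lemma lin_sweedler_arg:
  assumes "lin K U (tensor K V W) e" "bilin K V W X \<beta>"
  shows "lin K U X (\<lambda>x. sweedler K V W X \<beta> (e x))"
  by (rule lin_comp[OF lin_sweedler_induced[OF assms(2)] assms(1)])

lemma sweedler_sweedler:
  assumes "bilin K V' W' X \<beta>"
    "\<And>v w. v \<in> carrier V \<Longrightarrow> w \<in> carrier W \<Longrightarrow> \<gamma> v w \<in> carrier (tensor K V' W')"
  shows "sweedler K V' W' X \<beta> (sweedler K V W (tensor K V' W') \<gamma> t) =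
    sweedler K V W X (\<lambda>v w. sweedler K V' W' X \<beta> (\<gamma> v w)) t"
  by (rule lin_sweedler[OF lin_sweedler_induced[OF assms(1)] assms(2)])

lemma pure_sweedler_left:
  assumes "module K X" "module K Y" "y \<in> carrier Y"
    "\<And>v w. v \<in> carrier V \<Longrightarrow> w \<in> carrier W \<Longrightarrow> \<gamma> v w \<in> carrier X"
  shows "pure K X Y (sweedler K V W X \<gamma> t) y =
    sweedler K V W (tensor K X Y) (\<lambda>v w. pure K X Y (\<gamma> v w) y) t"
  by (rule lin_sweedler[OF bilinD(5)[OF pure_bilin] assms(4)]) (use assms in auto)

lemma pure_sweedler_right:
  assumes "module K X" "module K Y" "x \<in> carrier X"
    "\<And>v w. v \<in> carrier V \<Longrightarrow> w \<in> carrier W \<Longrightarrow> \<gamma> v w \<in> carrier Y"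
  shows "pure K X Y x (sweedler K V W Y \<gamma> t) =
    sweedler K V W (tensor K X Y) (\<lambda>v w. pure K X Y x (\<gamma> v w)) t"
  by (rule lin_sweedler[OF bilinD(4)[OF pure_bilin] assms(4)]) (use assms in auto)

lemmas sweedler_simps =
  bilinI lin_id pure_closed lin_pure_left lin_pure_right lin_sweedler_arg lin_sweedler_body
  sweedler_closed sweedler_pure sweedler_sweedler pure_sweedler_left pure_sweedler_right

declare sweedler_simps [simp]

lemma lin_ext:
  assumes "lin K V X f" "\<And>x. x \<in> carrier V \<Longrightarrow> f x = g x"
  shows "lin K V X g"
proof -
  interpret module K V by (rule linD(1)[OF assms(1)])
  show ?thesis by (rule linI) (simp_all add: assms(2)[symmetric] linD[OF assms(1)])
qed

lemma lin_linear_maps: "f \<in> linear_maps K V X \<Longrightarrow> module K V \<Longrightarrow> module K X \<Longrightarrow> lin K V X f"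
  by (auto simp: linear_maps_def lin_def)

lemma restrict_linear_maps:
  "lin K V X f \<Longrightarrow> (\<lambda>x\<in>carrier V. f x) \<in> linear_maps K V X"
proof -
  assume f: "lin K V X f"
  interpret module K V by (rule linD(1)[OF f])
  show ?thesis by (auto simp: linear_maps_def linD[OF f])
qed

lemma linear_mapsI:
  "lin K V X f \<Longrightarrow> f \<in> extensional (carrier V) \<Longrightarrow> f \<in> linear_maps K V X"
  using restrict_linear_maps[of K V X f] by (simp add: extensional_restrict)

lemma tsum_sweedler:
  "t \<in> carrier (tensor K V W) \<Longrightarrow> module K V \<Longrightarrow> module K W \<Longrightarrow> tsum X \<beta> t = sweedler K V W X \<beta> t"
  by (simp add: sweedler_def)

lemma tensor_map_sweedler:
  "t \<in> carrier (tensor K V W) \<Longrightarrow> module K V \<Longrightarrow> module K W \<Longrightarrow> tensor_map K V W V' W' f g t =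
     sweedler K V W (tensor K V' W') (\<lambda>v w. pure K V' W' (f v) (g w)) t"
  by (simp add: sweedler_def tensor_map_def)

lemma tassoc_sweedler:
  assumes "t \<in> carrier (tensor K (tensor K U V) W)" "module K U" "module K V" "module K W"
  shows "tassoc K U V W t = sweedler K (tensor K U V) W (tensor K U (tensor K V W))
     (\<lambda>s w. sweedler K U V (tensor K U (tensor K V W)) (\<lambda>u v. pure K U (tensor K V W) u (pure K V W v w)) s) t"
  using assms
  by (simp add: tassoc_def tsum_sweedler[of _ K "tensor K U V" W] tsum_sweedler[of _ K U V])

text \<open>
  The three-legged axioms (coassociativity of \<open>H\<close> and of comodules) are used below in the form
  that any trilinear expression takes the same value on both sides.
\<close>

definition trilin where
  "trilin K U V W X \<gamma> \<longleftrightarrow>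
    (\<forall>v\<in>carrier V. \<forall>w\<in>carrier W. lin K U X (\<lambda>u. \<gamma> u v w)) \<and>
    (\<forall>u\<in>carrier U. \<forall>w\<in>carrier W. lin K V X (\<lambda>v. \<gamma> u v w)) \<and>
    (\<forall>u\<in>carrier U. \<forall>v\<in>carrier V. lin K W X (\<lambda>w. \<gamma> u v w))"

lemma trilinI [simp]:
  assumes "\<And>v w. v \<in> carrier V \<Longrightarrow> w \<in> carrier W \<Longrightarrow> lin K U X (\<lambda>u. \<gamma> u v w)"
    "\<And>u w. u \<in> carrier U \<Longrightarrow> w \<in> carrier W \<Longrightarrow> lin K V X (\<lambda>v. \<gamma> u v w)"
    "\<And>u v. u \<in> carrier U \<Longrightarrow> v \<in> carrier V \<Longrightarrow> lin K W X (\<lambda>w. \<gamma> u v w)"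
  shows "trilin K U V W X \<gamma>"
  using assms by (simp add: trilin_def)

lemma trilin_cong [cong]:
  "U = U' \<Longrightarrow> V = V' \<Longrightarrow> W = W' \<Longrightarrow> X = X' \<Longrightarrow> trilin K U V W X f = trilin K U' V' W' X' f"
  by simp

lemma trilinD:
  assumes "trilin K U V W X \<gamma>"
  shows "v \<in> carrier V \<Longrightarrow> w \<in> carrier W \<Longrightarrow> lin K U X (\<lambda>u. \<gamma> u v w)"
    "u \<in> carrier U \<Longrightarrow> w \<in> carrier W \<Longrightarrow> lin K V X (\<lambda>v. \<gamma> u v w)"
    "u \<in> carrier U \<Longrightarrow> v \<in> carrier V \<Longrightarrow> lin K W X (\<lambda>w. \<gamma> u v w)"
  using assms by (auto simp: trilin_def)

lemma trilin_closed:
  assumes "trilin K U V W X \<gamma>" "u \<in> carrier U" "v \<in> carrier V" "w \<in> carrier W"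
  shows "\<gamma> u v w \<in> carrier X"
  using linD(3)[OF trilinD(1)[OF assms(1,3,4)]] assms by simp

lemma trilin_comp:
  assumes "trilin K U V W X \<gamma>"
  shows "lin K P U e \<Longrightarrow> v \<in> carrier V \<Longrightarrow> w \<in> carrier W \<Longrightarrow> lin K P X (\<lambda>x. \<gamma> (e x) v w)"
    "u \<in> carrier U \<Longrightarrow> lin K P V e \<Longrightarrow> w \<in> carrier W \<Longrightarrow> lin K P X (\<lambda>x. \<gamma> u (e x) w)"
    "u \<in> carrier U \<Longrightarrow> v \<in> carrier V \<Longrightarrow> lin K P W e \<Longrightarrow> lin K P X (\<lambda>x. \<gamma> u v (e x))"
  by (auto intro: lin_comp[OF trilinD(1)[OF assms]] lin_comp[OF trilinD(2)[OF assms]]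
    lin_comp[OF trilinD(3)[OF assms]])

lemma bilin_comp:
  assumes "bilin K V W X \<gamma>"
  shows "lin K P V e \<Longrightarrow> w \<in> carrier W \<Longrightarrow> lin K P X (\<lambda>x. \<gamma> (e x) w)"
    "v \<in> carrier V \<Longrightarrow> lin K P W e \<Longrightarrow> lin K P X (\<lambda>x. \<gamma> v (e x))"
  by (auto intro: lin_comp[OF bilinD(4)[OF assms]] lin_comp[OF bilinD(5)[OF assms]])

lemma lin_tensor_map:
  assumes "lin K V V' f" "lin K W W' g"
  shows "lin K (tensor K V W) (tensor K V' W') (tensor_map K V W V' W' f g)"
proof (rule lin_ext)
  note [simp] = linD(1,2)[OF assms(1)] linD(1,2)[OF assms(2)] linD(3)[OF assms(1)] linD(3)[OF assms(2)]
     assms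
  show "lin K (tensor K V W) (tensor K V' W')
    (\<lambda>t. sweedler K V W (tensor K V' W') (\<lambda>v w. pure K V' W' (f v) (g w)) t)"
    by simp
  fix t assume "t \<in> carrier (tensor K V W)"
  then show "sweedler K V W (tensor K V' W') (\<lambda>v w. pure K V' W' (f v) (g w)) t =
      tensor_map K V W V' W' f g t"
    by (simp add: tensor_map_sweedler)
qed

lemma tensor_map_pure:
  assumes "lin K V V' f" "lin K W W' g" "v \<in> carrier V" "w \<in> carrier W"
  shows "tensor_map K V W V' W' f g (pure K V W v w) = pure K V' W' (f v) (g w)"
proof -
  note [simp] = linD(1,2)[OF assms(1)] linD(1,2)[OF assms(2)] linD(3)[OF assms(1)] linD(3)[OF assms(2)]
     assms
  show ?thesis by (simp add: tensor_map_sweedler)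
qed

lemma lin_tassoc:
  assumes "module K U" "module K V" "module K W"
  shows "lin K (tensor K (tensor K U V) W) (tensor K U (tensor K V W)) (tassoc K U V W)"
  by (rule lin_ext[of _ _ _ "\<lambda>t. sweedler K (tensor K U V) W (tensor K U (tensor K V W))
     (\<lambda>s w. sweedler K U V (tensor K U (tensor K V W)) (\<lambda>u v. pure K U (tensor K V W) u (pure K V W v w)) s) t"])
   (simp_all add: assms tassoc_sweedler)

lemma tassoc_pure:
  assumes "module K U" "module K V" "module K W" "u \<in> carrier U" "v \<in> carrier V" "w \<in> carrier W"
  shows "tassoc K U V W (pure K (tensor K U V) W (pure K U V u v) w) =
    pure K U (tensor K V W) u (pure K V W v w)"
  by (simp add: assms tassoc_sweedler)

section \<open>Hom-bialgebras and Yetter-Drinfeld modules in Sweedler notation\<close>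

locale yd_setting =
  fixes K :: "('k, 'r) ring_scheme" and H :: "('k, 'a tuniv) hom_bialg"
  assumes bialg: "hom_bialgebra K H"
    and psi: "halpha H = hpsi H"
    and bij: "bij_betw (halpha H) (carrier (hspace H)) (carrier (hspace H))"
begin

abbreviation A where "A \<equiv> hspace H"
abbreviation al where "al \<equiv> halpha H"
abbreviation ai where "ai \<equiv> \<alpha>\<^sub>H_inv H"
abbreviation D where "D \<equiv> hcomult H"
abbreviation tens (infixr \<open>\<boxtimes>\<close> 75) where "V \<boxtimes> W \<equiv> tensor K V W"
abbreviation times (infixl \<open>\<star>\<close> 72) where "g \<star> h \<equiv> hprod K H g h"
abbreviation SW where "SW V W X \<beta> t \<equiv> sweedler K V W X \<beta> t"

lemma A_module [simp]: "module K A"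
  using bialg by (simp add: hom_bialgebra_def hom_assoc_algebra_def)

lemma lin_alpha: "lin K A A al"
  using bialg by (intro lin_linear_maps) (auto simp add: hom_bialgebra_def hom_assoc_algebra_def)

lemma al_ai [simp]: "h \<in> carrier A \<Longrightarrow> al (ai h) = h"
  using bij by (simp add: \<alpha>\<^sub>H_inv_def bij_betw_def f_inv_into_f)

lemma ai_al [simp]: "h \<in> carrier A \<Longrightarrow> ai (al h) = h"
  using bij by (simp add: \<alpha>\<^sub>H_inv_def bij_betw_def)

lemma ai_closed [simp]: "h \<in> carrier A \<Longrightarrow> ai h \<in> carrier A"
  using bij by (metis \<alpha>\<^sub>H_inv_def bij_betw_def inv_into_into)

lemma ai_eqI: "h \<in> carrier A \<Longrightarrow> g \<in> carrier A \<Longrightarrow> al g = h \<Longrightarrow> ai h = g"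
  by auto

lemma lin_alpha_inv: "lin K A A ai"
proof -
  interpret module K A by simp
  note L = linD[OF lin_alpha]
  show ?thesis by (rule linI) (auto intro!: ai_eqI simp: L)
qed

lemma lin_comult: "lin K A (A \<boxtimes> A) D"
  using bialg by (intro lin_linear_maps) (auto simp add: hom_bialgebra_def hom_coassoc_coalgebra_def)

lemma lin_mult: "lin K (A \<boxtimes> A) A (hmult H)"
  using bialg by (intro lin_linear_maps) (auto simp add: hom_bialgebra_def hom_assoc_algebra_def)

lemmas [simp] = linD(3)[OF lin_alpha] lin_comp[OF lin_alpha] lin_sweedler[OF lin_alpha]
  lin_comp[OF lin_alpha_inv] lin_sweedler[OF lin_alpha_inv]
  linD(3)[OF lin_comult] lin_comp[OF lin_comult] lin_sweedler[OF lin_comult]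

lemma bilin_prod: "bilin K A A A (hprod K H)"
  unfolding hprod_def by (rule bilinI) (auto intro!: lin_comp[OF lin_mult])

lemmas [simp] = bilinD(6)[OF bilin_prod] bilin_comp[OF bilin_prod]
  lin_sweedler[OF bilinD(4)[OF bilin_prod]] lin_sweedler[OF bilinD(5)[OF bilin_prod]]

lemma al_prod [simp]: "g \<in> carrier A \<Longrightarrow> h \<in> carrier A \<Longrightarrow> al (g \<star> h) = al g \<star> al h"
  using bialg by (simp add: hom_bialgebra_def hom_assoc_algebra_def hprod_def)

lemma ai_prod [simp]: "g \<in> carrier A \<Longrightarrow> h \<in> carrier A \<Longrightarrow> ai (g \<star> h) = ai g \<star> ai h"
  by (rule ai_eqI) auto

lemma hom_assoc: "a \<in> carrier A \<Longrightarrow> b \<in> carrier A \<Longrightarrow> c \<in> carrier A \<Longrightarrow>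
    al a \<star> (b \<star> c) = (a \<star> b) \<star> al c"
  using bialg by (simp add: hom_bialgebra_def hom_assoc_algebra_def hprod_def)

lemma D_al [simp]:
  "h \<in> carrier A \<Longrightarrow> D (al h) = SW A A (A \<boxtimes> A) (\<lambda>a b. pure K A A (al a) (al b)) (D h)"
  using bialg psi by (auto simp: hom_bialgebra_def hom_coassoc_coalgebra_def tensor_map_sweedler)

lemma D_prod [simp]:
  assumes "g \<in> carrier A" "h \<in> carrier A"
  shows "D (g \<star> h) = SW A A (A \<boxtimes> A) (\<lambda>a b. SW A A (A \<boxtimes> A)
    (\<lambda>c d. pure K A A (a \<star> c) (b \<star> d)) (D h)) (D g)"
proof -
  have "D (g \<star> h) = tensor_mult K A (hmult H) (pure K (A \<boxtimes> A) (A \<boxtimes> A) (D g) (D h))"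
    using bialg assms by (simp add: hom_bialgebra_def hom_algebra_morphism_def hprod_def)
  also have "\<dots> = SW (A \<boxtimes> A) (A \<boxtimes> A) (A \<boxtimes> A) (\<lambda>s s'. SW A A (A \<boxtimes> A) (\<lambda>a b. SW A A (A \<boxtimes> A)
    (\<lambda>c d. pure K A A (a \<star> c) (b \<star> d)) s') s) (pure K (A \<boxtimes> A) (A \<boxtimes> A) (D g) (D h))"
    using assms
    by (simp add: tensor_mult_def hprod_def[symmetric] tsum_sweedler[of _ K "A \<boxtimes> A" "A \<boxtimes> A"]
      tsum_sweedler[of _ K A A] del: sweedler_pure)
  also have "\<dots> = SW A A (A \<boxtimes> A) (\<lambda>a b. SW A A (A \<boxtimes> A)
    (\<lambda>c d. pure K A A (a \<star> c) (b \<star> d)) (D h)) (D g)"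
    using assms by simp
  finally show ?thesis .
qed

lemma D_ai [simp]:
  assumes "h \<in> carrier A"
  shows "D (ai h) = SW A A (A \<boxtimes> A) (\<lambda>a b. pure K A A (ai a) (ai b)) (D h)"
proof -
  have "SW A A (A \<boxtimes> A) (\<lambda>a b. pure K A A (ai a) (ai b)) (D (al (ai h))) = D (ai h)"
    using assms by (simp add: sweedler_expand del: al_ai)
  then show ?thesis using assms by simp
qed

text \<open>
  The axiom is an identity in \<open>H \<otimes> (H \<otimes> H)\<close>; the rule results from applying to both sides the
  linear map that \<open>\<gamma>\<close> induces on this space.
\<close>

lemma coassoc:
  assumes "h \<in> carrier A" "trilin K A A A X \<gamma>" "module K X"
  shows "SW A A X (\<lambda>a b. SW A A X (\<lambda>a1 a2. \<gamma> a1 a2 (al b)) (D a)) (D h) =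
    SW A A X (\<lambda>a b. SW A A X (\<lambda>b1 b2. \<gamma> (al a) b1 b2) (D b)) (D h)"
proof -
  note [simp] = assms trilin_closed[OF assms(2)] trilin_comp[OF assms(2)]
  let ?G = "\<lambda>t. SW A (A \<boxtimes> A) X (\<lambda>a s. SW A A X (\<lambda>b c. \<gamma> a b c) s) t"
  have "tassoc K A A A (tensor_map K A A (A \<boxtimes> A) A D al (D h)) = tensor_map K A A A (A \<boxtimes> A) al D (D h)"
    using bialg assms(1) psi by (simp add: hom_bialgebra_def hom_coassoc_coalgebra_def)
  then have "?G (tassoc K A A A (tensor_map K A A (A \<boxtimes> A) A D al (D h))) =
    ?G (tensor_map K A A A (A \<boxtimes> A) al D (D h))" by simp
  then show ?thesis by (simp add: tassoc_sweedler tensor_map_sweedler)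
qed

text \<open>
  The linearity of the structure maps alone. It is separated from the axioms of a Yetter-Drinfeld
  module so that the rewrite rules for linear maps are already available for the tensor product
  while its axioms are being verified.
\<close>

definition linear_data :: "('k, 'a tuniv) yd_module \<Rightarrow> bool" where
  "linear_data M \<longleftrightarrow> lin K (mspace M) (mspace M) (malpha M) \<and>
    bilin K A (mspace M) (mspace M) (act K H M) \<and>
    lin K (mspace M) (A \<boxtimes> mspace M) (mcoaction M)"

lemma linear_data_module: "linear_data M \<Longrightarrow> module K (mspace M)"
  by (auto simp: linear_data_def dest: linD)

text \<open>
  The space \<open>X\<close> is a separate variable because the space of a tensor product or of a twisted module
  is simplified to a different term; the equation \<open>X = mspace M\<close> is then solved by
  rewriting.
\<close>

lemma linear_data_rules [simp]:
  assumes "linear_data M" "X = mspace M"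
  shows "m \<in> carrier X \<Longrightarrow> malpha M m \<in> carrier X"
    "lin K U X e \<Longrightarrow> lin K U X (\<lambda>x. malpha M (e x))"
    "m \<in> carrier X \<Longrightarrow> mcoaction M m \<in> carrier (A \<boxtimes> X)"
    "lin K U X e \<Longrightarrow> lin K U (A \<boxtimes> X) (\<lambda>x. mcoaction M (e x))"
    "h \<in> carrier A \<Longrightarrow> m \<in> carrier X \<Longrightarrow> act K H M h m \<in> carrier X"
    "lin K U A f \<Longrightarrow> m \<in> carrier X \<Longrightarrow> lin K U X (\<lambda>x. act K H M (f x) m)"
    "h \<in> carrier A \<Longrightarrow> lin K U X e \<Longrightarrow> lin K U X (\<lambda>x. act K H M h (e x))"
  using assms unfolding linear_data_def
  by (auto intro: linD bilinD lin_comp dest: bilin_comp)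

lemma linear_data_push [simp]:
  assumes "linear_data M" "X = mspace M" "\<And>v w. v \<in> carrier V \<Longrightarrow> w \<in> carrier W \<Longrightarrow> \<gamma> v w \<in> carrier X"
  shows "malpha M (SW V W X \<gamma> t) = SW V W X (\<lambda>v w. malpha M (\<gamma> v w)) t"
    "mcoaction M (SW V W X \<gamma> t) = SW V W (A \<boxtimes> X) (\<lambda>v w. mcoaction M (\<gamma> v w)) t"
    "h \<in> carrier A \<Longrightarrow> act K H M h (SW V W X \<gamma> t) = SW V W X (\<lambda>v w. act K H M h (\<gamma> v w)) t"
  using assms unfolding linear_data_def by (auto intro!: lin_sweedler dest: bilinD(4))

lemma linear_data_push_left [simp]:
  assumes "linear_data M" "X = mspace M" "\<And>v w. v \<in> carrier V \<Longrightarrow> w \<in> carrier W \<Longrightarrow> \<gamma> v w \<in> carrier A"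
   "m \<in> carrier X"
  shows "act K H M (SW V W A \<gamma> t) m = SW V W X (\<lambda>v w. act K H M (\<gamma> v w) m) t"
proof -
  have "lin K A X (\<lambda>h. act K H M h m)" using assms unfolding linear_data_def by (auto dest: bilinD)
  from lin_sweedler[OF this assms(3)] show ?thesis by simp
qed

abbreviation yd where "yd \<equiv> yetter_drinfeld K H"

lemma linear_dataI:
  assumes "module K (mspace M)" "malpha M \<in> linear_maps K (mspace M) (mspace M)"
    "maction M \<in> linear_maps K (A \<boxtimes> mspace M) (mspace M)"
    "mcoaction M \<in> linear_maps K (mspace M) (A \<boxtimes> mspace M)"
  shows "linear_data M"
proof -
  have a: "lin K (A \<boxtimes> mspace M) (mspace M) (maction M)"
    using assms by (intro lin_linear_maps) auto
  have "bilin K A (mspace M) (mspace M) (act K H M)"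
    unfolding act_def using assms by (intro bilinI lin_comp[OF a]) auto
  moreover have "lin K (mspace M) (mspace M) (malpha M)" "lin K (mspace M) (A \<boxtimes> mspace M) (mcoaction M)"
    using assms by (auto intro: lin_linear_maps)
  ultimately show ?thesis by (simp only: linear_data_def)
qed

lemma yd_linear_data [simp]: "yd M \<Longrightarrow> linear_data M"
  by (rule linear_dataI) (simp_all add: yetter_drinfeld_def left_module_def left_comodule_def)

lemma yd_module [simp]: "yd M \<Longrightarrow> module K (mspace M)"
  by (rule linear_data_module[OF yd_linear_data])

lemma malpha_act [simp]:
  "yd M \<Longrightarrow> h \<in> carrier A \<Longrightarrow> m \<in> carrier (mspace M) \<Longrightarrow>
    malpha M (act K H M h m) = act K H M (al h) (malpha M m)"
  by (simp add: yetter_drinfeld_def left_module_def)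

lemma act_act:
  "yd M \<Longrightarrow> h \<in> carrier A \<Longrightarrow> h' \<in> carrier A \<Longrightarrow> m \<in> carrier (mspace M) \<Longrightarrow>
    act K H M (al h) (act K H M h' m) = act K H M (h \<star> h') (malpha M m)"
  unfolding yetter_drinfeld_def left_module_def by blast

lemma co_malpha [simp]:
  assumes "yd M" "m \<in> carrier (mspace M)"
  shows "mcoaction M (malpha M m) =
    SW A (mspace M) (A \<boxtimes> mspace M) (\<lambda>p q. pure K A (mspace M) (al p) (malpha M q)) (mcoaction M m)"
proof -
  have "tensor_map K A (mspace M) A (mspace M) al (malpha M) (mcoaction M m) = mcoaction M (malpha M m)"
    using assms by (simp add: yetter_drinfeld_def left_comodule_def)
  then show ?thesis using assms by (simp add: tensor_map_sweedler)
qed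

lemma co_coassoc:
  assumes "yd M" "m \<in> carrier (mspace M)" "trilin K A A (mspace M) X \<gamma>" "module K X"
  shows "SW A (mspace M) X (\<lambda>p q. SW A A X (\<lambda>a b. \<gamma> a b (malpha M q)) (D p)) (mcoaction M m) =
    SW A (mspace M) X (\<lambda>p q. SW A (mspace M) X (\<lambda>r s. \<gamma> (al p) r s) (mcoaction M q)) (mcoaction M m)"
proof -
  let ?M = "mspace M"
  note [simp] = assms trilin_closed[OF assms(3)] trilin_comp[OF assms(3)]
  let ?G = "\<lambda>t. SW A (A \<boxtimes> ?M) X (\<lambda>a s. SW A ?M X (\<lambda>b c. \<gamma> a b c) s) t"
  have "tassoc K A A ?M (tensor_map K A ?M (A \<boxtimes> A) ?M D (malpha M) (mcoaction M m)) =
      tensor_map K A ?M A (A \<boxtimes> ?M) al (mcoaction M) (mcoaction M m)"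
    using assms(1,2) unfolding yetter_drinfeld_def left_comodule_def by blast
  then have "?G (tassoc K A A ?M (tensor_map K A ?M (A \<boxtimes> A) ?M D (malpha M) (mcoaction M m))) =
      ?G (tensor_map K A ?M A (A \<boxtimes> ?M) al (mcoaction M) (mcoaction M m))" by simp
  then show ?thesis by (simp add: tassoc_sweedler tensor_map_sweedler)
qed

text \<open>
  The Yetter-Drinfeld condition under an arbitrary bilinear \<open>\<gamma>\<close>, obtained by applying the
  linear map induced by \<open>\<gamma>\<close> to both sides.
\<close>

lemma yd_compat:
  assumes "yd M" "h \<in> carrier A" "m \<in> carrier (mspace M)" "bilin K A (mspace M) X \<gamma>"
  shows "SW A A X (\<lambda>h1 h2. SW A (mspace M) X (\<lambda>p q. \<gamma> (p \<star> al (al h2)) q) (mcoaction M (act K H M h1 m))) (D h) =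
    SW A A X (\<lambda>h1 h2. SW A (mspace M) X (\<lambda>p q. \<gamma> (al (al h1) \<star> al p) (act K H M (al h2) q)) (mcoaction M m)) (D h)"
proof -
  let ?M = "mspace M"
  note [simp] = assms bilinD(3,6)[OF assms(4)] bilin_comp[OF assms(4)]
  let ?G = "\<lambda>t. SW A ?M X \<gamma> t"
  have "SW A A (A \<boxtimes> ?M) (\<lambda>h1 h2. SW A (mspace M) (A \<boxtimes> ?M) (\<lambda>p q. pure K A ?M (p \<star> al (al h2)) q) (mcoaction M (act K H M h1 m))) (D h) =
    SW A A (A \<boxtimes> ?M) (\<lambda>h1 h2. SW A (mspace M) (A \<boxtimes> ?M) (\<lambda>p q. pure K A ?M (al (al h1) \<star> al p) (act K H M (al h2) q)) (mcoaction M m)) (D h)"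
    (is "?L = ?R")
    using assms(1,2,3) unfolding yetter_drinfeld_def
    by (simp add: tsum_sweedler[of _ K A A] tsum_sweedler[of _ K A ?M])
  then have "?G ?L = ?G ?R" by simp
  then show ?thesis by simp
qed

text \<open>
  The axioms of a Yetter-Drinfeld module as equations between Sweedler sums, with a separate name \<open>V\<close> for the
  underlying space so that it can be given in simplified form.
\<close>

lemma ydI:
  assumes V: "mspace M = V"
    and M: "module K V" "malpha M \<in> linear_maps K V V"
    "maction M \<in> linear_maps K (A \<boxtimes> V) V"
    "mcoaction M \<in> linear_maps K V (A \<boxtimes> V)"
    and act1: "\<And>h m. h \<in> carrier A \<Longrightarrow> m \<in> carrier V \<Longrightarrow>
      malpha M (act K H M h m) = act K H M (al h) (malpha M m)"
    and act2: "\<And>h h' m. h \<in> carrier A \<Longrightarrow> h' \<in> carrier A \<Longrightarrow> m \<in> carrier V \<Longrightarrow>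
      act K H M (al h) (act K H M h' m) = act K H M (h \<star> h') (malpha M m)"
    and co1: "\<And>m. m \<in> carrier V \<Longrightarrow>
      SW A V (A \<boxtimes> V) (\<lambda>p q. pure K A V (al p) (malpha M q)) (mcoaction M m)
      = mcoaction M (malpha M m)"
    and co2: "\<And>m. m \<in> carrier V \<Longrightarrow>
      SW A V (A \<boxtimes> A \<boxtimes> V) (\<lambda>p q. SW A A (A \<boxtimes> A \<boxtimes> V)
        (\<lambda>a b. pure K A (A \<boxtimes> V) a (pure K A V b (malpha M q))) (D p)) (mcoaction M m) =
      SW A V (A \<boxtimes> A \<boxtimes> V) (\<lambda>p q. pure K A (A \<boxtimes> V) (al p) (mcoaction M q)) (mcoaction M m)"
    and compat: "\<And>h m. h \<in> carrier A \<Longrightarrow> m \<in> carrier V \<Longrightarrow>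
      SW A A (A \<boxtimes> V) (\<lambda>h1 h2. SW A V (A \<boxtimes> V)
        (\<lambda>p q. pure K A V (p \<star> al (al h2)) q) (mcoaction M (act K H M h1 m))) (D h) =
      SW A A (A \<boxtimes> V) (\<lambda>h1 h2. SW A V (A \<boxtimes> V)
        (\<lambda>p q. pure K A V (al (al h1) \<star> al p) (act K H M (al h2) q)) (mcoaction M m)) (D h)"
  shows "yd M"
proof -
  note M' = M[folded V]
  note [simp] = linear_dataI[OF M'] M(1) V
  have "left_module K H M" unfolding left_module_def V using M act1 act2 by blast
  moreover have "left_comodule K H M"
    unfolding left_comodule_def V using M
    by (intro conjI ballI) (simp_all add: tensor_map_sweedler tassoc_sweedler co1 co2)
  ultimately show ?thesis unfolding yetter_drinfeld_def V
    by (simp add: tsum_sweedler[of _ K A A] tsum_sweedler[of _ K A "V"] compat)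
qed

lemma malpha_ext: "yd M \<Longrightarrow> malpha M \<in> extensional (carrier (mspace M))"
  unfolding yetter_drinfeld_def left_module_def linear_maps_def PiE_def by blast

lemma maction_ext: "yd M \<Longrightarrow> maction M \<in> extensional (carrier (A \<boxtimes> mspace M))"
  unfolding yetter_drinfeld_def left_module_def linear_maps_def PiE_def by blast

lemma mcoaction_ext: "yd M \<Longrightarrow> mcoaction M \<in> extensional (carrier (mspace M))"
  unfolding yetter_drinfeld_def left_comodule_def linear_maps_def PiE_def by blast

lemma malpha_linear_map: "yd M \<Longrightarrow> malpha M \<in> linear_maps K (mspace M) (mspace M)"
  unfolding yetter_drinfeld_def left_module_def by blast

section \<open>The twisted Yetter-Drinfeld module\<close>

definition twist :: "('k, 'a tuniv) yd_module \<Rightarrow> ('k, 'a tuniv) yd_module" where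
  "twist M = \<lparr>mspace = mspace M, malpha = malpha M,
    maction = (\<lambda>x\<in>carrier (A \<boxtimes> mspace M). SW A (mspace M) (mspace M) (\<lambda>h m. act K H M (al h) m) x),
    mcoaction = (\<lambda>m\<in>carrier (mspace M).
      SW A (mspace M) (A \<boxtimes> mspace M) (\<lambda>p q. pure K A (mspace M) (ai p) q) (mcoaction M m))\<rparr>"

lemma twist_simps [simp]:
  "mspace (twist M) = mspace M" "malpha (twist M) = malpha M"
  by (simp_all add: twist_def)

lemma act_twist [simp]:
  "linear_data M \<Longrightarrow> h \<in> carrier A \<Longrightarrow> m \<in> carrier (mspace M) \<Longrightarrow> act K H (twist M) h m = act K H M (al h) m"
  by (simp add: act_def[of K H "twist M"] linear_data_module) (simp add: twist_def linear_data_module)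

lemma mcoaction_twist [simp]:
  "m \<in> carrier (mspace M) \<Longrightarrow> mcoaction (twist M) m =
     SW A (mspace M) (A \<boxtimes> mspace M) (\<lambda>p q. pure K A (mspace M) (ai p) q) (mcoaction M m)"
  by (simp add: twist_def)

text \<open>
  Each axiom of \<open>twist M\<close> is the corresponding axiom of \<open>M\<close> after a substitution: coassociativity
  is that of \<open>M\<close> with \<open>\<alpha>\<inverse>\<close> applied to the two legs in \<open>H\<close>, and the compatibility condition at \<open>h\<close> is
  that of \<open>M\<close> at \<open>\<alpha>(h)\<close> with \<open>\<alpha>\<inverse>\<close> applied to the leg in \<open>H\<close>.
\<close>

lemma yd_twist [simp]:
  assumes "yd M"
  shows "yd (twist M)"
proof (rule ydI[where V = "mspace M"])
  note [simp] = assms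
  show "mspace (twist M) = mspace M" "module K (mspace M)" by simp_all
  show "malpha (twist M) \<in> linear_maps K (mspace M) (mspace M)"
    by (simp add: malpha_linear_map)
  show "maction (twist M) \<in> linear_maps K (A \<boxtimes> mspace M) (mspace M)"
    unfolding twist_def by (simp add: restrict_linear_maps)
  show "mcoaction (twist M) \<in> linear_maps K (mspace M) (A \<boxtimes> mspace M)"
    unfolding twist_def by (simp add: restrict_linear_maps)
  fix m assume [simp]: "m \<in> carrier (mspace M)"
  show "SW A (mspace M) (A \<boxtimes> mspace M)
      (\<lambda>p q. pure K A (mspace M) (al p) (malpha (twist M) q)) (mcoaction (twist M) m)
      = mcoaction (twist M) (malpha (twist M) m)" by simp
  show "SW A (mspace M) (A \<boxtimes> A \<boxtimes> mspace M) (\<lambda>p q. SW A A (A \<boxtimes> A \<boxtimes> mspace M)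
        (\<lambda>a b. pure K A (A \<boxtimes> mspace M) a (pure K A (mspace M) b (malpha (twist M) q))) (D p)) (mcoaction (twist M) m) =
      SW A (mspace M) (A \<boxtimes> A \<boxtimes> mspace M) (\<lambda>p q. pure K A (A \<boxtimes> mspace M) (al p) (mcoaction (twist M) q)) (mcoaction (twist M) m)"
    using co_coassoc[of M m "A \<boxtimes> A \<boxtimes> mspace M"
      "\<lambda>a b q. pure K A (A \<boxtimes> mspace M) (ai a) (pure K A (mspace M) (ai b) q)"]
    by simp
  fix h assume [simp]: "h \<in> carrier A"
  show "malpha (twist M) (act K H (twist M) h m) = act K H (twist M) (al h) (malpha (twist M) m)"
    by simp
  show "SW A A (A \<boxtimes> mspace M) (\<lambda>h1 h2. SW A (mspace M) (A \<boxtimes> mspace M)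
        (\<lambda>p q. pure K A (mspace M) (p \<star> al (al h2)) q) (mcoaction (twist M) (act K H (twist M) h1 m))) (D h) =
      SW A A (A \<boxtimes> mspace M) (\<lambda>h1 h2. SW A (mspace M) (A \<boxtimes> mspace M)
        (\<lambda>p q. pure K A (mspace M) (al (al h1) \<star> al p) (act K H (twist M) (al h2) q)) (mcoaction (twist M) m)) (D h)"
    using yd_compat[of M "al h" m "A \<boxtimes> mspace M" "\<lambda>p q. pure K A (mspace M) (ai p) q"]
    by simp
  fix h' assume [simp]: "h' \<in> carrier A"
  show "act K H (twist M) (al h) (act K H (twist M) h' m) = act K H (twist M) (h \<star> h') (malpha (twist M) m)"
    by (simp add: act_act)
qed

section \<open>The tensor product of Yetter-Drinfeld modules\<close>

abbreviation ten (infixl \<open>\<otimes>\<^sub>y\<^sub>d\<close> 70) where "M \<otimes>\<^sub>y\<^sub>d N \<equiv> yd_tensor K H M N"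
abbreviation mten where "mten M N \<equiv> mspace M \<boxtimes> mspace N"

lemma mspace_tensor [simp]: "mspace (M \<otimes>\<^sub>y\<^sub>d N) = mspace M \<boxtimes> mspace N"
  by (simp add: yd_tensor_def Let_def)

context
  fixes M N assumes MN [simp]: "yd M" "yd N"
begin

lemma lin_malpha: "lin K (mspace M) (mspace M) (malpha M)" "lin K (mspace N) (mspace N) (malpha N)"
  by simp_all

lemma malpha_tensor [simp]:
  "V = mspace M \<Longrightarrow> W = mspace N \<Longrightarrow> m \<in> carrier V \<Longrightarrow> n \<in> carrier W \<Longrightarrow>
   malpha (M \<otimes>\<^sub>y\<^sub>d N) (pure K V W m n) = pure K V W (malpha M m) (malpha N n)"
  by (simp add: yd_tensor_def Let_def tensor_map_pure)

lemma act_tensor_general: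
  "h \<in> carrier A \<Longrightarrow> t \<in> carrier (mten M N) \<Longrightarrow>
   act K H (M \<otimes>\<^sub>y\<^sub>d N) h t = SW A A (mten M N) (\<lambda>h1 h2. SW (mspace M) (mspace N) (mten M N)
     (\<lambda>m n. pure K (mspace M) (mspace N) (act K H M h1 m) (act K H N h2 n)) t) (D h)"
  by (simp add: act_def[of K H "M \<otimes>\<^sub>y\<^sub>d N"])
   (simp add: yd_tensor_def Let_def tsum_sweedler[of _ K A "mten M N"] tsum_sweedler[of _ K A A]
     tsum_sweedler[of _ K "mspace M" "mspace N"])

lemma act_tensor [simp]:
  "V = mspace M \<Longrightarrow> W = mspace N \<Longrightarrow> h \<in> carrier A \<Longrightarrow> m \<in> carrier V \<Longrightarrow> n \<in> carrier W \<Longrightarrow>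
   act K H (M \<otimes>\<^sub>y\<^sub>d N) h (pure K V W m n) = SW A A (V \<boxtimes> W) (\<lambda>h1 h2.
     pure K V W (act K H M h1 m) (act K H N h2 n)) (D h)"
  by (simp add: act_tensor_general)

lemma mcoaction_tensor_general:
  "t \<in> carrier (mten M N) \<Longrightarrow> mcoaction (M \<otimes>\<^sub>y\<^sub>d N) t =
    SW (mspace M) (mspace N) (A \<boxtimes> mten M N) (\<lambda>m n. SW A (mspace M) (A \<boxtimes> mten M N) (\<lambda>p q.
       SW A (mspace N) (A \<boxtimes> mten M N) (\<lambda>r s. pure K A (mten M N) (ai (ai (p \<star> r)))
         (pure K (mspace M) (mspace N) q s)) (mcoaction N n)) (mcoaction M m)) t"
  by (simp add: yd_tensor_def Let_def tsum_sweedler[of _ K A "mspace M"] tsum_sweedler[of _ K A "mspace N"]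
     tsum_sweedler[of _ K "mspace M" "mspace N"] del: ai_prod)

lemma mcoaction_tensor [simp]:
  "V = mspace M \<Longrightarrow> W = mspace N \<Longrightarrow> m \<in> carrier V \<Longrightarrow> n \<in> carrier W \<Longrightarrow>
    mcoaction (M \<otimes>\<^sub>y\<^sub>d N) (pure K V W m n) =
     SW A V (A \<boxtimes> V \<boxtimes> W) (\<lambda>p q.
       SW A W (A \<boxtimes> V \<boxtimes> W) (\<lambda>r s. pure K A (V \<boxtimes> W) (ai (ai (p \<star> r)))
         (pure K V W q s)) (mcoaction N n)) (mcoaction M m)"
  by (simp add: mcoaction_tensor_general)

lemma tensor_linear_maps:
  "malpha (M \<otimes>\<^sub>y\<^sub>d N) \<in> linear_maps K (mten M N) (mten M N)"
  "maction (M \<otimes>\<^sub>y\<^sub>d N) \<in> linear_maps K (A \<boxtimes> mten M N) (mten M N)"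
  "mcoaction (M \<otimes>\<^sub>y\<^sub>d N) \<in> linear_maps K (mten M N) (A \<boxtimes> mten M N)"
proof -
  have "malpha (M \<otimes>\<^sub>y\<^sub>d N) \<in> extensional (carrier (mten M N))"
    by (simp add: yd_tensor_def Let_def tensor_map_def)
  moreover have "lin K (mten M N) (mten M N) (malpha (M \<otimes>\<^sub>y\<^sub>d N))"
    by (simp only: yd_tensor_def Let_def yd_module.select_convs lin_tensor_map lin_malpha)
  ultimately show "malpha (M \<otimes>\<^sub>y\<^sub>d N) \<in> linear_maps K (mten M N) (mten M N)"
    by (rule linear_mapsI[rotated])
  have "maction (M \<otimes>\<^sub>y\<^sub>d N) = (\<lambda>x\<in>carrier (A \<boxtimes> mten M N). SW A (mten M N) (mten M N) (\<lambda>h t.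
    SW A A (mten M N) (\<lambda>h1 h2. SW (mspace M) (mspace N) (mten M N)
     (\<lambda>m n. pure K (mspace M) (mspace N) (act K H M h1 m) (act K H N h2 n)) t) (D h)) x)"
    by (rule ext) (simp add: yd_tensor_def Let_def tsum_sweedler[of _ K A "mten M N"] tsum_sweedler[of _ K A A]
     tsum_sweedler[of _ K "mspace M" "mspace N"] restrict_def)
  then show "maction (M \<otimes>\<^sub>y\<^sub>d N) \<in> linear_maps K (A \<boxtimes> mten M N) (mten M N)"
    by (simp add: restrict_linear_maps)
  have "mcoaction (M \<otimes>\<^sub>y\<^sub>d N) \<in> extensional (carrier (mten M N))"
    by (simp add: yd_tensor_def Let_def)
  moreover have "lin K (mten M N) (A \<boxtimes> mten M N) (mcoaction (M \<otimes>\<^sub>y\<^sub>d N))"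
    by (rule lin_ext[OF _ mcoaction_tensor_general[symmetric]]) simp_all
  ultimately show "mcoaction (M \<otimes>\<^sub>y\<^sub>d N) \<in> linear_maps K (mten M N) (A \<boxtimes> mten M N)"
    by (rule linear_mapsI[rotated])
qed

lemma linear_data_tensor: "linear_data (M \<otimes>\<^sub>y\<^sub>d N)"
  by (rule linear_dataI) (simp_all add: tensor_linear_maps)

end

text \<open>
  By linearity all axioms need checking only on pure tensors \<open>m \<otimes> n\<close>. For coassociativity, the coassociativity
  of \<open>N\<close> and that of \<open>M\<close> are applied one after the other. In the compatibility condition \<open>(h\<^sub>1\<^sub>1 m)\<^sub>-\<^sub>1 (h\<^sub>1\<^sub>2 n)\<^sub>-\<^sub>1\<close> has to be
  moved past \<open>h\<^sub>2\<close>. Reassociating the product by hom-associativity and the coproduct by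
  hom-coassociativity brings the coaction of \<open>h\<^sub>2\<^sub>1 n\<close> next to \<open>h\<^sub>2\<^sub>2\<close>, where the condition for \<open>N\<close>
  applies; reassociating back brings the coaction of \<open>h\<^sub>1\<^sub>1 m\<close> next to \<open>h\<^sub>1\<^sub>2\<close>, where the condition for
  \<open>M\<close> applies; a last reassociation gives the right-hand side.
\<close>

lemma yd_tensor_closed [simp]:
  assumes MN [simp]: "yd M" "yd N"
  shows "yd (M \<otimes>\<^sub>y\<^sub>d N)"
proof (rule ydI[where V = "mten M N"])
  note [simp] = linear_data_tensor[OF MN]
  let ?P = "M \<otimes>\<^sub>y\<^sub>d N" and ?T = "mten M N" and ?X = "A \<boxtimes> mten M N"
    and ?Y = "A \<boxtimes> A \<boxtimes> mten M N" and ?M = "mspace M" and ?N = "mspace N"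
  let ?g = "\<lambda>z q s. pure K A ?T z (pure K ?M ?N q s)"
  \<comment> \<open>Applying \<open>skip\<close> descends into the body of an outer sum. Wildcards in later instantiations of \<open>\<gamma>\<close>
    stand for the legs bound by the sums already passed.\<close>
  note skip = sweedler_cong[OF HOL.refl HOL.refl HOL.refl HOL.refl]
  show "mspace ?P = ?T" "module K ?T" by simp_all
  show "malpha ?P \<in> linear_maps K ?T ?T"
    "maction ?P \<in> linear_maps K (A \<boxtimes> ?T) ?T"
    "mcoaction ?P \<in> linear_maps K ?T (A \<boxtimes> ?T)"
    by (simp_all add: tensor_linear_maps)
  fix t assume t: "t \<in> carrier ?T"
  show "SW A ?T (A \<boxtimes> ?T) (\<lambda>p q. pure K A ?T (al p) (malpha ?P q)) (mcoaction ?P t)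
      = mcoaction ?P (malpha ?P t)"
    by (rule tensor_eqI[OF t, where X = ?X]) simp_all
  show "SW A ?T (A \<boxtimes> A \<boxtimes> ?T) (\<lambda>p q. SW A A (A \<boxtimes> A \<boxtimes> ?T)
        (\<lambda>a b. pure K A (A \<boxtimes> ?T) a (pure K A ?T b (malpha ?P q))) (D p)) (mcoaction ?P t) =
      SW A ?T (A \<boxtimes> A \<boxtimes> ?T) (\<lambda>p q. pure K A (A \<boxtimes> ?T) (al p) (mcoaction ?P q)) (mcoaction ?P t)"
  proof (rule tensor_eqI[OF t, where X = ?Y])
    fix m n assume [simp]: "m \<in> carrier ?M" "n \<in> carrier ?N"
    let ?k = "\<lambda>a c b d q s. pure K A ?X (ai (ai a) \<star> ai (ai c)) (?g (ai (ai b) \<star> ai (ai d)) q s)"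
    have "SW A ?M ?Y (\<lambda>p q. SW A ?N ?Y (\<lambda>r s. SW A A ?Y (\<lambda>a b. SW A A ?Y
        (\<lambda>c d. ?k a c b d (malpha M q) (malpha N s)) (D r)) (D p)) (mcoaction N n)) (mcoaction M m) =
      SW A ?M ?Y (\<lambda>p q. SW A A ?Y (\<lambda>a b. SW A ?N ?Y (\<lambda>r s. SW A A ?Y
        (\<lambda>c d. ?k a c b d (malpha M q) (malpha N s)) (D r)) (mcoaction N n)) (D p)) (mcoaction M m)"
      by (rule skip, rule sweedler_swap) simp_all
    also have "\<dots> = SW A ?M ?Y (\<lambda>p q. SW A A ?Y (\<lambda>a b. SW A ?N ?Y (\<lambda>r s. SW A ?N ?Y
        (\<lambda>c d. ?k a (al r) b c (malpha M q) d) (mcoaction N s)) (mcoaction N n)) (D p)) (mcoaction M m)"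
      by (rule skip, rule skip, rule co_coassoc[where \<gamma> = "\<lambda>c d s. ?k _ c _ d (malpha M _) s"]) simp_all
    also have "\<dots> = SW A ?M ?Y (\<lambda>p q. SW A ?M ?Y (\<lambda>a b. SW A ?N ?Y (\<lambda>r s. SW A ?N ?Y
        (\<lambda>c d. ?k (al p) (al r) a c b d) (mcoaction N s)) (mcoaction N n)) (mcoaction M q)) (mcoaction M m)"
      by (rule co_coassoc[where \<gamma> = "\<lambda>a b q. SW A ?N ?Y (\<lambda>r s. SW A ?N ?Y
        (\<lambda>c d. ?k a (al r) b c q d) (mcoaction N s)) (mcoaction N n)"]) simp_all
    also have "\<dots> = SW A ?M ?Y (\<lambda>p q. SW A ?N ?Y (\<lambda>r s. SW A ?M ?Y (\<lambda>a b. SW A ?N ?Y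
        (\<lambda>c d. ?k (al p) (al r) a c b d) (mcoaction N s)) (mcoaction M q)) (mcoaction N n)) (mcoaction M m)"
      by (rule skip, rule sweedler_swap) simp_all
    finally show "SW A ?T ?Y (\<lambda>p q. SW A A ?Y
        (\<lambda>a b. pure K A ?X a (pure K A ?T b (malpha ?P q))) (D p)) (mcoaction ?P (pure K ?M ?N m n)) =
      SW A ?T ?Y (\<lambda>p q. pure K A ?X (al p) (mcoaction ?P q)) (mcoaction ?P (pure K ?M ?N m n))"
      by simp
  qed simp_all
  fix h assume [simp]: "h \<in> carrier A"
  show "malpha ?P (act K H ?P h t) = act K H ?P (al h) (malpha ?P t)"
    by (rule tensor_eqI[OF t, where X = ?T]) simp_all
  show "act K H ?P (al h) (act K H ?P h' t) = act K H ?P (h \<star> h') (malpha ?P t)"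
    if [simp]: "h' \<in> carrier A" for h'
  proof (rule tensor_eqI[OF t, where X = ?T])
    fix m n assume [simp]: "m \<in> carrier ?M" "n \<in> carrier ?N"
    show "act K H ?P (al h) (act K H ?P h' (pure K ?M ?N m n)) =
      act K H ?P (h \<star> h') (malpha ?P (pure K ?M ?N m n))"
      by (simp add: act_act) (rule sweedler_swap, simp_all)
  qed simp_all
  show "SW A A (A \<boxtimes> ?T) (\<lambda>h1 h2. SW A ?T (A \<boxtimes> ?T)
        (\<lambda>p q. pure K A ?T (p \<star> al (al h2)) q) (mcoaction ?P (act K H ?P h1 t))) (D h) =
      SW A A (A \<boxtimes> ?T) (\<lambda>h1 h2. SW A ?T (A \<boxtimes> ?T)
        (\<lambda>p q. pure K A ?T (al (al h1) \<star> al p) (act K H ?P (al h2) q)) (mcoaction ?P t)) (D h)"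
  proof (rule tensor_eqI[OF t, where X = ?X])
    fix m n assume [simp]: "m \<in> carrier ?M" "n \<in> carrier ?N"
    \<comment> \<open>Since \<open>\<alpha>\<close> is bijective, hom-associativity may be applied to preimages under \<open>\<alpha>\<close>.\<close>
    have eq1: "(ai (ai p) \<star> ai (ai r)) \<star> al (al b) = ai p \<star> (ai (ai r) \<star> al b)"
      if "p \<in> carrier A" "r \<in> carrier A" "b \<in> carrier A" for p r b
      using hom_assoc[of "ai (ai p)" "ai (ai r)" "al b"] that by simp
    have eq2: "ai p \<star> (b \<star> ai r) = (ai (ai p) \<star> b) \<star> r"
      if "p \<in> carrier A" "r \<in> carrier A" "b \<in> carrier A" for p r b
      using hom_assoc[of "ai (ai p)" b "ai r"] that by simp
    have eq3: "(a \<star> ai p) \<star> r = al a \<star> (ai p \<star> ai r)"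
      if "p \<in> carrier A" "r \<in> carrier A" "a \<in> carrier A" for p r a
      using hom_assoc[of a "ai p" "ai r"] that by simp
    have "SW A A ?X (\<lambda>a b. SW A A ?X (\<lambda>a1 a2. SW A ?M ?X (\<lambda>p q. SW A ?N ?X (\<lambda>r s.
        ?g ((ai (ai p) \<star> ai (ai r)) \<star> al (al b)) q s)
        (mcoaction N (act K H N a2 n))) (mcoaction M (act K H M a1 m))) (D a)) (D h) =
      SW A A ?X (\<lambda>a b. SW A A ?X (\<lambda>a1 a2. SW A ?M ?X (\<lambda>p q. SW A ?N ?X (\<lambda>r s.
        ?g (ai p \<star> (ai (ai r) \<star> al b)) q s)
        (mcoaction N (act K H N a2 n))) (mcoaction M (act K H M a1 m))) (D a)) (D h)"
      by (simp add: eq1)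
    also have "\<dots> = SW A A ?X (\<lambda>a b. SW A A ?X (\<lambda>b1 b2. SW A ?M ?X (\<lambda>p q. SW A ?N ?X (\<lambda>r s.
        ?g (ai p \<star> (ai (ai r) \<star> b2)) q s)
        (mcoaction N (act K H N b1 n))) (mcoaction M (act K H M (al a) m))) (D b)) (D h)"
      by (rule coassoc[where \<gamma> = "\<lambda>x y z. SW A ?M ?X (\<lambda>p q. SW A ?N ?X (\<lambda>r s.
        ?g (ai p \<star> (ai (ai r) \<star> z)) q s)
        (mcoaction N (act K H N y n))) (mcoaction M (act K H M x m))"]) simp_all
    also have "\<dots> = SW A A ?X (\<lambda>a b. SW A ?M ?X (\<lambda>p q. SW A A ?X (\<lambda>b1 b2. SW A ?N ?X (\<lambda>r s.
        ?g (ai p \<star> ai (ai (r \<star> al (al b2)))) q s)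
        (mcoaction N (act K H N b1 n))) (D b)) (mcoaction M (act K H M (al a) m))) (D h)"
      by (simp, rule skip, rule sweedler_swap) simp_all
    also have "\<dots> = SW A A ?X (\<lambda>a b. SW A ?M ?X (\<lambda>p q. SW A A ?X (\<lambda>b1 b2. SW A ?N ?X (\<lambda>r s.
        ?g (ai p \<star> ai (ai (al (al b1) \<star> al r))) q (act K H N (al b2) s))
        (mcoaction N n)) (D b)) (mcoaction M (act K H M (al a) m))) (D h)"
      by (rule skip, rule skip, rule yd_compat) simp_all
    also have "\<dots> = SW A A ?X (\<lambda>a b. SW A A ?X (\<lambda>b1 b2. SW A ?M ?X (\<lambda>p q. SW A ?N ?X (\<lambda>r s.
        ?g ((ai (ai p) \<star> b1) \<star> r) q (act K H N (al b2) s))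
        (mcoaction N n)) (mcoaction M (act K H M (al a) m))) (D b)) (D h)"
      by (simp add: eq2, rule skip, rule sweedler_swap) simp_all
    also have "\<dots> = SW A A ?X (\<lambda>a b. SW A A ?X (\<lambda>a1 a2. SW A ?M ?X (\<lambda>p q. SW A ?N ?X (\<lambda>r s.
        ?g ((ai (ai p) \<star> a2) \<star> r) q (act K H N (al (al b)) s))
        (mcoaction N n)) (mcoaction M (act K H M a1 m))) (D a)) (D h)"
      by (rule coassoc[symmetric, where \<gamma> = "\<lambda>x y z. SW A ?M ?X (\<lambda>p q. SW A ?N ?X (\<lambda>r s.
        ?g ((ai (ai p) \<star> y) \<star> r) q (act K H N (al z) s))
        (mcoaction N n)) (mcoaction M (act K H M x m))"]) simp_all
    also have "\<dots> = SW A A ?X (\<lambda>a b. SW A A ?X (\<lambda>a1 a2. SW A ?M ?X (\<lambda>p q. SW A ?N ?X (\<lambda>r s.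
        ?g (ai (ai (p \<star> al (al a2))) \<star> r) q (act K H N (al (al b)) s))
        (mcoaction N n)) (mcoaction M (act K H M a1 m))) (D a)) (D h)"
      by simp
    also have "\<dots> = SW A A ?X (\<lambda>a b. SW A A ?X (\<lambda>a1 a2. SW A ?M ?X (\<lambda>p q. SW A ?N ?X (\<lambda>r s.
        ?g (ai (ai (al (al a1) \<star> al p)) \<star> r) (act K H M (al a2) q) (act K H N (al (al b)) s))
        (mcoaction N n)) (mcoaction M m)) (D a)) (D h)"
      by (rule skip, rule yd_compat[where \<gamma> = "\<lambda>x q. SW A ?N ?X (\<lambda>r s. ?g (ai (ai x) \<star> r) q
        (act K H N (al (al _)) s)) (mcoaction N n)"]) simp_all
    also have "\<dots> = SW A A ?X (\<lambda>a b. SW A A ?X (\<lambda>a1 a2. SW A ?M ?X (\<lambda>p q. SW A ?N ?X (\<lambda>r s.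
        ?g (al a1 \<star> (ai p \<star> ai r)) (act K H M (al a2) q) (act K H N (al (al b)) s))
        (mcoaction N n)) (mcoaction M m)) (D a)) (D h)"
      by (simp add: eq3)
    also have "\<dots> = SW A A ?X (\<lambda>a b. SW A A ?X (\<lambda>b1 b2. SW A ?M ?X (\<lambda>p q. SW A ?N ?X (\<lambda>r s.
        ?g (al (al a) \<star> (ai p \<star> ai r)) (act K H M (al b1) q) (act K H N (al b2) s))
        (mcoaction N n)) (mcoaction M m)) (D b)) (D h)"
      by (rule coassoc[where \<gamma> = "\<lambda>x y z. SW A ?M ?X (\<lambda>p q. SW A ?N ?X (\<lambda>r s.
        ?g (al x \<star> (ai p \<star> ai r)) (act K H M (al y) q) (act K H N (al z) s))
        (mcoaction N n)) (mcoaction M m)"]) simp_all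
    also have "\<dots> = SW A A ?X (\<lambda>a b. SW A ?M ?X (\<lambda>p q. SW A A ?X (\<lambda>b1 b2. SW A ?N ?X (\<lambda>r s.
        ?g (al (al a) \<star> (ai p \<star> ai r)) (act K H M (al b1) q) (act K H N (al b2) s))
        (mcoaction N n)) (D b)) (mcoaction M m)) (D h)"
      by (rule skip, rule sweedler_swap) simp_all
    also have "\<dots> = SW A A ?X (\<lambda>a b. SW A ?M ?X (\<lambda>p q. SW A ?N ?X (\<lambda>r s. SW A A ?X (\<lambda>b1 b2.
        ?g (al (al a) \<star> (ai p \<star> ai r)) (act K H M (al b1) q) (act K H N (al b2) s))
        (D b)) (mcoaction N n)) (mcoaction M m)) (D h)"
      by (rule skip, rule skip, rule sweedler_swap) simp_all
    finally show "SW A A (A \<boxtimes> ?T) (\<lambda>h1 h2. SW A ?T (A \<boxtimes> ?T)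
        (\<lambda>p q. pure K A ?T (p \<star> al (al h2)) q) (mcoaction ?P (act K H ?P h1 (pure K ?M ?N m n)))) (D h) =
      SW A A (A \<boxtimes> ?T) (\<lambda>h1 h2. SW A ?T (A \<boxtimes> ?T)
        (\<lambda>p q. pure K A ?T (al (al h1) \<star> al p) (act K H ?P (al h2) q)) (mcoaction ?P (pure K ?M ?N m n))) (D h)"
      by simp
  qed simp_all
qed

end

section \<open>Maps between tensor products\<close>

lemma lin_restrict [simp]:
  "lin K V X f \<Longrightarrow> lin K V X (\<lambda>x\<in>carrier V. f x)"
  by (rule lin_ext) simp_all

lemma tensor_map_simps [simp]:
  assumes "lin K V V' f" "lin K W W' g"
  shows "t \<in> carrier (tensor K V W) \<Longrightarrow> tensor_map K V W V' W' f g t \<in> carrier (tensor K V' W')"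
    "lin K U (tensor K V W) e \<Longrightarrow> lin K U (tensor K V' W') (\<lambda>x. tensor_map K V W V' W' f g (e x))"
    "v \<in> carrier V \<Longrightarrow> w \<in> carrier W \<Longrightarrow>
      tensor_map K V W V' W' f g (pure K V W v w) = pure K V' W' (f v) (g w)"
    "(\<And>p q. p \<in> carrier P \<Longrightarrow> q \<in> carrier Q \<Longrightarrow> \<gamma> p q \<in> carrier (tensor K V W)) \<Longrightarrow>
      tensor_map K V W V' W' f g (sweedler K P Q (tensor K V W) \<gamma> t) =
      sweedler K P Q (tensor K V' W') (\<lambda>p q. tensor_map K V W V' W' f g (\<gamma> p q)) t"
  using lin_tensor_map[OF assms] tensor_map_pure[OF assms]
  by (auto intro: linD lin_comp lin_sweedler)

lemma tassoc_simps [simp]: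
  assumes "module K U" "module K V" "module K W"
  shows "t \<in> carrier (tensor K (tensor K U V) W) \<Longrightarrow> tassoc K U V W t \<in> carrier (tensor K U (tensor K V W))"
    "lin K Y (tensor K (tensor K U V) W) e \<Longrightarrow> lin K Y (tensor K U (tensor K V W)) (\<lambda>x. tassoc K U V W (e x))"
    "u \<in> carrier U \<Longrightarrow> v \<in> carrier V \<Longrightarrow> w \<in> carrier W \<Longrightarrow>
      tassoc K U V W (pure K (tensor K U V) W (pure K U V u v) w) = pure K U (tensor K V W) u (pure K V W v w)"
    "(\<And>p q. p \<in> carrier P \<Longrightarrow> q \<in> carrier Q \<Longrightarrow> \<gamma> p q \<in> carrier (tensor K (tensor K U V) W)) \<Longrightarrow>
      tassoc K U V W (sweedler K P Q (tensor K (tensor K U V) W) \<gamma> t) =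
      sweedler K P Q (tensor K U (tensor K V W)) (\<lambda>p q. tassoc K U V W (\<gamma> p q)) t"
  using lin_tassoc[OF assms] tassoc_pure[OF assms]
  by (auto intro: linD lin_comp lin_sweedler)

definition tassoc_inv ::
  "('k, 'r) ring_scheme \<Rightarrow> ('k, 'a tuniv) module \<Rightarrow> ('k, 'a tuniv) module \<Rightarrow> ('k, 'a tuniv) module \<Rightarrow> 'a tuniv \<Rightarrow> 'a tuniv" where
  "tassoc_inv K U V W = (\<lambda>t\<in>carrier (tensor K U (tensor K V W)).
    sweedler K U (tensor K V W) (tensor K (tensor K U V) W) (\<lambda>u s.
      sweedler K V W (tensor K (tensor K U V) W) (\<lambda>v w. pure K (tensor K U V) W (pure K U V u v) w) s) t)"

lemma lin_tassoc_inv: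
  assumes "module K U" "module K V" "module K W"
  shows "lin K (tensor K U (tensor K V W)) (tensor K (tensor K U V) W) (tassoc_inv K U V W)"
  unfolding tassoc_inv_def by (rule lin_restrict) (simp add: assms)

lemma tassoc_inv_simps [simp]:
  assumes "module K U" "module K V" "module K W"
  shows "t \<in> carrier (tensor K U (tensor K V W)) \<Longrightarrow> tassoc_inv K U V W t \<in> carrier (tensor K (tensor K U V) W)"
    "lin K Y (tensor K U (tensor K V W)) e \<Longrightarrow> lin K Y (tensor K (tensor K U V) W) (\<lambda>x. tassoc_inv K U V W (e x))"
    "u \<in> carrier U \<Longrightarrow> v \<in> carrier V \<Longrightarrow> w \<in> carrier W \<Longrightarrow>
      tassoc_inv K U V W (pure K U (tensor K V W) u (pure K V W v w)) = pure K (tensor K U V) W (pure K U V u v) w"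
    "(\<And>p q. p \<in> carrier P \<Longrightarrow> q \<in> carrier Q \<Longrightarrow> \<gamma> p q \<in> carrier (tensor K U (tensor K V W))) \<Longrightarrow>
      tassoc_inv K U V W (sweedler K P Q (tensor K U (tensor K V W)) \<gamma> t) =
      sweedler K P Q (tensor K (tensor K U V) W) (\<lambda>p q. tassoc_inv K U V W (\<gamma> p q)) t"
proof -
  note L = lin_tassoc_inv[OF assms]
  show "t \<in> carrier (tensor K U (tensor K V W)) \<Longrightarrow> tassoc_inv K U V W t \<in> carrier (tensor K (tensor K U V) W)"
    by (rule linD(3)[OF L])
  show "lin K Y (tensor K U (tensor K V W)) e \<Longrightarrow> lin K Y (tensor K (tensor K U V) W) (\<lambda>x. tassoc_inv K U V W (e x))"
    by (rule lin_comp[OF L])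
  show "u \<in> carrier U \<Longrightarrow> v \<in> carrier V \<Longrightarrow> w \<in> carrier W \<Longrightarrow>
      tassoc_inv K U V W (pure K U (tensor K V W) u (pure K V W v w)) = pure K (tensor K U V) W (pure K U V u v) w"
    by (simp add: tassoc_inv_def assms)
  show "(\<And>p q. p \<in> carrier P \<Longrightarrow> q \<in> carrier Q \<Longrightarrow> \<gamma> p q \<in> carrier (tensor K U (tensor K V W))) \<Longrightarrow>
      tassoc_inv K U V W (sweedler K P Q (tensor K U (tensor K V W)) \<gamma> t) =
      sweedler K P Q (tensor K (tensor K U V) W) (\<lambda>p q. tassoc_inv K U V W (\<gamma> p q)) t"
    by (rule lin_sweedler[OF L])
qed

text \<open>
  Linear maps on a triple tensor product are equal if they agree on pure triples: fix the last
  leg and use the criterion for two factors in the remaining ones.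
\<close>

lemma tensor_eqI3_left:
  assumes "t \<in> carrier (tensor K (tensor K U V) W)"
    "lin K (tensor K (tensor K U V) W) X f" "lin K (tensor K (tensor K U V) W) X g"
    "module K U" "module K V" "module K W"
    "\<And>u v w. u \<in> carrier U \<Longrightarrow> v \<in> carrier V \<Longrightarrow> w \<in> carrier W \<Longrightarrow>
      f (pure K (tensor K U V) W (pure K U V u v) w) = g (pure K (tensor K U V) W (pure K U V u v) w)"
  shows "f t = g t"
proof (rule tensor_eqI[OF assms(1-3)])
  fix s w assume s: "s \<in> carrier (tensor K U V)" and w: "w \<in> carrier W"
  show "f (pure K (tensor K U V) W s w) = g (pure K (tensor K U V) W s w)"
    by (rule tensor_eqI[OF s, where X = X and f = "\<lambda>s. f (pure K (tensor K U V) W s w)"])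
      (use assms w in \<open>auto intro: lin_comp[OF assms(2)] lin_comp[OF assms(3)]\<close>)
qed (use assms in auto)

lemma tensor_eqI3_right:
  assumes "t \<in> carrier (tensor K U (tensor K V W))"
    "lin K (tensor K U (tensor K V W)) X f" "lin K (tensor K U (tensor K V W)) X g"
    "module K U" "module K V" "module K W"
    "\<And>u v w. u \<in> carrier U \<Longrightarrow> v \<in> carrier V \<Longrightarrow> w \<in> carrier W \<Longrightarrow>
      f (pure K U (tensor K V W) u (pure K V W v w)) = g (pure K U (tensor K V W) u (pure K V W v w))"
  shows "f t = g t"
proof (rule tensor_eqI[OF assms(1-3)])
  fix s u assume s: "s \<in> carrier (tensor K V W)" and u: "u \<in> carrier U"
  show "f (pure K U (tensor K V W) u s) = g (pure K U (tensor K V W) u s)"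
    by (rule tensor_eqI[OF s, where X = X and f = "\<lambda>s. f (pure K U (tensor K V W) u s)"])
      (use assms u in \<open>auto intro: lin_comp[OF assms(2)] lin_comp[OF assms(3)]\<close>)
qed (use assms in auto)

context yd_setting begin

section \<open>Morphisms of Yetter-Drinfeld modules\<close>

definition mor where "mor M N f \<longleftrightarrow> yd M \<and> yd N \<and> yd_morphism K H M N f"

lemma morI:
  assumes "yd M" "yd N" "mspace M = V" "mspace N = W" "lin K V W f" "f \<in> extensional (carrier V)"
    "\<And>m. m \<in> carrier V \<Longrightarrow> f (malpha M m) = malpha N (f m)"
    "\<And>h m. h \<in> carrier A \<Longrightarrow> m \<in> carrier V \<Longrightarrow> f (act K H M h m) = act K H N h (f m)"
    "\<And>m. m \<in> carrier V \<Longrightarrow>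
      SW A V (A \<boxtimes> W) (\<lambda>p q. pure K A W p (f q)) (mcoaction M m) = mcoaction N (f m)"
  shows "mor M N f"
proof -
  note [simp] = linD(1,2)[OF assms(5)]
  show ?thesis
  unfolding mor_def yd_morphism_def assms(3,4)
  using assms by (auto simp: linear_mapsI tensor_map_sweedler)
qed

lemma mor_lin: "mor M N f \<Longrightarrow> lin K (mspace M) (mspace N) f"
  unfolding mor_def yd_morphism_def by (auto intro: lin_linear_maps)

lemma mor_ext: "mor M N f \<Longrightarrow> f \<in> extensional (carrier (mspace M))"
  unfolding mor_def yd_morphism_def linear_maps_def PiE_def by blast

lemma mor_yd: "mor M N f \<Longrightarrow> yd M" "mor M N f \<Longrightarrow> yd N"
  by (auto simp: mor_def)

lemma mor_eqs:
  assumes f: "mor M N f" and [simp]: "m \<in> carrier (mspace M)"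
  shows "f (malpha M m) = malpha N (f m)"
    "h \<in> carrier A \<Longrightarrow> f (act K H M h m) = act K H N h (f m)"
    "mcoaction N (f m) = SW A (mspace M) (A \<boxtimes> mspace N) (\<lambda>p q. pure K A (mspace N) p (f q)) (mcoaction M m)"
proof -
  note [simp] = mor_yd[OF f]
  show "f (malpha M m) = malpha N (f m)" "h \<in> carrier A \<Longrightarrow> f (act K H M h m) = act K H N h (f m)"
    using f unfolding mor_def yd_morphism_def by auto
  have "tensor_map K A (mspace M) A (mspace N) (\<lambda>h\<in>carrier A. h) f (mcoaction M m) = mcoaction N (f m)"
    using f assms(2) unfolding mor_def yd_morphism_def by blast
  then show "mcoaction N (f m) = SW A (mspace M) (A \<boxtimes> mspace N) (\<lambda>p q. pure K A (mspace N) p (f q)) (mcoaction M m)"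
    by (simp add: tensor_map_sweedler)
qed

lemma mor_rules:
  assumes "mor M N f"
  shows "yd M" "yd N" "lin K (mspace M) (mspace N) f"
    "lin K U (mspace M) e \<Longrightarrow> lin K U (mspace N) (\<lambda>x. f (e x))"
    "m \<in> carrier (mspace M) \<Longrightarrow> f m \<in> carrier (mspace N)"
    "(\<And>p q. p \<in> carrier P \<Longrightarrow> q \<in> carrier Q \<Longrightarrow> \<gamma> p q \<in> carrier (mspace M)) \<Longrightarrow>
      f (SW P Q (mspace M) \<gamma> t) = SW P Q (mspace N) (\<lambda>p q. f (\<gamma> p q)) t"
  by (fact mor_yd[OF assms] linD(3)[OF mor_lin[OF assms]] mor_lin[OF assms]
    lin_comp[OF mor_lin[OF assms]] lin_sweedler[OF mor_lin[OF assms]])+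

lemma mor_id: "yd M \<Longrightarrow> mor M M (\<lambda>m\<in>carrier (mspace M). m)"
  by (rule morI[OF _ _ HOL.refl HOL.refl]) (simp_all add: sweedler_expand)

lemma mor_compose:
  assumes "mor M N f" "mor N P g"
  shows "mor M P (compose (carrier (mspace M)) g f)"
proof -
  note [simp] = mor_rules[OF assms(1)] mor_rules[OF assms(2)] mor_eqs[OF assms(1)] mor_eqs[OF assms(2)]
  show ?thesis
    unfolding compose_def by (rule morI[OF _ _ HOL.refl HOL.refl]) simp_all
qed

lemma mor_twist: "mor M N f \<Longrightarrow> mor (twist M) (twist N) f"
proof -
  assume f: "mor M N f"
  note [simp] = mor_rules[OF f] mor_eqs[OF f] mor_ext[OF f]
  show ?thesis by (rule morI[OF _ _ HOL.refl HOL.refl]) simp_all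
qed

text \<open>
  This is the component of \<open>\<Phi>\<close>: \<open>\<alpha>\<^sub>M(h \<cdot> m) = \<alpha>(h) \<cdot> \<alpha>\<^sub>M(m)\<close> is linearity over \<open>H\<close> into \<open>twist M\<close>, and the
  factor \<open>\<alpha>\<close> in the coaction of \<open>\<alpha>\<^sub>M(m)\<close> is cancelled by the \<open>\<alpha>\<inverse>\<close> of \<open>twist M\<close>.
\<close>

lemma mor_malpha: "yd M \<Longrightarrow> mor M (twist M) (malpha M)"
  by (rule morI[OF _ _ HOL.refl HOL.refl]) (simp_all add: malpha_ext)

lemma mor_tensor:
  assumes f: "mor M M' f" and g: "mor N N' g"
  shows "mor (M \<otimes>\<^sub>y\<^sub>d N) (M' \<otimes>\<^sub>y\<^sub>d N') (tensor_map K (mspace M) (mspace N) (mspace M') (mspace N') f g)"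
proof -
  note [simp] = mor_rules[OF f] mor_rules[OF g] mor_eqs[OF f] mor_eqs[OF g] linear_data_tensor
  let ?f = "tensor_map K (mspace M) (mspace N) (mspace M') (mspace N') f g"
  show ?thesis
  proof (rule morI[where V = "mten M N" and W = "mten M' N'"])
    show "?f \<in> extensional (carrier (mten M N))" by (simp add: tensor_map_def)
    show "lin K (mten M N) (mten M' N') ?f" by (simp add: lin_tensor_map)
    fix t assume t: "t \<in> carrier (mten M N)"
    show "?f (malpha (M \<otimes>\<^sub>y\<^sub>d N) t) = malpha (M' \<otimes>\<^sub>y\<^sub>d N') (?f t)"
      by (rule tensor_eqI[OF t, where X = "mten M' N'"]) simp_all
    show "?f (act K H (M \<otimes>\<^sub>y\<^sub>d N) h t) = act K H (M' \<otimes>\<^sub>y\<^sub>d N') h (?f t)" if [simp]: "h \<in> carrier A" for h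
      by (rule tensor_eqI[OF t, where X = "mten M' N'"]) simp_all
    show "SW A (mten M N) (A \<boxtimes> mten M' N') (\<lambda>p q. pure K A (mten M' N') p (?f q)) (mcoaction (M \<otimes>\<^sub>y\<^sub>d N) t) =
        mcoaction (M' \<otimes>\<^sub>y\<^sub>d N') (?f t)"
      by (rule tensor_eqI[OF t, where X = "A \<boxtimes> mten M' N'"]) simp_all
  qed simp_all
qed

text \<open>
  Invertible morphisms have inverse morphisms; this spares a second verification for the inverse
  of the associativity map.
\<close>

lemma mor_inverse:
  assumes f: "mor M N f" and g: "lin K (mspace N) (mspace M) g" "g \<in> extensional (carrier (mspace N))"
    and gf: "\<And>m. m \<in> carrier (mspace M) \<Longrightarrow> g (f m) = m"
    and fg: "\<And>n. n \<in> carrier (mspace N) \<Longrightarrow> f (g n) = n"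
  shows "mor N M g"
proof -
  note [simp] = mor_rules[OF f] mor_eqs(3)[OF f] linD(3)[OF g(1)] gf fg lin_comp[OF g(1)] g(2)
  show ?thesis
  proof (rule morI[where V = "mspace N" and W = "mspace M"])
    show "lin K (mspace N) (mspace M) g" by fact
    fix n assume [simp]: "n \<in> carrier (mspace N)"
    show "g (malpha N n) = malpha M (g n)"
      using gf[of "malpha M (g n)"] mor_eqs(1)[OF f, of "g n"] by (simp del: gf)
    show "g (act K H N h n) = act K H M h (g n)" if [simp]: "h \<in> carrier A" for h
      using gf[of "act K H M h (g n)"] mor_eqs(2)[OF f, of "g n" h] by (simp del: gf)
    have "SW A (mspace N) (A \<boxtimes> mspace M) (\<lambda>p q. pure K A (mspace M) p (g q)) (mcoaction N (f (g n))) =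
      mcoaction M (g n)"
      by (simp del: fg add: sweedler_expand)
    then show "SW A (mspace N) (A \<boxtimes> mspace M) (\<lambda>p q. pure K A (mspace M) p (g q)) (mcoaction N n) =
      mcoaction M (g n)" by simp
  qed simp_all
qed

text \<open>
  Compatibility with the actions is the hom-coassociativity of \<open>H\<close>, and compatibility with the
  coactions is its hom-associativity. The twist of the outer factor is exactly what makes
  both apply.
\<close>

lemma mor_tassoc:
  assumes [simp]: "yd X" "yd Y" "yd Z"
  shows "mor ((X \<otimes>\<^sub>y\<^sub>d Y) \<otimes>\<^sub>y\<^sub>d twist Z) (twist X \<otimes>\<^sub>y\<^sub>d (Y \<otimes>\<^sub>y\<^sub>d Z)) (tassoc K (mspace X) (mspace Y) (mspace Z))"
proof -
  let ?X = "mspace X" and ?Y = "mspace Y" and ?Z = "mspace Z"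
  let ?V = "(?X \<boxtimes> ?Y) \<boxtimes> ?Z" and ?W = "?X \<boxtimes> ?Y \<boxtimes> ?Z"
  let ?S = "(X \<otimes>\<^sub>y\<^sub>d Y) \<otimes>\<^sub>y\<^sub>d twist Z" and ?T = "twist X \<otimes>\<^sub>y\<^sub>d (Y \<otimes>\<^sub>y\<^sub>d Z)"
  let ?f = "tassoc K ?X ?Y ?Z"
  show ?thesis
  proof (rule morI[where V = ?V and W = ?W])
    show "?f \<in> extensional (carrier ?V)" by (simp add: tassoc_def)
    show "lin K ?V ?W ?f" by (simp add: lin_tassoc)
    fix t assume t: "t \<in> carrier ?V"
    show "?f (malpha ?S t) = malpha ?T (?f t)"
      by (rule tensor_eqI3_left[OF t, where X = ?W]) simp_all
    show "?f (act K H ?S h t) = act K H ?T h (?f t)" if [simp]: "h \<in> carrier A" for h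
    proof (rule tensor_eqI3_left[OF t, where X = ?W])
      fix x y z assume [simp]: "x \<in> carrier ?X" "y \<in> carrier ?Y" "z \<in> carrier ?Z"
      show "?f (act K H ?S h (pure K (?X \<boxtimes> ?Y) ?Z (pure K ?X ?Y x y) z)) =
        act K H ?T h (?f (pure K (?X \<boxtimes> ?Y) ?Z (pure K ?X ?Y x y) z))"
        using coassoc[of h ?W "\<lambda>a b c. pure K ?X (?Y \<boxtimes> ?Z) (act K H X a x)
          (pure K ?Y ?Z (act K H Y b y) (act K H Z c z))"] by simp
    qed simp_all
    show "SW A ?V (A \<boxtimes> ?W) (\<lambda>p q. pure K A ?W p (?f q)) (mcoaction ?S t) = mcoaction ?T (?f t)"
    proof (rule tensor_eqI3_left[OF t, where X = "A \<boxtimes> ?W"])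
      fix x y z assume [simp]: "x \<in> carrier ?X" "y \<in> carrier ?Y" "z \<in> carrier ?Z"
      have e: "(ai (ai (ai (ai a))) \<star> ai (ai (ai (ai b)))) \<star> ai (ai (ai c)) =
        ai (ai (ai a)) \<star> (ai (ai (ai (ai b))) \<star> ai (ai (ai (ai c))))"
        if "a \<in> carrier A" "b \<in> carrier A" "c \<in> carrier A" for a b c
        using hom_assoc[of "ai (ai (ai (ai a)))" "ai (ai (ai (ai b)))" "ai (ai (ai (ai c)))"] that by simp
      show "SW A ?V (A \<boxtimes> ?W) (\<lambda>p q. pure K A ?W p (?f q)) (mcoaction ?S (pure K (?X \<boxtimes> ?Y) ?Z (pure K ?X ?Y x y) z))
        = mcoaction ?T (?f (pure K (?X \<boxtimes> ?Y) ?Z (pure K ?X ?Y x y) z))"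
        by (simp add: e)
    qed simp_all
  qed simp_all
qed

lemma tassoc_inv_tassoc:
  assumes [simp]: "module K U" "module K V" "module K W" and t: "t \<in> carrier (tensor K (tensor K U V) W)"
  shows "tassoc_inv K U V W (tassoc K U V W t) = t"
  by (rule tensor_eqI3_left[OF t, where X = "tensor K (tensor K U V) W"]) simp_all

lemma tassoc_tassoc_inv:
  assumes [simp]: "module K U" "module K V" "module K W" and t: "t \<in> carrier (tensor K U (tensor K V W))"
  shows "tassoc K U V W (tassoc_inv K U V W t) = t"
  by (rule tensor_eqI3_right[OF t, where X = "tensor K U (tensor K V W)"]) simp_all

lemma mor_tassoc_inv:
  assumes [simp]: "yd X" "yd Y" "yd Z"
  shows "mor (twist X \<otimes>\<^sub>y\<^sub>d (Y \<otimes>\<^sub>y\<^sub>d Z)) ((X \<otimes>\<^sub>y\<^sub>d Y) \<otimes>\<^sub>y\<^sub>d twist Z) (tassoc_inv K (mspace X) (mspace Y) (mspace Z))"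
  by (rule mor_inverse[OF mor_tassoc])
    (simp_all add: lin_tassoc_inv tassoc_inv_tassoc tassoc_tassoc_inv, simp add: tassoc_inv_def)

abbreviation br where "br M N \<equiv> yd_braiding K H M N"

lemma braiding_sweedler:
  assumes [simp]: "yd M" "yd N"
  shows "t \<in> carrier (mten M N) \<Longrightarrow> br M N t = SW (mspace M) (mspace N) (mten N M) (\<lambda>m n.
    SW A (mspace M) (mten N M) (\<lambda>p q. pure K (mspace N) (mspace M) (act K H N (ai p) n) q) (mcoaction M m)) t"
  by (simp add: yd_braiding_def tsum_sweedler[of _ K "mspace M" "mspace N"] tsum_sweedler[of _ K A "mspace M"])

lemma lin_braiding: "yd M \<Longrightarrow> yd N \<Longrightarrow> lin K (mten M N) (mten N M) (br M N)"
  by (rule lin_ext[OF _ braiding_sweedler[symmetric]]) simp_all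

lemma braiding_simps [simp]:
  assumes [simp]: "yd M" "yd N" and V: "V = mten M N" and W: "W = mten N M"
  shows "t \<in> carrier V \<Longrightarrow> br M N t \<in> carrier W"
    "lin K Y V e \<Longrightarrow> lin K Y W (\<lambda>x. br M N (e x))"
    "(\<And>p q. p \<in> carrier P \<Longrightarrow> q \<in> carrier Q \<Longrightarrow> \<gamma> p q \<in> carrier V) \<Longrightarrow>
      br M N (SW P Q V \<gamma> t) = SW P Q W (\<lambda>p q. br M N (\<gamma> p q)) t"
  unfolding V W
  by (auto intro: lin_comp[OF lin_braiding] lin_sweedler[OF lin_braiding] linD(3)[OF lin_braiding])

lemma braiding_pure [simp]:
  assumes "yd M" "yd N" "V = mspace M" "W = mspace N" "m \<in> carrier V" "n \<in> carrier W"
  shows "br M N (pure K V W m n) =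
    SW A (mspace M) (mten N M) (\<lambda>p q. pure K (mspace N) (mspace M) (act K H N (ai p) n) q) (mcoaction M m)"
  using assms by (simp add: braiding_sweedler)

text \<open>
  Both conditions are instances of the compatibility condition. For the action, the condition for \<open>M\<close>
  moves \<open>h\<close> past \<open>m\<^sub>-\<^sub>1\<close>, after the module axiom of \<open>N\<close> has turned the iterated action on \<open>n\<close> into a
  product. For the coaction, coassociativity of \<open>M\<close> produces the two legs of \<open>\<Delta>(m\<^sub>-\<^sub>1)\<close>, to which the
  condition for \<open>N\<close> is applied at \<open>h = \<alpha>\<^sup>-\<^sup>2(m\<^sub>-\<^sub>1)\<close>, and coassociativity is then applied backwards.
\<close>

lemma mor_braiding:
  assumes [simp]: "yd M" "yd N"
  shows "mor (M \<otimes>\<^sub>y\<^sub>d N) (twist N \<otimes>\<^sub>y\<^sub>d twist M) (br M N)"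
proof -
  let ?M = "mspace M" and ?N = "mspace N"
  let ?V = "?M \<boxtimes> ?N" and ?W = "?N \<boxtimes> ?M" and ?S = "M \<otimes>\<^sub>y\<^sub>d N" and ?T = "twist N \<otimes>\<^sub>y\<^sub>d twist M"
  note skip = sweedler_cong[OF HOL.refl HOL.refl HOL.refl HOL.refl]
  show ?thesis
  proof (rule morI[where V = ?V and W = ?W])
    show "br M N \<in> extensional (carrier ?V)" by (simp add: yd_braiding_def)
    show "lin K ?V ?W (br M N)" by (rule lin_braiding) simp_all
    fix t assume t: "t \<in> carrier ?V"
    show "br M N (malpha ?S t) = malpha ?T (br M N t)"
      by (rule tensor_eqI[OF t, where X = ?W]) simp_all
    show "br M N (act K H ?S h t) = act K H ?T h (br M N t)" if [simp]: "h \<in> carrier A" for h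
    proof (rule tensor_eqI[OF t, where X = ?W])
      fix m n assume [simp]: "m \<in> carrier ?M" "n \<in> carrier ?N"
      have eq1: "act K H N (ai p) (act K H N b n) = act K H N (ai (ai (p \<star> al (al b)))) (malpha N n)"
        if "p \<in> carrier A" "b \<in> carrier A" for p b
        using act_act[of N "ai (ai p)" b n] that by simp
      have eq2: "act K H N (ai (ai (al (al a) \<star> al p))) (malpha N n) = act K H N (al a) (act K H N (ai p) n)"
        if "p \<in> carrier A" "a \<in> carrier A" for p a
        using act_act[of N a "ai p" n] that by simp
      have "SW A A ?W (\<lambda>a b. SW A ?M ?W (\<lambda>p q. pure K ?N ?M (act K H N (ai p) (act K H N b n)) q)
          (mcoaction M (act K H M a m))) (D h) =
        SW A A ?W (\<lambda>a b. SW A ?M ?W (\<lambda>p q. pure K ?N ?M (act K H N (ai (ai (p \<star> al (al b)))) (malpha N n)) q)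
          (mcoaction M (act K H M a m))) (D h)"
        by (simp only: eq1 cong: sweedler_cong)
      also have "\<dots> = SW A A ?W (\<lambda>a b. SW A ?M ?W (\<lambda>p q. pure K ?N ?M
          (act K H N (ai (ai (al (al a) \<star> al p))) (malpha N n)) (act K H M (al b) q))
          (mcoaction M m)) (D h)"
        by (rule yd_compat[where \<gamma> = "\<lambda>x q. pure K ?N ?M (act K H N (ai (ai x)) (malpha N n)) q"]) simp_all
      also have "\<dots> = SW A A ?W (\<lambda>a b. SW A ?M ?W (\<lambda>p q. pure K ?N ?M
          (act K H N (al a) (act K H N (ai p) n)) (act K H M (al b) q))
          (mcoaction M m)) (D h)"
        by (simp only: eq2 cong: sweedler_cong)
      also have "\<dots> = SW A ?M ?W (\<lambda>p q. SW A A ?W (\<lambda>a b. pure K ?N ?M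
          (act K H N (al a) (act K H N (ai p) n)) (act K H M (al b) q)) (D h)) (mcoaction M m)"
        by (rule sweedler_swap) simp_all
      finally show "br M N (act K H ?S h (pure K ?M ?N m n)) = act K H ?T h (br M N (pure K ?M ?N m n))"
        by simp
    qed simp_all
    show "SW A ?V (A \<boxtimes> ?W) (\<lambda>p q. pure K A ?W p (br M N q)) (mcoaction ?S t) = mcoaction ?T (br M N t)"
    proof (rule tensor_eqI[OF t, where X = "A \<boxtimes> ?W"])
      fix m n assume [simp]: "m \<in> carrier ?M" "n \<in> carrier ?N"
      let ?X = "A \<boxtimes> ?W"
      have "SW A ?M ?X (\<lambda>p q. SW A ?N ?X (\<lambda>r s. SW A ?M ?X (\<lambda>b c.
          pure K A ?W (ai (ai (p \<star> r))) (pure K ?N ?M (act K H N (ai b) s) c)) (mcoaction M q)) (mcoaction N n)) (mcoaction M m) =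
        SW A ?M ?X (\<lambda>p q. SW A ?M ?X (\<lambda>b c. SW A ?N ?X (\<lambda>r s.
          pure K A ?W (ai (ai (p \<star> r))) (pure K ?N ?M (act K H N (ai b) s) c)) (mcoaction N n)) (mcoaction M q)) (mcoaction M m)"
        by (rule skip, rule sweedler_swap) simp_all
      also have "\<dots> = SW A ?M ?X (\<lambda>p q. SW A A ?X (\<lambda>a b. SW A ?N ?X (\<lambda>r s.
          pure K A ?W (ai (ai (ai a \<star> r))) (pure K ?N ?M (act K H N (ai b) s) (malpha M q)))
            (mcoaction N n)) (D p)) (mcoaction M m)"
        using co_coassoc[of M m ?X "\<lambda>a b c. SW A ?N ?X (\<lambda>r s.
          pure K A ?W (ai (ai (ai a \<star> r))) (pure K ?N ?M (act K H N (ai b) s) c)) (mcoaction N n)"]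
        by simp
      also have "\<dots> = SW A ?M ?X (\<lambda>p q. SW A A ?X (\<lambda>a b. SW A ?N ?X (\<lambda>r s.
          pure K A ?W (ai (ai (ai (al (al a) \<star> al r)))) (pure K ?N ?M (act K H N (al b) s) (malpha M q)))
            (mcoaction N n)) (D (ai (ai p)))) (mcoaction M m)"
        by simp
      also have "\<dots> = SW A ?M ?X (\<lambda>p q. SW A A ?X (\<lambda>a b. SW A ?N ?X (\<lambda>r s.
          pure K A ?W (ai (ai (ai (r \<star> al (al b))))) (pure K ?N ?M s (malpha M q)))
            (mcoaction N (act K H N a n))) (D (ai (ai p)))) (mcoaction M m)"
        by (rule skip, rule yd_compat[symmetric, where \<gamma> =
          "\<lambda>x s. pure K A ?W (ai (ai (ai x))) (pure K ?N ?M s (malpha M _))"]) simp_all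
      also have "\<dots> = SW A ?M ?X (\<lambda>p q. SW A A ?X (\<lambda>a b. SW A ?N ?X (\<lambda>r s.
          pure K A ?W (ai (ai (ai (r \<star> b)))) (pure K ?N ?M s (malpha M q)))
            (mcoaction N (act K H N (ai (ai a)) n))) (D p)) (mcoaction M m)"
        by simp
      also have "\<dots> = SW A ?M ?X (\<lambda>p q. SW A ?M ?X (\<lambda>b c. SW A ?N ?X (\<lambda>r s.
          pure K A ?W (ai (ai (ai (r \<star> b)))) (pure K ?N ?M s c))
            (mcoaction N (act K H N (ai (ai (al p))) n))) (mcoaction M q)) (mcoaction M m)"
        by (rule co_coassoc[where \<gamma> = "\<lambda>a b c. SW A ?N ?X (\<lambda>r s.
          pure K A ?W (ai (ai (ai (r \<star> b)))) (pure K ?N ?M s c))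
            (mcoaction N (act K H N (ai (ai a)) n))"]) simp_all
      also have "\<dots> = SW A ?M ?X (\<lambda>p q. SW A ?N ?X (\<lambda>r s. SW A ?M ?X (\<lambda>b c.
          pure K A ?W (ai (ai (ai (r \<star> b)))) (pure K ?N ?M s c)) (mcoaction M q))
            (mcoaction N (act K H N (ai p) n))) (mcoaction M m)"
        by (simp, rule skip, rule sweedler_swap) simp_all
      finally show "SW A ?V (A \<boxtimes> ?W) (\<lambda>p q. pure K A ?W p (br M N q)) (mcoaction ?S (pure K ?M ?N m n)) =
        mcoaction ?T (br M N (pure K ?M ?N m n))"
        by simp
    qed simp_all
  qed simp_all
qed

end

section \<open>The category of Yetter-Drinfeld modules\<close>

lemma (in category) inverse_arrow_eq:
  assumes "inverse_arrows C f g"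
  shows "inverse_arrow C f = g"
  unfolding inverse_arrow_def
proof (rule the_equality)
  show "inverse_arrows C f g" by fact
  fix g' assume g': "inverse_arrows C f g'"
  let ?X = "Dom C f" and ?Y = "Cod C f"
  have H: "f \<in> Hom C ?X ?Y" "g \<in> Hom C ?Y ?X" "g' \<in> Hom C ?Y ?X"
    using assms g' by (auto simp: inverse_arrows_def Hom_def)
  have "g' = Comp C g' (Comp C f g)"
    using assms H Comp_Id[OF H(3)] by (simp add: inverse_arrows_def)
  also have "\<dots> = Comp C (Comp C g' f) g" using H(2,1,3) by (rule Comp_assoc)
  also have "\<dots> = g" using g' Id_Comp[OF H(2)] by (simp add: inverse_arrows_def)
  finally show "g' = g" .
qed

lemma Hom_product:
  "\<phi> \<in> Hom (product_category C D) X Y \<longleftrightarrow>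
    fst \<phi> \<in> Hom C (fst X) (fst Y) \<and> snd \<phi> \<in> Hom D (snd X) (snd Y)"
  by (cases \<phi>; cases X; cases Y) (auto simp: Hom_def product_category_def)

lemma product_simps [simp]:
  "Obj (product_category C D) = Obj C \<times> Obj D"
  "Id (product_category C D) (X, Y) = (Id C X, Id D Y)"
  "Comp (product_category C D) (f, f') (g, g') = (Comp C f g, Comp D f' g')"
  by (simp_all add: product_category_def)

lemma category_product:
  assumes "category C" "category D"
  shows "category (product_category C D)"
proof -
  interpret C: category C by fact
  interpret D: category D by fact
  show ?thesis
  proof
    fix f assume "f \<in> Arr (product_category C D)"
    then show "Dom (product_category C D) f \<in> Obj (product_category C D)"
      "Cod (product_category C D) f \<in> Obj (product_category C D)"
      by (auto simp: product_category_def C.Dom_Obj C.Cod_Obj D.Dom_Obj D.Cod_Obj)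
  qed (auto simp: Hom_product C.Id_Hom D.Id_Hom C.Comp_Id D.Comp_Id C.Id_Comp D.Id_Comp
      intro: C.Comp_Hom D.Comp_Hom C.Comp_assoc D.Comp_assoc)
qed

lemma compose_eqI: "(\<And>x. x \<in> S \<Longrightarrow> g (f x) = g' (f' x)) \<Longrightarrow> compose S g f = compose S g' f'"
  by (auto simp: compose_def)

context yd_setting begin

abbreviation yd_cat where "yd_cat \<equiv> yd_category K H"
abbreviation tensor_fun where "tensor_fun \<equiv> yd_tensor_functor K H"

lemma yd_cat_simps [simp]:
  "Obj yd_cat = {M. yd M}" "(M, f, N) \<in> Arr yd_cat \<longleftrightarrow> mor M N f"
  "Dom yd_cat (M, f, N) = M" "Cod yd_cat (M, f, N) = N"
  "Id yd_cat M = (M, \<lambda>m\<in>carrier (mspace M). m, M)"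
  "Comp yd_cat (N', g, P) (M, f, N) = (M, compose (carrier (mspace M)) g f, P)"
  by (simp_all add: yd_category_def mor_def)

lemma Hom_yd_cat: "\<phi> \<in> Hom yd_cat X Y \<longleftrightarrow> (\<exists>f. \<phi> = (X, f, Y) \<and> mor X Y f)"
  by (cases \<phi>) (auto simp: Hom_def)

lemma Hom_yd_cat_triple [simp]: "(M, f, N) \<in> Hom yd_cat X Y \<longleftrightarrow> M = X \<and> N = Y \<and> mor M N f"
  by (auto simp: Hom_yd_cat)

lemma category_yd_cat: "category yd_cat"
proof
  fix \<phi> assume "\<phi> \<in> Arr yd_cat"
  then show "Dom yd_cat \<phi> \<in> Obj yd_cat" "Cod yd_cat \<phi> \<in> Obj yd_cat"
    by (cases \<phi>; auto simp: mor_def)+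
next
  fix X assume "X \<in> Obj yd_cat"
  then show "Id yd_cat X \<in> Hom yd_cat X X" by (simp add: mor_id)
next
  fix f X Y g Z assume "f \<in> Hom yd_cat X Y" "g \<in> Hom yd_cat Y Z"
  then show "Comp yd_cat g f \<in> Hom yd_cat X Z" by (auto simp: Hom_yd_cat mor_compose)
next
  fix f X Y assume "f \<in> Hom yd_cat X Y"
  then obtain g where f: "f = (X, g, Y)" and g: "mor X Y g" by (auto simp: Hom_yd_cat)
  have "compose (carrier (mspace X)) g (\<lambda>m\<in>carrier (mspace X). m) = g"
    "compose (carrier (mspace X)) (\<lambda>m\<in>carrier (mspace Y). m) g = g"
    using mor_ext[OF g] mor_rules(5)[OF g] by (auto simp: compose_def extensional_def fun_eq_iff)
  then show "Comp yd_cat f (Id yd_cat X) = f" "Comp yd_cat (Id yd_cat Y) f = f" by (simp_all add: f)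
next
  fix f g h W X Y Z assume "f \<in> Hom yd_cat W X" "g \<in> Hom yd_cat X Y" "h \<in> Hom yd_cat Y Z"
  then show "Comp yd_cat h (Comp yd_cat g f) = Comp yd_cat (Comp yd_cat h g) f"
    by (auto simp: Hom_yd_cat compose_def fun_eq_iff mor_rules(5))
qed

lemma tensor_fun_simps [simp]:
  "fobj tensor_fun (M, N) = M \<otimes>\<^sub>y\<^sub>d N"
  "farr tensor_fun ((M, f, M'), (N, g, N')) =
     (M \<otimes>\<^sub>y\<^sub>d N, tensor_map K (mspace M) (mspace N) (mspace M') (mspace N') f g, M' \<otimes>\<^sub>y\<^sub>d N')"
  by (simp_all add: yd_tensor_functor_def)

lemma tensor_Hom:
  "f \<in> Hom yd_cat X Y \<Longrightarrow> g \<in> Hom yd_cat X' Y' \<Longrightarrow> farr tensor_fun (f, g) \<in> Hom yd_cat (X \<otimes>\<^sub>y\<^sub>d X') (Y \<otimes>\<^sub>y\<^sub>d Y')"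
  by (auto simp: Hom_yd_cat mor_tensor)

lemma tensor_Id:
  assumes [simp]: "yd X" "yd Y"
  shows "farr tensor_fun (Id yd_cat X, Id yd_cat Y) = Id yd_cat (X \<otimes>\<^sub>y\<^sub>d Y)"
proof -
  have "tensor_map K (mspace X) (mspace Y) (mspace X) (mspace Y)
     (\<lambda>m\<in>carrier (mspace X). m) (\<lambda>m\<in>carrier (mspace Y). m) t = t" if t: "t \<in> carrier (mten X Y)" for t
    by (rule tensor_eqI[OF t, where X = "mten X Y"]) (simp_all del: restrict_apply add: restrict_apply')
  then have "tensor_map K (mspace X) (mspace Y) (mspace X) (mspace Y)
     (\<lambda>m\<in>carrier (mspace X). m) (\<lambda>m\<in>carrier (mspace Y). m) = (\<lambda>t\<in>carrier (mten X Y). t)"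
    by (auto simp: fun_eq_iff) (simp add: tensor_map_def)
  then show ?thesis by simp
qed

lemma tensor_Comp:
  assumes "f \<in> Hom yd_cat X Y" "g \<in> Hom yd_cat Y Z" "f' \<in> Hom yd_cat X' Y'" "g' \<in> Hom yd_cat Y' Z'"
  shows "farr tensor_fun (Comp yd_cat g f, Comp yd_cat g' f') = Comp yd_cat (farr tensor_fun (g, g')) (farr tensor_fun (f, f'))"
proof -
  obtain p q p' q' where e: "f = (X, p, Y)" "g = (Y, q, Z)" "f' = (X', p', Y')" "g' = (Y', q', Z')"
    and m: "mor X Y p" "mor Y Z q" "mor X' Y' p'" "mor Y' Z' q'"
    using assms by (auto simp: Hom_yd_cat)
  let ?c = "compose (carrier (mspace X)) q p" and ?c' = "compose (carrier (mspace X')) q' p'"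
  note [simp] = mor_rules[OF m(1)] mor_rules[OF m(2)] mor_rules[OF m(3)] mor_rules[OF m(4)]
    mor_rules(3)[OF mor_compose[OF m(1,2)]] mor_rules(3)[OF mor_compose[OF m(3,4)]]
  have "tensor_map K (mspace X) (mspace X') (mspace Z) (mspace Z') ?c ?c' t =
    tensor_map K (mspace Y) (mspace Y') (mspace Z) (mspace Z') q q'
      (tensor_map K (mspace X) (mspace X') (mspace Y) (mspace Y') p p' t)"
    if t: "t \<in> carrier (mten X X')" for t
    by (rule tensor_eqI[OF t, where X = "mten Z Z'"]) (simp_all add: compose_eq)
  then have "tensor_map K (mspace X) (mspace X') (mspace Z) (mspace Z') ?c ?c' =
    compose (carrier (mten X X')) (tensor_map K (mspace Y) (mspace Y') (mspace Z) (mspace Z') q q')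
      (tensor_map K (mspace X) (mspace X') (mspace Y) (mspace Y') p p')"
    by (auto simp: fun_eq_iff compose_def) (simp add: tensor_map_def)
  then show ?thesis by (simp add: e)
qed

lemma is_functor_tensor: "is_functor (product_category yd_cat yd_cat) yd_cat tensor_fun"
proof (intro is_functor.intro category_product category_yd_cat is_functor_axioms.intro)
  fix X assume "X \<in> Obj (product_category yd_cat yd_cat)"
  then show "fobj tensor_fun X \<in> Obj yd_cat" "farr tensor_fun (Id (product_category yd_cat yd_cat) X) = Id yd_cat (fobj tensor_fun X)"
    using tensor_Id by (cases X; simp del: yd_cat_simps(5))+
next
  fix f X Y assume "f \<in> Hom (product_category yd_cat yd_cat) X Y"
  then show "farr tensor_fun f \<in> Hom yd_cat (fobj tensor_fun X) (fobj tensor_fun Y)"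
    by (cases f; cases X; cases Y) (auto simp: Hom_product intro: tensor_Hom)
next
  fix f g X Y Z assume "f \<in> Hom (product_category yd_cat yd_cat) X Y" "g \<in> Hom (product_category yd_cat yd_cat) Y Z"
  then show "farr tensor_fun (Comp (product_category yd_cat yd_cat) g f) = Comp yd_cat (farr tensor_fun g) (farr tensor_fun f)"
    using tensor_Comp[of "fst f" "fst X" "fst Y" "fst g" "fst Z" "snd f" "snd X" "snd Y" "snd g" "snd Z"]
    by (cases f; cases g) (simp add: Hom_product)
qed

definition twist_functor where "twist_functor = \<lparr>fobj = twist, farr = (\<lambda>(M, f, N). (twist M, f, twist N))\<rparr>"

lemma twist_functor_simps [simp]: "fobj twist_functor M = twist M" "farr twist_functor (M, f, N) = (twist M, f, twist N)"
  by (simp_all add: twist_functor_def)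

lemma twist_Hom: "f \<in> Hom yd_cat X Y \<Longrightarrow> farr twist_functor f \<in> Hom yd_cat (twist X) (twist Y)"
  by (auto simp: Hom_yd_cat mor_twist)

lemma twist_Id: "farr twist_functor (Id yd_cat X) = Id yd_cat (twist X)"
  by simp

lemma twist_Comp: "f \<in> Hom yd_cat X Y \<Longrightarrow> g \<in> Hom yd_cat Y Z \<Longrightarrow>
    farr twist_functor (Comp yd_cat g f) = Comp yd_cat (farr twist_functor g) (farr twist_functor f)"
  by (auto simp: Hom_yd_cat)

lemma is_functor_twist: "is_functor yd_cat yd_cat twist_functor"
  by (intro is_functor.intro category_yd_cat is_functor_axioms.intro)
    (auto simp: twist_Comp simp del: yd_cat_simps(5) simp: twist_Id, auto simp: Hom_yd_cat mor_twist)

lemma maction_linear_map: "yd M \<Longrightarrow> maction M \<in> linear_maps K (A \<boxtimes> mspace M) (mspace M)"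
  unfolding yetter_drinfeld_def left_module_def by blast

text \<open>
  The action is a map on \<open>H \<otimes> M\<close>, so knowing it on pure tensors suffices; all structure maps are
  extensional, which turns agreement on carriers into equality of the records.
\<close>

lemma yd_eqI:
  assumes M: "yd M" and N: "yd N" and V: "mspace M = V" "mspace N = V" and a: "malpha M = malpha N"
    and b: "\<And>h m. h \<in> carrier A \<Longrightarrow> m \<in> carrier V \<Longrightarrow> act K H M h m = act K H N h m"
    and c: "\<And>m. m \<in> carrier V \<Longrightarrow> mcoaction M m = mcoaction N m"
  shows "M = N"
proof -
  have l: "lin K (A \<boxtimes> mspace M) (mspace M) (maction M)" if "yd M" for M
    using that by (intro lin_linear_maps maction_linear_map) simp_all
  have [simp]: "module K V" using yd_module[OF M] V by simp
  have "maction M x = maction N x" if x: "x \<in> carrier (A \<boxtimes> V)" for x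
    by (rule tensor_eqI[OF x, where X = V])
      (use l[OF M] l[OF N] V b in \<open>simp_all add: act_def\<close>)
  then have "maction M = maction N"
    using maction_ext[OF M] maction_ext[OF N] V by (intro extensionalityI) auto
  moreover have "mcoaction M = mcoaction N"
    using mcoaction_ext[OF M] mcoaction_ext[OF N] V c by (intro extensionalityI) auto
  ultimately show ?thesis using V a by (intro yd_module.equality) auto
qed

text \<open>
  A hom-tensor category requires \<open>F(U \<otimes> V) = F(U) \<otimes> F(V)\<close> on the nose. It holds because \<open>\<alpha>\<close> and
  \<open>\<alpha>\<inverse>\<close> are compatible with the coproduct and the product of \<open>H\<close>.
\<close>

lemma twist_tensor [simp]:
  assumes [simp]: "yd M" "yd N"
  shows "twist (M \<otimes>\<^sub>y\<^sub>d N) = twist M \<otimes>\<^sub>y\<^sub>d twist N"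
proof (rule yd_eqI[where V = "mten M N"])
  show "malpha (twist (M \<otimes>\<^sub>y\<^sub>d N)) = malpha (twist M \<otimes>\<^sub>y\<^sub>d twist N)"
    by (simp add: yd_tensor_def Let_def)
  fix t assume t: "t \<in> carrier (mten M N)"
  show "mcoaction (twist (M \<otimes>\<^sub>y\<^sub>d N)) t = mcoaction (twist M \<otimes>\<^sub>y\<^sub>d twist N) t"
    by (rule tensor_eqI[OF t, where X = "A \<boxtimes> mten M N"]) simp_all
  fix h assume [simp]: "h \<in> carrier A"
  show "act K H (twist (M \<otimes>\<^sub>y\<^sub>d N)) h t = act K H (twist M \<otimes>\<^sub>y\<^sub>d twist N) h t"
    by (rule tensor_eqI[OF t, where X = "mten M N"]) simp_all
qed simp_all

section \<open>Coherence\<close>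

definition assoc_arrow where
  "assoc_arrow X Y Z = ((X \<otimes>\<^sub>y\<^sub>d Y) \<otimes>\<^sub>y\<^sub>d twist Z, tassoc K (mspace X) (mspace Y) (mspace Z), twist X \<otimes>\<^sub>y\<^sub>d (Y \<otimes>\<^sub>y\<^sub>d Z))"

definition assoc_inv_arrow where
  "assoc_inv_arrow X Y Z = (twist X \<otimes>\<^sub>y\<^sub>d (Y \<otimes>\<^sub>y\<^sub>d Z), tassoc_inv K (mspace X) (mspace Y) (mspace Z), (X \<otimes>\<^sub>y\<^sub>d Y) \<otimes>\<^sub>y\<^sub>d twist Z)"

definition alpha_arrow where "alpha_arrow M = (M, malpha M, twist M)"

definition braiding_arrow where "braiding_arrow M N = (M \<otimes>\<^sub>y\<^sub>d N, br M N, twist N \<otimes>\<^sub>y\<^sub>d twist M)"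

lemma inverse_assoc:
  assumes [simp]: "yd X" "yd Y" "yd Z"
  shows "inverse_arrows yd_cat (assoc_arrow X Y Z) (assoc_inv_arrow X Y Z)"
proof -
  have "compose (carrier (mspace X \<boxtimes> mspace Y \<boxtimes> mspace Z)) (tassoc K (mspace X) (mspace Y) (mspace Z))
      (tassoc_inv K (mspace X) (mspace Y) (mspace Z)) = (\<lambda>t\<in>carrier (mspace X \<boxtimes> mspace Y \<boxtimes> mspace Z). t)"
    by (auto simp: compose_def tassoc_tassoc_inv)
  moreover have "compose (carrier ((mspace X \<boxtimes> mspace Y) \<boxtimes> mspace Z)) (tassoc_inv K (mspace X) (mspace Y) (mspace Z))
      (tassoc K (mspace X) (mspace Y) (mspace Z)) = (\<lambda>t\<in>carrier ((mspace X \<boxtimes> mspace Y) \<boxtimes> mspace Z). t)"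
    by (auto simp: compose_def tassoc_inv_tassoc)
  ultimately show ?thesis
    by (simp add: inverse_arrows_def assoc_arrow_def assoc_inv_arrow_def mor_tassoc mor_tassoc_inv)
qed

lemma inverse_arrow_assoc: "yd X \<Longrightarrow> yd Y \<Longrightarrow> yd Z \<Longrightarrow> inverse_arrow yd_cat (assoc_arrow X Y Z) = assoc_inv_arrow X Y Z"
  by (rule category.inverse_arrow_eq[OF category_yd_cat inverse_assoc])

lemma assoc_natural_iso:
  "natural_isomorphism (product_category yd_cat (product_category yd_cat yd_cat)) yd_cat
         \<lparr>fobj = (\<lambda>(X, Y, Z). fobj tensor_fun (fobj tensor_fun (X, Y), fobj twist_functor Z)),
          farr = (\<lambda>(f, g, h). farr tensor_fun (farr tensor_fun (f, g), farr twist_functor h))\<rparr>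
         \<lparr>fobj = (\<lambda>(X, Y, Z). fobj tensor_fun (fobj twist_functor X, fobj tensor_fun (Y, Z))),
          farr = (\<lambda>(f, g, h). farr tensor_fun (farr twist_functor f, farr tensor_fun (g, h)))\<rparr>
         (\<lambda>(X, Y, Z). assoc_arrow X Y Z)"
  (is "natural_isomorphism ?P yd_cat ?S ?T ?\<tau>")
proof (intro natural_isomorphism.intro natural_transformation.intro natural_isomorphism_axioms.intro
    natural_transformation_axioms.intro is_functor.intro is_functor_axioms.intro category_yd_cat category_product)
  fix X assume "X \<in> Obj ?P"
  then obtain x y z where X: "X = (x, y, z)" and [simp]: "yd x" "yd y" "yd z" by auto
  show "fobj ?S X \<in> Obj yd_cat" "fobj ?T X \<in> Obj yd_cat" by (simp_all add: X)
  show "farr ?S (Id ?P X) = Id yd_cat (fobj ?S X)" "farr ?T (Id ?P X) = Id yd_cat (fobj ?T X)"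
    by (simp_all add: X tensor_Id twist_Id del: yd_cat_simps(5) tensor_fun_simps(2))
  show "?\<tau> X \<in> Hom yd_cat (fobj ?S X) (fobj ?T X)"
    by (simp add: X assoc_arrow_def mor_tassoc)
  show "iso_arrow yd_cat (?\<tau> X)" unfolding iso_arrow_def X prod.case
    by (rule exI, rule inverse_assoc) simp_all
next
  fix f X Y assume f: "f \<in> Hom ?P X Y"
  obtain x y z x' y' z' where X: "X = (x, y, z)" "Y = (x', y', z')" by (cases X; cases Y) auto
  obtain p q r where e: "f = (p, q, r)" by (cases f) auto
  have H: "p \<in> Hom yd_cat x x'" "q \<in> Hom yd_cat y y'" "r \<in> Hom yd_cat z z'" using f by (auto simp: X e Hom_product)
  show "farr ?S f \<in> Hom yd_cat (fobj ?S X) (fobj ?S Y)" "farr ?T f \<in> Hom yd_cat (fobj ?T X) (fobj ?T Y)"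
    using H by (simp_all add: X e tensor_Hom twist_Hom)
  obtain u v w where e': "p = (x, u, x')" "q = (y, v, y')" "r = (z, w, z')"
    and m: "mor x x' u" "mor y y' v" "mor z z' w" using H by (auto simp: Hom_yd_cat)
  note [simp] = mor_rules[OF m(1)] mor_rules[OF m(2)] mor_rules[OF m(3)]
  let ?W = "mspace x' \<boxtimes> mspace y' \<boxtimes> mspace z'"
  show "Comp yd_cat (farr ?T f) (?\<tau> X) = Comp yd_cat (?\<tau> Y) (farr ?S f)"
  proof (simp add: X e e' assoc_arrow_def, rule compose_eqI)
    fix t assume t: "t \<in> carrier ((mspace x \<boxtimes> mspace y) \<boxtimes> mspace z)"
    show "tensor_map K (mspace x) (mten y z) (mspace x') (mten y' z') u
        (tensor_map K (mspace y) (mspace z) (mspace y') (mspace z') v w) (tassoc K (mspace x) (mspace y) (mspace z) t) =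
      tassoc K (mspace x') (mspace y') (mspace z') (tensor_map K (mten x y) (mspace z) (mten x' y') (mspace z')
        (tensor_map K (mspace x) (mspace y) (mspace x') (mspace y') u v) w t)"
      by (rule tensor_eqI3_left[OF t, where X = ?W]) (simp_all add: lin_tensor_map)
  qed
next
  fix f g X Y Z assume fg: "f \<in> Hom ?P X Y" "g \<in> Hom ?P Y Z"
  obtain p q r p' q' r' where e: "f = (p, q, r)" "g = (p', q', r')" by (cases f; cases g) auto
  have H: "p \<in> Hom yd_cat (fst X) (fst Y)" "q \<in> Hom yd_cat (fst (snd X)) (fst (snd Y))" "r \<in> Hom yd_cat (snd (snd X)) (snd (snd Y))"
    "p' \<in> Hom yd_cat (fst Y) (fst Z)" "q' \<in> Hom yd_cat (fst (snd Y)) (fst (snd Z))" "r' \<in> Hom yd_cat (snd (snd Y)) (snd (snd Z))"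
    using fg by (auto simp: e Hom_product)
  show "farr ?S (Comp ?P g f) = Comp yd_cat (farr ?S g) (farr ?S f)"
    by (simp add: e tensor_Comp[OF H(1,4,2,5)] twist_Comp[OF H(3,6)]
      tensor_Comp[OF tensor_Hom[OF H(1,2)] tensor_Hom[OF H(4,5)] twist_Hom[OF H(3)] twist_Hom[OF H(6)]])
  show "farr ?T (Comp ?P g f) = Comp yd_cat (farr ?T g) (farr ?T f)"
    by (simp add: e tensor_Comp[OF H(2,5,3,6)] twist_Comp[OF H(1,4)]
      tensor_Comp[OF twist_Hom[OF H(1)] twist_Hom[OF H(4)] tensor_Hom[OF H(2,3)] tensor_Hom[OF H(5,6)]])
qed

text \<open>
  All arrows involved are ordinary associativity maps, so both sides agree on pure tensors as they
  do for vector spaces.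
\<close>

lemma pentagon:
  assumes [simp]: "yd X" "yd Y" "yd Z" "yd U"
  shows "Comp yd_cat (assoc_arrow (twist X) (twist Y) (Z \<otimes>\<^sub>y\<^sub>d U)) (assoc_arrow (X \<otimes>\<^sub>y\<^sub>d Y) (twist Z) (twist U)) =
    Comp yd_cat (farr tensor_fun (Id yd_cat (twist (twist X)), assoc_arrow Y Z U))
      (Comp yd_cat (assoc_arrow (twist X) (Y \<otimes>\<^sub>y\<^sub>d Z) (twist U)) (farr tensor_fun (assoc_arrow X Y Z, Id yd_cat (twist (twist U)))))"
proof -
  let ?X = "mspace X" and ?Y = "mspace Y" and ?Z = "mspace Z" and ?U = "mspace U"
  let ?W = "?X \<boxtimes> ?Y \<boxtimes> ?Z \<boxtimes> ?U"
  have "tassoc K ?X ?Y (?Z \<boxtimes> ?U) (tassoc K (?X \<boxtimes> ?Y) ?Z ?U t) =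
     tensor_map K ?X ((?Y \<boxtimes> ?Z) \<boxtimes> ?U) ?X (?Y \<boxtimes> ?Z \<boxtimes> ?U) (\<lambda>m\<in>carrier ?X. m) (tassoc K ?Y ?Z ?U)
       (tassoc K ?X (?Y \<boxtimes> ?Z) ?U
         (tensor_map K ((?X \<boxtimes> ?Y) \<boxtimes> ?Z) ?U (?X \<boxtimes> ?Y \<boxtimes> ?Z) ?U (tassoc K ?X ?Y ?Z) (\<lambda>m\<in>carrier ?U. m) t))"
    if t: "t \<in> carrier (((?X \<boxtimes> ?Y) \<boxtimes> ?Z) \<boxtimes> ?U)" for t
  proof (rule tensor_eqI[OF t, where X = ?W])
    fix s u assume s: "s \<in> carrier ((?X \<boxtimes> ?Y) \<boxtimes> ?Z)" and [simp]: "u \<in> carrier ?U"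
    show "tassoc K ?X ?Y (?Z \<boxtimes> ?U) (tassoc K (?X \<boxtimes> ?Y) ?Z ?U (pure K ((?X \<boxtimes> ?Y) \<boxtimes> ?Z) ?U s u)) =
     tensor_map K ?X ((?Y \<boxtimes> ?Z) \<boxtimes> ?U) ?X (?Y \<boxtimes> ?Z \<boxtimes> ?U) (\<lambda>m\<in>carrier ?X. m) (tassoc K ?Y ?Z ?U)
       (tassoc K ?X (?Y \<boxtimes> ?Z) ?U
         (tensor_map K ((?X \<boxtimes> ?Y) \<boxtimes> ?Z) ?U (?X \<boxtimes> ?Y \<boxtimes> ?Z) ?U (tassoc K ?X ?Y ?Z) (\<lambda>m\<in>carrier ?U. m)
           (pure K ((?X \<boxtimes> ?Y) \<boxtimes> ?Z) ?U s u)))"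
      by (rule tensor_eqI3_left[OF s, where X = ?W])
        (simp_all add: lin_tassoc restrict_apply' del: restrict_apply)
  qed (simp_all add: lin_tassoc)
  then show ?thesis
    by (auto simp add: assoc_arrow_def compose_eq intro!: compose_eqI)
qed

lemma alpha_natural: "natural_transformation yd_cat yd_cat \<lparr>fobj = (\<lambda>X. X), farr = (\<lambda>f. f)\<rparr> twist_functor alpha_arrow"
proof (intro natural_transformation.intro natural_transformation_axioms.intro is_functor_twist)
  show "is_functor yd_cat yd_cat \<lparr>fobj = (\<lambda>X. X), farr = (\<lambda>f. f)\<rparr>"
    by (intro is_functor.intro is_functor_axioms.intro category_yd_cat) simp_all
next
  fix X assume "X \<in> Obj yd_cat"
  then show "alpha_arrow X \<in> Hom yd_cat (fobj \<lparr>fobj = (\<lambda>X. X), farr = (\<lambda>f. f)\<rparr> X) (fobj twist_functor X)"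
    by (simp add: alpha_arrow_def mor_malpha)
next
  fix f X Y assume "f \<in> Hom yd_cat X Y"
  then show "Comp yd_cat (farr twist_functor f) (alpha_arrow X) = Comp yd_cat (alpha_arrow Y) (farr \<lparr>fobj = (\<lambda>X. X), farr = (\<lambda>f. f)\<rparr> f)"
    by (auto simp: Hom_yd_cat alpha_arrow_def mor_eqs intro!: compose_eqI)
qed

lemma braiding_natural: "natural_transformation (product_category yd_cat yd_cat) yd_cat
         \<lparr>fobj = (\<lambda>(V, W). fobj tensor_fun (V, W)), farr = (\<lambda>(f, g). farr tensor_fun (f, g))\<rparr>
         \<lparr>fobj = (\<lambda>(V, W). fobj tensor_fun (fobj twist_functor W, fobj twist_functor V)), farr = (\<lambda>(f, g). farr tensor_fun (farr twist_functor g, farr twist_functor f))\<rparr>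
         (\<lambda>(V, W). braiding_arrow V W)"
  (is "natural_transformation ?P yd_cat ?S ?T ?\<tau>")
proof (intro natural_transformation.intro natural_transformation_axioms.intro is_functor_tensor)
  have "?S = tensor_fun" by (simp add: yd_tensor_functor_def fun_eq_iff)
  then show "is_functor ?P yd_cat ?S" using is_functor_tensor by simp
  show "is_functor ?P yd_cat ?T"
  proof (intro is_functor.intro is_functor_axioms.intro category_yd_cat category_product)
    fix X assume "X \<in> Obj ?P"
    then obtain x y where X: "X = (x, y)" and [simp]: "yd x" "yd y" by auto
    show "fobj ?T X \<in> Obj yd_cat" by (simp add: X)
    show "farr ?T (Id ?P X) = Id yd_cat (fobj ?T X)"
      by (simp add: X tensor_Id twist_Id del: yd_cat_simps(5) tensor_fun_simps(2))
  next
    fix f X Y assume f: "f \<in> Hom ?P X Y"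
    then have "fst f \<in> Hom yd_cat (fst X) (fst Y)" "snd f \<in> Hom yd_cat (snd X) (snd Y)"
      by (simp_all add: Hom_product)
    from tensor_Hom[OF twist_Hom[OF this(2)] twist_Hom[OF this(1)]]
    show "farr ?T f \<in> Hom yd_cat (fobj ?T X) (fobj ?T Y)"
      by (cases f; cases X; cases Y) simp
  next
    fix f g X Y Z assume fg: "f \<in> Hom ?P X Y" "g \<in> Hom ?P Y Z"
    obtain p q p' q' where e: "f = (p, q)" "g = (p', q')" by (cases f; cases g) auto
    have H: "p \<in> Hom yd_cat (fst X) (fst Y)" "q \<in> Hom yd_cat (snd X) (snd Y)"
      "p' \<in> Hom yd_cat (fst Y) (fst Z)" "q' \<in> Hom yd_cat (snd Y) (snd Z)"
      using fg by (auto simp: e Hom_product)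
    show "farr ?T (Comp ?P g f) = Comp yd_cat (farr ?T g) (farr ?T f)"
      by (simp add: e twist_Comp[OF H(1,3)] twist_Comp[OF H(2,4)]
        tensor_Comp[OF twist_Hom[OF H(2)] twist_Hom[OF H(4)] twist_Hom[OF H(1)] twist_Hom[OF H(3)]])
  qed
next
  fix X assume "X \<in> Obj ?P"
  then show "?\<tau> X \<in> Hom yd_cat (fobj ?S X) (fobj ?T X)"
    by (auto simp: braiding_arrow_def mor_braiding)
next
  fix f X Y assume f: "f \<in> Hom ?P X Y"
  obtain x y x' y' where X: "X = (x, y)" "Y = (x', y')" by (cases X; cases Y) auto
  obtain u v where e: "f = ((x, u, x'), (y, v, y'))"
    and m: "mor x x' u" "mor y y' v" using f by (cases f) (auto simp: Hom_yd_cat Hom_product X)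
  note [simp] = mor_rules[OF m(1)] mor_rules[OF m(2)] mor_eqs[OF m(1)] mor_eqs[OF m(2)]
  let ?W = "mspace y' \<boxtimes> mspace x'"
  show "Comp yd_cat (farr ?T f) (?\<tau> X) = Comp yd_cat (?\<tau> Y) (farr ?S f)"
  proof (simp add: X e braiding_arrow_def, rule compose_eqI)
    fix t assume t: "t \<in> carrier (mten x y)"
    show "tensor_map K (mspace y) (mspace x) (mspace y') (mspace x') v u (br x y t) =
      br x' y' (tensor_map K (mspace x) (mspace y) (mspace x') (mspace y') u v t)"
      by (rule tensor_eqI[OF t, where X = ?W]) simp_all
  qed
qed

lemma braiding_twist:
  assumes [simp]: "yd U" "yd V"
  shows "farr twist_functor (braiding_arrow U V) = braiding_arrow (twist U) (twist V)"
proof -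
  have "br U V t = br (twist U) (twist V) t" if t: "t \<in> carrier (mten U V)" for t
    by (rule tensor_eqI[OF t, where X = "mten V U"]) simp_all
  moreover have "br U V t = br (twist U) (twist V) t" if "t \<notin> carrier (mten U V)" for t
    using that by (simp add: yd_braiding_def)
  ultimately have "br U V = br (twist U) (twist V)" by blast
  then show ?thesis by (simp add: braiding_arrow_def)
qed

lemma hexagon1:
  assumes [simp]: "yd U" "yd V" "yd W"
  shows "Comp yd_cat (farr tensor_fun (Id yd_cat (twist (twist V)), farr tensor_fun (Id yd_cat (twist W), alpha_arrow (twist U))))
      (Comp yd_cat (assoc_arrow (twist V) (twist W) (twist U)) (Comp yd_cat (braiding_arrow (twist U) (V \<otimes>\<^sub>y\<^sub>d W)) (assoc_arrow U V W))) =
    Comp yd_cat (farr tensor_fun (Id yd_cat (twist (twist V)), braiding_arrow (twist U) W))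
      (Comp yd_cat (assoc_arrow (twist V) (twist U) W) (farr tensor_fun (braiding_arrow U V, Id yd_cat (twist W))))"
proof -
  let ?U = "mspace U" and ?V = "mspace V" and ?W = "mspace W"
  let ?X = "?V \<boxtimes> ?W \<boxtimes> ?U"
  have "tensor_map K ?V (?W \<boxtimes> ?U) ?V (?W \<boxtimes> ?U) (\<lambda>m\<in>carrier ?V. m)
      (tensor_map K ?W ?U ?W ?U (\<lambda>m\<in>carrier ?W. m) (malpha U))
      (tassoc K ?V ?W ?U (br (twist U) (V \<otimes>\<^sub>y\<^sub>d W) (tassoc K ?U ?V ?W t))) =
    tensor_map K ?V (?U \<boxtimes> ?W) ?V (?W \<boxtimes> ?U) (\<lambda>m\<in>carrier ?V. m) (br (twist U) W)
      (tassoc K ?V ?U ?W (tensor_map K (?U \<boxtimes> ?V) ?W (?V \<boxtimes> ?U) ?W (br U V) (\<lambda>m\<in>carrier ?W. m) t))"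
    if t: "t \<in> carrier ((?U \<boxtimes> ?V) \<boxtimes> ?W)" for t
  proof (rule tensor_eqI3_left[OF t, where X = ?X])
    fix u v w assume [simp]: "u \<in> carrier ?U" "v \<in> carrier ?V" "w \<in> carrier ?W"
    let ?t = "pure K (?U \<boxtimes> ?V) ?W (pure K ?U ?V u v) w"
    show "tensor_map K ?V (?W \<boxtimes> ?U) ?V (?W \<boxtimes> ?U) (\<lambda>m\<in>carrier ?V. m)
      (tensor_map K ?W ?U ?W ?U (\<lambda>m\<in>carrier ?W. m) (malpha U))
      (tassoc K ?V ?W ?U (br (twist U) (V \<otimes>\<^sub>y\<^sub>d W) (tassoc K ?U ?V ?W ?t))) =
    tensor_map K ?V (?U \<boxtimes> ?W) ?V (?W \<boxtimes> ?U) (\<lambda>m\<in>carrier ?V. m) (br (twist U) W)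
      (tassoc K ?V ?U ?W (tensor_map K (?U \<boxtimes> ?V) ?W (?V \<boxtimes> ?U) ?W (br U V) (\<lambda>m\<in>carrier ?W. m) ?t))"
      \<comment> \<open>Evaluating both sides leaves the two sides of the coassociativity of \<open>U\<close>, under the
        trilinear expression \<open>(a, b, q) \<mapsto> \<alpha>\<^sup>-\<^sup>2(a) \<cdot> v \<otimes> (\<alpha>\<^sup>-\<^sup>2(b) \<cdot> w \<otimes> q)\<close>.\<close>
      using co_coassoc[of U u ?X "\<lambda>a b q. pure K ?V (?W \<boxtimes> ?U) (act K H V (ai (ai a)) v)
        (pure K ?W ?U (act K H W (ai (ai b)) w) q)"]
      by (simp add: lin_tensor_map lin_braiding)
  qed (simp_all add: lin_tensor_map lin_braiding)
  then show ?thesis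
    by (auto simp add: assoc_arrow_def braiding_arrow_def alpha_arrow_def compose_eq intro!: compose_eqI)
qed

lemma hexagon2:
  assumes [simp]: "yd U" "yd V" "yd W"
  shows "Comp yd_cat (farr tensor_fun (farr tensor_fun (alpha_arrow (twist W), Id yd_cat (twist U)), Id yd_cat (twist (twist V))))
      (Comp yd_cat (assoc_inv_arrow (twist W) (twist U) (twist V)) (Comp yd_cat (braiding_arrow (U \<otimes>\<^sub>y\<^sub>d V) (twist W)) (assoc_inv_arrow U V W))) =
    Comp yd_cat (farr tensor_fun (braiding_arrow U (twist W), Id yd_cat (twist (twist V))))
      (Comp yd_cat (assoc_inv_arrow U (twist W) (twist V)) (farr tensor_fun (Id yd_cat (twist U), braiding_arrow V W)))"
proof -
  let ?U = "mspace U" and ?V = "mspace V" and ?W = "mspace W"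
  let ?X = "(?W \<boxtimes> ?U) \<boxtimes> ?V"
  have "tensor_map K (?W \<boxtimes> ?U) ?V (?W \<boxtimes> ?U) ?V
      (tensor_map K ?W ?U ?W ?U (malpha W) (\<lambda>m\<in>carrier ?U. m)) (\<lambda>m\<in>carrier ?V. m)
      (tassoc_inv K ?W ?U ?V (br (U \<otimes>\<^sub>y\<^sub>d V) (twist W) (tassoc_inv K ?U ?V ?W t))) =
    tensor_map K (?U \<boxtimes> ?W) ?V (?W \<boxtimes> ?U) ?V (br U (twist W)) (\<lambda>m\<in>carrier ?V. m)
      (tassoc_inv K ?U ?W ?V (tensor_map K ?U (?V \<boxtimes> ?W) ?U (?W \<boxtimes> ?V) (\<lambda>m\<in>carrier ?U. m) (br V W) t))"
    if t: "t \<in> carrier (?U \<boxtimes> ?V \<boxtimes> ?W)" for t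
  proof (rule tensor_eqI3_right[OF t, where X = ?X])
    fix u v w assume [simp]: "u \<in> carrier ?U" "v \<in> carrier ?V" "w \<in> carrier ?W"
    let ?t = "pure K ?U (?V \<boxtimes> ?W) u (pure K ?V ?W v w)"
    \<comment> \<open>This is the module axiom for \<open>W\<close>; the factor \<open>\<alpha>\<^sub>W\<close> on the right is supplied by \<open>\<Phi>\<close>.\<close>
    have e': "act K H W p (act K H W (ai r) w) = act K H W (ai p \<star> ai r) (malpha W w)"
      if "p \<in> carrier A" "r \<in> carrier A" for p r
      using act_act[of W "ai p" "ai r" w] that by simp
    show "tensor_map K (?W \<boxtimes> ?U) ?V (?W \<boxtimes> ?U) ?V
      (tensor_map K ?W ?U ?W ?U (malpha W) (\<lambda>m\<in>carrier ?U. m)) (\<lambda>m\<in>carrier ?V. m)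
      (tassoc_inv K ?W ?U ?V (br (U \<otimes>\<^sub>y\<^sub>d V) (twist W) (tassoc_inv K ?U ?V ?W ?t))) =
    tensor_map K (?U \<boxtimes> ?W) ?V (?W \<boxtimes> ?U) ?V (br U (twist W)) (\<lambda>m\<in>carrier ?V. m)
      (tassoc_inv K ?U ?W ?V (tensor_map K ?U (?V \<boxtimes> ?W) ?U (?W \<boxtimes> ?V) (\<lambda>m\<in>carrier ?U. m) (br V W) ?t))"
      by (simp add: lin_tensor_map lin_braiding e') (rule sweedler_swap, simp_all)
  qed (simp_all add: lin_tensor_map lin_braiding)
  then show ?thesis
    by (auto simp add: assoc_inv_arrow_def braiding_arrow_def alpha_arrow_def compose_eq intro!: compose_eqI)
qed

lemma alpha_tensor:
  assumes [simp]: "yd X" "yd Y"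
  shows "alpha_arrow (X \<otimes>\<^sub>y\<^sub>d Y) = farr tensor_fun (alpha_arrow X, alpha_arrow Y)"
  by (simp add: alpha_arrow_def) (simp add: yd_tensor_def Let_def)

lemma hom_tensor_yd: "hom_tensor_category yd_cat tensor_fun twist_functor twist_functor assoc_arrow alpha_arrow"
proof (intro hom_tensor_category.intro hom_tensor_category_axioms.intro category_yd_cat is_functor_tensor
    is_functor_twist assoc_natural_iso alpha_natural)
  fix f g assume "f \<in> Arr yd_cat" "g \<in> Arr yd_cat"
  then show "farr twist_functor (farr tensor_fun (f, g)) = farr tensor_fun (farr twist_functor f, farr twist_functor g)"
    "farr twist_functor (farr tensor_fun (f, g)) = farr tensor_fun (farr twist_functor f, farr twist_functor g)"
    by (cases f; cases g; simp add: mor_def)+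
next
  fix X Y Z U assume "X \<in> Obj yd_cat" "Y \<in> Obj yd_cat" "Z \<in> Obj yd_cat" "U \<in> Obj yd_cat"
  then show "Comp yd_cat (assoc_arrow (fobj twist_functor X) (fobj twist_functor Y) (fobj tensor_fun (Z, U)))
      (assoc_arrow (fobj tensor_fun (X, Y)) (fobj twist_functor Z) (fobj twist_functor U)) =
    Comp yd_cat (farr tensor_fun (Id yd_cat (fobj twist_functor (fobj twist_functor X)), assoc_arrow Y Z U))
      (Comp yd_cat (assoc_arrow (fobj twist_functor X) (fobj tensor_fun (Y, Z)) (fobj twist_functor U))
        (farr tensor_fun (assoc_arrow X Y Z, Id yd_cat (fobj twist_functor (fobj twist_functor U)))))"
    using pentagon by simp
qed (use alpha_tensor in \<open>auto simp: alpha_arrow_def\<close>)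

lemma hom_braided_yd: "hom_braided_category yd_cat tensor_fun twist_functor twist_functor assoc_arrow alpha_arrow braiding_arrow"
proof (intro hom_braided_category.intro hom_braided_category_axioms.intro hom_tensor_yd braiding_natural)
  fix U V assume "U \<in> Obj yd_cat" "V \<in> Obj yd_cat"
  then show "farr twist_functor (braiding_arrow U V) = braiding_arrow (fobj twist_functor U) (fobj twist_functor V)" using braiding_twist by simp
next
  fix U V W assume yds: "U \<in> Obj yd_cat" "V \<in> Obj yd_cat" "W \<in> Obj yd_cat"
  show "Comp yd_cat (farr tensor_fun (Id yd_cat (fobj twist_functor (fobj twist_functor V)), farr tensor_fun (Id yd_cat (fobj twist_functor W), alpha_arrow (fobj twist_functor U))))
      (Comp yd_cat (assoc_arrow (fobj twist_functor V) (fobj twist_functor W) (fobj twist_functor U))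
        (Comp yd_cat (braiding_arrow (fobj twist_functor U) (fobj tensor_fun (V, W))) (assoc_arrow U V W))) =
    Comp yd_cat (farr tensor_fun (Id yd_cat (fobj twist_functor (fobj twist_functor V)), braiding_arrow (fobj twist_functor U) W))
      (Comp yd_cat (assoc_arrow (fobj twist_functor V) (fobj twist_functor U) W) (farr tensor_fun (braiding_arrow U V, Id yd_cat (fobj twist_functor W))))"
    using hexagon1[of U V W] yds by simp
  show "Comp yd_cat (farr tensor_fun (farr tensor_fun (alpha_arrow (fobj twist_functor W), Id yd_cat (fobj twist_functor U)), Id yd_cat (fobj twist_functor (fobj twist_functor V))))
      (Comp yd_cat (inverse_arrow yd_cat (assoc_arrow (fobj twist_functor W) (fobj twist_functor U) (fobj twist_functor V)))
        (Comp yd_cat (braiding_arrow (fobj tensor_fun (U, V)) (fobj twist_functor W)) (inverse_arrow yd_cat (assoc_arrow U V W)))) =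
    Comp yd_cat (farr tensor_fun (braiding_arrow U (fobj twist_functor W), Id yd_cat (fobj twist_functor (fobj twist_functor V))))
      (Comp yd_cat (inverse_arrow yd_cat (assoc_arrow U (fobj twist_functor W) (fobj twist_functor V)))
        (farr tensor_fun (Id yd_cat (fobj twist_functor U), braiding_arrow V W)))"
    using hexagon2[of U V W] yds by (simp add: inverse_arrow_assoc)
qed

end

theorem proposition7p5:
  fixes K :: "('k, 'r) ring_scheme"
    and H :: "('k, 'a tuniv) hom_bialg"
  assumes "field K"
    and "hom_bialgebra K H"
    and "halpha H = hpsi H"
    and "bij_betw (halpha H) (carrier (hspace H)) (carrier (hspace H))"
  shows "\<exists>F G a \<Phi>.
    preserves_underlying K H F \<and> preserves_underlying K H G \<and>
    hom_braided_category (yd_category K H) (yd_tensor_functor K H) F G a \<Phi>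
      (\<lambda>M N. (yd_tensor K H M N,
              yd_braiding K H M N,
              yd_tensor K H (fobj G N) (fobj G M)))"
proof -
  interpret yd_setting K H by (rule yd_setting.intro) fact+
  have "preserves_underlying K H twist_functor"
    by (auto simp: preserves_underlying_def)
  moreover have "hom_braided_category yd_cat tensor_fun twist_functor twist_functor assoc_arrow alpha_arrow
      (\<lambda>M N. (M \<otimes>\<^sub>y\<^sub>d N, br M N, fobj twist_functor N \<otimes>\<^sub>y\<^sub>d fobj twist_functor M))"
    using hom_braided_yd by (simp add: braiding_arrow_def[abs_def])
  ultimately show ?thesis by blast
qed

end
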